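(* Let $E=\{x_n\}\subseteq\mathbb{R}^d$ be a separated sequence, and let $\Lambda\subseteq\widehat{\mathbb{R}}^d$ be an S-set of strict multiplicity which is compact, convex, and symmetric about $0$. Let $G\in L^\infty(\widehat{\mathbb{R}}^d)$ be non-negative. If balayage is possible for $(E,\Lambda)$, then there exist $A,B>0$ such that for all $f\in PW_\Lambda\setminus\{0\}$, $F=\widehat f$, $$A\frac{\left(\int_\Lambda|F(\gamma)|^2G(\gamma)\,d\gamma\right)^2}{\int_\Lambda|F(\gamma)|^2\,d\gamma}\le\sum_{x\in E}|(FG)^\vee(x)|^2\le B\int_\Lambda|F(\gamma)|^2\,d\gamma.$$ Moreover $B$ can be taken as $B_1\|G\|_\infty^2$, where $B_1$ is a constant such that $\sum_{x\in E}|u(x)|^2\le B_1\|u\|_2^2$ for all $u\in PW_\Lambda$.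
   Context: Fourier transform $\widehat f(\gamma)=\int f(x)e^{-2\pi i x\cdot\gamma}dx$, inverse $F^\vee(x)=\int F(\gamma)e^{2\pi i x\cdot\gamma}d\gamma$; $\widehat{\mathbb{R}}^d$ is $\mathbb{R}^d$ as frequency domain; $F$ vanishes off $\Lambda$. $PW_\Lambda=\{f\in L^2(\mathbb{R}^d):\operatorname{supp}\widehat f\subseteq\Lambda\}$. $M_b(X)$: bounded complex Radon measures supported in closed $X$. $\mathcal{C}(\Lambda)=\{f\in C_b(\mathbb{R}^d):\operatorname{supp}\widehat f\subseteq\Lambda\}$. Balayage possible for $(E,\Lambda)$: every $\mu\in M_b(\mathbb{R}^d)$ has $\nu\in M_b(E)$ with $\widehat\mu=\widehat\nu$ on $\Lambda$. S-set: for all $f\in\mathcal{C}(\Lambda)$, $\mu\in M_b(\mathbb{R}^d)$ with $\widehat\mu=0$ on $\Lambda$, $\int f\,d\mu=0$. Strict multiplicity: some $\mu\in M_b(\Lambda)\setminus\{0\}$ with $|\mu^\vee(x)|\to0$ as $\|x\|\to\infty$. Separated: $\inf\{\|x-y\|:x\ne y\in E\}>0$ (for separated $E$, a constant $B_1$ as in the claim exists). *)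

theory Defs
  imports "HOL-Analysis.Analysis" "HOL-Probability.Essential_Supremum"
begin

definition fourier :: "('a::euclidean_space \<Rightarrow> complex) \<Rightarrow> 'a \<Rightarrow> complex" where
  "fourier f \<gamma> = (LINT x|lebesgue. f x * cis (- 2 * pi * (x \<bullet> \<gamma>)))"

definition ifourier :: "('a::euclidean_space \<Rightarrow> complex) \<Rightarrow> 'a \<Rightarrow> complex" where
  "ifourier F x = (LINT \<gamma>|lebesgue. F \<gamma> * cis (2 * pi * (x \<bullet> \<gamma>)))"

(* Bounded complex Radon measures on R^d are represented as  mu = h . M  with M a finite
   (positive) Borel measure and h an M-integrable complex density.  (Every finite Borel
   measure on R^d is Radon, and every bounded complex measure has such a representation,
   e.g. with M = |mu|.) *)
definition cmeasure :: "'a::euclidean_space measure \<Rightarrow> ('a \<Rightarrow> complex) \<Rightarrow> bool" where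
  "cmeasure M h \<longleftrightarrow> sets M = sets borel \<and> finite_measure M \<and> integrable M h"

definition cm_supp_in :: "'a::euclidean_space measure \<Rightarrow> ('a \<Rightarrow> complex) \<Rightarrow> 'a set \<Rightarrow> bool" where
  "cm_supp_in M h X \<longleftrightarrow> (AE x in M. h x \<noteq> 0 \<longrightarrow> x \<in> X)"

definition cm_fourier :: "'a::euclidean_space measure \<Rightarrow> ('a \<Rightarrow> complex) \<Rightarrow> 'a \<Rightarrow> complex" where
  "cm_fourier M h \<gamma> = (LINT x|M. h x * cis (- 2 * pi * (x \<bullet> \<gamma>)))"

definition cm_ifourier :: "'a::euclidean_space measure \<Rightarrow> ('a \<Rightarrow> complex) \<Rightarrow> 'a \<Rightarrow> complex" where
  "cm_ifourier M h x = (LINT \<gamma>|M. h \<gamma> * cis (2 * pi * (x \<bullet> \<gamma>)))"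

fun pderivs :: "'a::euclidean_space list \<Rightarrow> ('a \<Rightarrow> complex) \<Rightarrow> 'a \<Rightarrow> complex" where
  "pderivs [] f = f"
| "pderivs (v # vs) f = (\<lambda>x. vector_derivative (\<lambda>t::real. pderivs vs f (x + t *\<^sub>R v)) (at 0))"

definition smooth_fun :: "('a::euclidean_space \<Rightarrow> complex) \<Rightarrow> bool" where
  "smooth_fun f \<longleftrightarrow>
     (\<forall>vs \<in> lists Basis. continuous_on UNIV (pderivs vs f) \<and>
        (\<forall>v \<in> Basis. \<forall>x. (\<lambda>t::real. pderivs vs f (x + t *\<^sub>R v)) differentiable (at 0)))"

definition test_fun :: "('a::euclidean_space \<Rightarrow> complex) \<Rightarrow> bool" where
  "test_fun \<psi> \<longleftrightarrow> smooth_fun \<psi> \<and> compact (closure {x. \<psi> x \<noteq> 0})"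

(* for bounded continuous f: the distributional support of hat f lies in Lambda, i.e.
   <hat f, psi> = int f(x) hat psi(x) dx = 0 for every test function psi whose support
   does not meet Lambda *)
definition ft_supp_in :: "('a::euclidean_space \<Rightarrow> complex) \<Rightarrow> 'a set \<Rightarrow> bool" where
  "ft_supp_in f \<Lambda> \<longleftrightarrow>
     (\<forall>\<psi>. test_fun \<psi> \<and> closure {x. \<psi> x \<noteq> 0} \<inter> \<Lambda> = {} \<longrightarrow>
        (LINT x|lebesgue. f x * fourier \<psi> x) = 0)"

definition CLam :: "'a::euclidean_space set \<Rightarrow> ('a \<Rightarrow> complex) set" where
  "CLam \<Lambda> = {f. continuous_on UNIV f \<and> bounded (range f) \<and> ft_supp_in f \<Lambda>}"

definition balayage_possible :: "'a::euclidean_space set \<Rightarrow> 'a set \<Rightarrow> bool" where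
  "balayage_possible E \<Lambda> \<longleftrightarrow>
     (\<forall>M h. cmeasure M h \<longrightarrow>
        (\<exists>N k. cmeasure N k \<and> cm_supp_in N k E \<and>
               (\<forall>\<gamma>\<in>\<Lambda>. cm_fourier M h \<gamma> = cm_fourier N k \<gamma>)))"

definition S_set :: "'a::euclidean_space set \<Rightarrow> bool" where
  "S_set \<Lambda> \<longleftrightarrow>
     (\<forall>f \<in> CLam \<Lambda>. \<forall>M h. cmeasure M h \<and> (\<forall>\<gamma>\<in>\<Lambda>. cm_fourier M h \<gamma> = 0) \<longrightarrow>
        (LINT x|M. f x * h x) = 0)"

definition strict_multiplicity :: "'a::euclidean_space set \<Rightarrow> bool" where
  "strict_multiplicity \<Lambda> \<longleftrightarrow>
     (\<exists>M h. cmeasure M h \<and> cm_supp_in M h \<Lambda> \<and> \<not> (AE x in M. h x = 0) \<and>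
            (cm_ifourier M h \<longlongrightarrow> 0) at_infinity)"

definition separated :: "'a::euclidean_space set \<Rightarrow> bool" where
  "separated E \<longleftrightarrow> (\<exists>\<delta>>0. \<forall>x\<in>E. \<forall>y\<in>E. x \<noteq> y \<longrightarrow> \<delta> \<le> dist x y)"

(* F in L^2 vanishing off Lambda  (F = hat f, f in PW_Lambda) *)
definition L2_on :: "'a::euclidean_space set \<Rightarrow> ('a \<Rightarrow> complex) \<Rightarrow> bool" where
  "L2_on \<Lambda> F \<longleftrightarrow> F \<in> borel_measurable lebesgue \<and> integrable lebesgue (\<lambda>\<gamma>. (norm (F \<gamma>))\<^sup>2) \<and>
                   (\<forall>\<gamma>. \<gamma> \<notin> \<Lambda> \<longrightarrow> F \<gamma> = 0)"

definition Linf_norm :: "('a::euclidean_space \<Rightarrow> real) \<Rightarrow> real" where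
  "Linf_norm G = real_of_ereal (esssup lebesgue (\<lambda>\<gamma>. ereal \<bar>G \<gamma>\<bar>))"

end

theory Submission
  imports Defs "HOL-Probability.Probability" "HOL-Real_Asymp.Real_Asymp"
begin

text \<open>
  A gliding hump argument turns balayage into a uniform sampling inequality
  \<open>\<bar>h y\<bar> \<le> K sup\<^sub>E \<bar>h\<bar>\<close> for bounded functions \<open>h\<close> with spectrum in \<open>\<Lambda>\<close>. If \<open>\<Lambda>\<close> has empty
  interior it is a null set and there is nothing to show; otherwise \<open>0\<close> is an interior point.
  The inequality then survives an enlargement of the spectrum: for \<open>\<phi>\<close> with spectrum in
  \<open>(1 + \<epsilon>) \<Lambda>\<close>, apply it to the average over \<open>J\<close> dyadic scales \<open>\<delta>\<^sub>j\<close> of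
  \<open>\<phi>((1 - \<delta>\<^sub>j) x + \<delta>\<^sub>j z) \<eta>(\<delta>\<^sub>j (x - z) / 2)\<close>, where \<open>\<eta>\<close> is decaying, has small spectrum and \<open>\<eta> 0 = 1\<close>.
  By Bernstein's inequality the error at scale \<open>j\<close> is at most a constant times
  \<open>min(t, 1/t)\<close> with \<open>t = \<delta>\<^sub>j \<bar>x - z\<bar>\<close>, so the average error is \<open>O(1/J)\<close> and can be absorbed.

  With this room, multiplying \<open>f \<in> PW\<^sub>\<Lambda>\<close> by a translate of a square integrable \<open>\<theta>\<close> with small
  spectrum gives \<open>\<bar>f y\<bar>\<^sup>2 \<le> K\<^sup>2 \<Sum>\<^sub>x \<bar>f x\<bar>\<^sup>2 \<bar>\<theta>(x - y)\<bar>\<^sup>2\<close>; integrating in \<open>y\<close> yields the lower frame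
  bound, to which the statement for \<open>F G\<close> reduces by the Cauchy-Schwarz inequality. The upper bound is
  the Plancherel-Polya inequality for separated sets. Plancherel's theorem is replaced by
  integration against Gaussian weights.
\<close>

section \<open>Functions with prescribed spectrum\<close>

text \<open>The obstacle is that balayage controls only spectra inside \<Lambda> itself, whereas
  localising \<open>f\<close> by a multiplier enlarges its spectrum, so the sup inequality does not
  apply to the localised function directly. Contracting the argument towards \<open>z\<close> by 1 -
  \<delta> shrinks the spectrum; the room gained pays both for the enlargement and for the damping
  factor. A single scale would not do: the displacement is harmless where \<delta> |x - z| is small
  and the damping is effective where it is large, but where |x - z| is about 1 / \<delta> neither
  helps, however small \<delta> is. A given point is critical for boundedly many dyadic scales only,
  hence the average. Once \<open>f\<close> is localised, a supremum of squares over \<open>E\<close>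
  is dominated by their sum, and the square integrable envelope keeps the bound integrable in
  \<open>y\<close>. Of Plancherel's theorem only two inequalities are required, and their constants
  need not be sharp; a Gaussian weight makes every integral absolutely convergent
  beforehand.\<close>

definition trig :: "'b measure \<Rightarrow> ('b \<Rightarrow> complex) \<Rightarrow> ('b \<Rightarrow> 'a::euclidean_space) \<Rightarrow> 'a \<Rightarrow> complex" where
  "trig P c g x = (LINT \<omega>|P. c \<omega> * cis (2 * pi * (x \<bullet> g \<omega>)))"

text \<open>The parameter space and the frequency map \<open>g\<close> are arbitrary so that
  products and affine substitutions of such functions keep this form without any convolution: on a
  product space frequencies simply add. The support condition is imposed on the coefficient
  pointwise, so no closure of \<open>S\<close> is taken. Sigma-finiteness is there for Fubini's
  theorem.\<close>

definition spectral :: "'a::euclidean_space set \<Rightarrow> 'b measure \<Rightarrow> ('b \<Rightarrow> complex) \<Rightarrow> ('b \<Rightarrow> 'a) \<Rightarrow> bool" where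
  "spectral S P c g \<longleftrightarrow> sigma_finite_measure P \<and> integrable P c \<and> g \<in> borel_measurable P \<and>
     (\<forall>\<omega>\<in>space P. c \<omega> \<noteq> 0 \<longrightarrow> g \<omega> \<in> S)"

text \<open>
  The bounded functions on which equality of Fourier transforms on \<open>\<Lambda>\<close> can be tested. Unlike the
  functions \<open>trig P c g\<close> with a fixed \<open>P\<close>, they form a vector space.
\<close>

definition bal_fun :: "'a::euclidean_space set \<Rightarrow> ('a \<Rightarrow> complex) set" where
  "bal_fun \<Lambda> = {h. h \<in> borel_measurable borel \<and> bounded (range h) \<and>
     (\<forall>M k N l. cmeasure M k \<and> cmeasure N l \<and> (\<forall>\<gamma>\<in>\<Lambda>. cm_fourier M k \<gamma> = cm_fourier N l \<gamma>)
        \<longrightarrow> (LINT x|M. h x * k x) = (LINT x|N. h x * l x))}"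

lemma borel_measurable_cis [measurable]: "cis \<in> borel_measurable borel"
  by (intro borel_measurable_continuous_onI continuous_intros)

lemma integrable_pair_mult:
  fixes c :: "'a \<Rightarrow> complex" and d :: "'b \<Rightarrow> complex"
  assumes P: "sigma_finite_measure P" and Q: "sigma_finite_measure Q"
    and c: "integrable P c" and d: "integrable Q d"
    and B: "B \<in> borel_measurable (P \<Otimes>\<^sub>M Q)" and B1: "\<And>z. norm (B z :: complex) \<le> 1"
  shows "integrable (P \<Otimes>\<^sub>M Q) (\<lambda>z. c (fst z) * d (snd z) * B z)"
proof -
  interpret pair_sigma_finite P Q using P Q by (simp add: pair_sigma_finite_def)
  have [measurable]: "c \<in> borel_measurable P" "d \<in> borel_measurable Q" using c d by auto
  have "integrable (P \<Otimes>\<^sub>M Q) (\<lambda>z. c (fst z) * d (snd z))"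
    by (rule Fubini_integrable) (use c d in \<open>auto simp: norm_mult\<close>)
  then show ?thesis
  proof (rule Bochner_Integration.integrable_bound)
    show "(\<lambda>z. c (fst z) * d (snd z) * B z) \<in> borel_measurable (P \<Otimes>\<^sub>M Q)"
      using B by measurable
    show "AE z in P \<Otimes>\<^sub>M Q. norm (c (fst z) * d (snd z) * B z) \<le> norm (c (fst z) * d (snd z))"
      using B1 by (auto simp: norm_mult intro!: mult_left_le)
  qed
qed

lemma integrable_mult_bounded:
  fixes c :: "'a \<Rightarrow> complex"
  assumes "integrable P c" "b \<in> borel_measurable P" "\<And>x. x \<in> space P \<Longrightarrow> norm (b x :: complex) \<le> 1"
  shows "integrable P (\<lambda>x. c x * b x)"
  using assms(1)
proof (rule Bochner_Integration.integrable_bound)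
  show "(\<lambda>x. c x * b x) \<in> borel_measurable P" using assms by measurable
  show "AE x in P. norm (c x * b x) \<le> norm (c x)"
    using assms(3) by (auto simp: norm_mult intro!: mult_left_le)
qed

lemma norm_integral_bound:
  fixes f :: "'a \<Rightarrow> complex"
  assumes "integrable M f" "integrable M g" "\<And>x. x \<in> space M \<Longrightarrow> norm (f x) \<le> g x"
  shows "norm (LINT x|M. f x) \<le> (LINT x|M. g x)"
proof -
  have "norm (LINT x|M. f x) \<le> (LINT x|M. norm (f x))" by simp
  also have "\<dots> \<le> (LINT x|M. g x)" using assms by (intro integral_mono) auto
  finally show ?thesis .
qed

lemma borel_measurable_trig [measurable]:
  assumes "sigma_finite_measure P" and [measurable]: "c \<in> borel_measurable P" "g \<in> borel_measurable P"
  shows "trig P c g \<in> borel_measurable borel"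
proof -
  interpret sigma_finite_measure P by fact
  show ?thesis unfolding trig_def by measurable
qed

lemma norm_trig_le:
  assumes "integrable P c"
  shows "norm (trig P c g x) \<le> (LINT \<omega>|P. norm (c \<omega>))"
  unfolding trig_def using integral_norm_bound[of P "\<lambda>\<omega>. c \<omega> * cis (2 * pi * (x \<bullet> g \<omega>))"]
  by (simp add: norm_mult)

text \<open>Fubini's theorem moves the integral over \<open>M\<close> inside, which shows that the
  pairing sees the measure only through its Fourier transform at the points
  \<open>- g \<omega>\<close>.\<close>

lemma trig_pair_integral:
  assumes sp: "spectral S P c g" and cm: "cmeasure M k"
  shows "(LINT x|M. trig P c g x * k x) = (LINT \<omega>|P. c \<omega> * (LINT x|M. k x * cis (2 * pi * (x \<bullet> g \<omega>))))"
proof -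
  have P: "sigma_finite_measure P" and c: "integrable P c" and [measurable]: "g \<in> borel_measurable P"
    using sp by (auto simp: spectral_def)
  have [measurable_cong]: "sets M = sets borel" and fin: "finite_measure M" and k: "integrable M k"
    using cm by (auto simp: cmeasure_def)
  have M: "sigma_finite_measure M" using fin by (simp add: finite_measure_def)
  interpret pair_sigma_finite M P using P M by (simp add: pair_sigma_finite_def)
  have I: "integrable (M \<Otimes>\<^sub>M P) (\<lambda>z. k (fst z) * c (snd z) * cis (2 * pi * (fst z \<bullet> g (snd z))))"
    by (rule integrable_pair_mult[OF M P k c]) auto
  have "(LINT x|M. trig P c g x * k x) = (LINT x|M. (LINT \<omega>|P. k x * c \<omega> * cis (2 * pi * (x \<bullet> g \<omega>))))"
    unfolding trig_def
    by (subst mult.commute, subst integral_mult_right_zero[symmetric]) (simp add: mult.assoc)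
  also have "\<dots> = (LINT \<omega>|P. (LINT x|M. k x * c \<omega> * cis (2 * pi * (x \<bullet> g \<omega>))))"
    using Fubini_integral[of "\<lambda>x \<omega>. k x * c \<omega> * cis (2 * pi * (x \<bullet> g \<omega>))"] I
    by (simp add: case_prod_beta')
  also have "\<dots> = (LINT \<omega>|P. c \<omega> * (LINT x|M. k x * cis (2 * pi * (x \<bullet> g \<omega>))))"
    by (intro Bochner_Integration.integral_cong refl)
       (simp add: mult.assoc mult.left_commute)
  finally show ?thesis .
qed

text \<open>Equality of the transforms on \<Lambda> makes the inner integrals of
  \<open>trig_pair_integral\<close> agree. Symmetry enters because that pairing carries the
  exponential with a plus sign, \<open>cm_fourier\<close> with a minus sign.\<close>

lemma trig_in_bal_fun:
  assumes sp: "spectral \<Lambda> P c g" and sym: "\<forall>\<gamma>\<in>\<Lambda>. - \<gamma> \<in> \<Lambda>"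
  shows "trig P c g \<in> bal_fun \<Lambda>"
proof -
  have P: "sigma_finite_measure P" and c: "integrable P c" and g: "g \<in> borel_measurable P"
    using sp by (auto simp: spectral_def)
  have "trig P c g \<in> borel_measurable borel" using P c g by measurable
  moreover have "bounded (range (trig P c g))"
    using norm_trig_le[OF c, of g] by (auto simp: bounded_iff)
  moreover have "(LINT x|M. trig P c g x * k x) = (LINT x|N. trig P c g x * l x)"
    if "cmeasure M k" "cmeasure N l" and eq: "\<forall>\<gamma>\<in>\<Lambda>. cm_fourier M k \<gamma> = cm_fourier N l \<gamma>" for M k N l
    unfolding trig_pair_integral[OF sp that(1)] trig_pair_integral[OF sp that(2)]
  proof (intro Bochner_Integration.integral_cong refl)
    fix \<omega> assume w: "\<omega> \<in> space P"
    show "c \<omega> * (LINT x|M. k x * cis (2 * pi * (x \<bullet> g \<omega>))) = c \<omega> * (LINT x|N. l x * cis (2 * pi * (x \<bullet> g \<omega>)))"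
    proof (cases "c \<omega> = 0")
      case False
      then have "- g \<omega> \<in> \<Lambda>" using sp sym w by (auto simp: spectral_def)
      then show ?thesis using eq by (force simp: cm_fourier_def)
    qed simp
  qed
  ultimately show ?thesis by (auto simp: bal_fun_def)
qed

lemma bal_fun_scale: "h \<in> bal_fun \<Lambda> \<Longrightarrow> (\<lambda>x. a * h x) \<in> bal_fun \<Lambda>"
proof -
  assume h: "h \<in> bal_fun \<Lambda>"
  have "bounded ((\<lambda>z. a * z) ` range h)"
    by (rule bounded_linear_image[OF _ bounded_linear_mult_right]) (use h in \<open>auto simp: bal_fun_def\<close>)
  then show ?thesis using h by (auto simp: bal_fun_def image_image mult.assoc)
qed

lemma cmeasure_integrable_bounded:
  assumes "cmeasure M k" "h \<in> borel_measurable borel" "bounded (range h)"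
  shows "integrable M (\<lambda>x. h x * k x)"
proof -
  obtain B where B: "\<And>x. norm (h x) \<le> B" "B > 0" using assms(3) by (auto simp: bounded_pos)
  have [measurable_cong]: "sets M = sets borel" and k: "integrable M k"
    using assms(1) by (auto simp: cmeasure_def)
  have "integrable M (\<lambda>x. k x * (h x / of_real B))"
    by (rule integrable_mult_bounded[OF k]) (use assms B in \<open>auto simp: norm_divide\<close>)
  then have "integrable M (\<lambda>x. of_real B * (k x * (h x / of_real B)))"
    by (intro integrable_mult_right)
  moreover have "(\<lambda>x. of_real B * (k x * (h x / of_real B))) = (\<lambda>x. h x * k x)"
    using B(2) by auto
  ultimately show ?thesis by simp
qed

lemma bal_fun_sum:
  assumes "finite I" "\<And>i. i \<in> I \<Longrightarrow> h i \<in> bal_fun \<Lambda>"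
  shows "(\<lambda>x. \<Sum>i\<in>I. h i x) \<in> bal_fun \<Lambda>"
proof -
  have [measurable]: "\<And>i. i \<in> I \<Longrightarrow> h i \<in> borel_measurable borel" using assms by (auto simp: bal_fun_def)
  have "bounded (range (\<lambda>x. \<Sum>i\<in>I. h i x))"
    using assms
  proof (induction I rule: finite_induct)
    case (insert i I)
    then have "bounded (range (\<lambda>x. h i x + (\<Sum>i\<in>I. h i x)))"
      by (intro bounded_plus_comp) (auto simp: bal_fun_def)
    then show ?case using insert by simp
  qed simp
  moreover have "(LINT x|M. (\<Sum>i\<in>I. h i x) * k x) = (LINT x|N. (\<Sum>i\<in>I. h i x) * l x)"
    if M: "cmeasure M k" and N: "cmeasure N l" and eq: "\<forall>\<gamma>\<in>\<Lambda>. cm_fourier M k \<gamma> = cm_fourier N l \<gamma>" for M k N l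
  proof -
    have "integrable M (\<lambda>x. h i x * k x)" "integrable N (\<lambda>x. h i x * l x)"
       "(LINT x|M. h i x * k x) = (LINT x|N. h i x * l x)" if "i \<in> I" for i
      using assms(2)[OF that] M N eq by (auto simp: bal_fun_def intro!: cmeasure_integrable_bounded)
    then show ?thesis by (simp add: sum_distrib_right Bochner_Integration.integral_sum)
  qed
  ultimately show ?thesis by (auto simp: bal_fun_def)
qed

text \<open>Exponentials multiply by adding frequencies, so the integral over the product space
  factors. Passing to \<open>P \<Otimes>\<^sub>M Q\<close> takes the place of convolving the
  spectra.\<close>

lemma trig_prod:
  fixes f :: "'b \<Rightarrow> 'a::euclidean_space" and g :: "'c \<Rightarrow> 'a"
  assumes 1: "spectral S P c f" and 2: "spectral T Q d g"
    and sub: "\<And>s t. s \<in> S \<Longrightarrow> t \<in> T \<Longrightarrow> s + t \<in> U"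
  defines "c' \<equiv> \<lambda>z. c (fst z) * d (snd z)" and "g' \<equiv> \<lambda>z. f (fst z) + g (snd z)"
  shows "spectral U (P \<Otimes>\<^sub>M Q) c' g'" and "trig (P \<Otimes>\<^sub>M Q) c' g' x = trig P c f x * trig Q d g x"
proof -
  have P: "sigma_finite_measure P" and c: "integrable P c" and [measurable]: "f \<in> borel_measurable P"
    using 1 by (auto simp: spectral_def)
  have Q: "sigma_finite_measure Q" and d: "integrable Q d" and [measurable]: "g \<in> borel_measurable Q"
    using 2 by (auto simp: spectral_def)
  interpret pair_sigma_finite P Q using P Q by (simp add: pair_sigma_finite_def)
  have [measurable]: "g' \<in> borel_measurable (P \<Otimes>\<^sub>M Q)" unfolding g'_def by measurable
  have I: "integrable (P \<Otimes>\<^sub>M Q) c'"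
    using integrable_pair_mult[OF P Q c d, of "\<lambda>_. 1"] by (simp add: c'_def)
  have "sigma_finite_measure (P \<Otimes>\<^sub>M Q)" ..
  then show "spectral U (P \<Otimes>\<^sub>M Q) c' g'"
    using I 1 2 sub by (auto simp: spectral_def space_pair_measure c'_def g'_def)
  have I: "integrable (P \<Otimes>\<^sub>M Q) (\<lambda>z. c' z * cis (2 * pi * (x \<bullet> g' z)))"
    by (rule integrable_mult_bounded[OF I]) auto
  have eq: "c' (s, t) * cis (2 * pi * (x \<bullet> g' (s, t))) = (c s * cis (2 * pi * (x \<bullet> f s))) * (d t * cis (2 * pi * (x \<bullet> g t)))" for s t

  proof -
    have "cis (2 * pi * (x \<bullet> g' (s, t))) = cis (2 * pi * (x \<bullet> f s)) * cis (2 * pi * (x \<bullet> g t))"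
      unfolding cis_mult by (simp add: g'_def inner_add_right distrib_left)
    then show ?thesis unfolding c'_def fst_conv snd_conv by (simp only: mult_ac)
  qed
  have "trig (P \<Otimes>\<^sub>M Q) c' g' x = (LINT s|P. LINT t|Q. c' (s, t) * cis (2 * pi * (x \<bullet> g' (s, t))))"
    unfolding trig_def using integral_fst'[OF I] by simp
  also have "\<dots> = trig P c f x * trig Q d g x"
    by (simp only: eq integral_mult_right_zero integral_mult_left_zero trig_def)
  finally show "trig (P \<Otimes>\<^sub>M Q) c' g' x = trig P c f x * trig Q d g x" .
qed

text \<open>Translation by \<open>a\<close> becomes a phase in the coefficient, dilation by
  \<open>r\<close> a dilation of the frequencies.\<close>

lemma trig_affine:
  fixes f :: "'b \<Rightarrow> 'a::euclidean_space" and a :: 'a and r :: real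
  assumes 1: "spectral S P c f"
  defines "c' \<equiv> \<lambda>\<omega>. c \<omega> * cis (2 * pi * (a \<bullet> f \<omega>))" and "f' \<equiv> \<lambda>\<omega>. r *\<^sub>R f \<omega>"
  shows "spectral ((*\<^sub>R) r ` S) P c' f'" and "trig P c' f' x = trig P c f (a + r *\<^sub>R x)"
proof -
  have c: "integrable P c" and [measurable]: "f \<in> borel_measurable P"
    using 1 by (auto simp: spectral_def)
  have "integrable P c'" unfolding c'_def by (rule integrable_mult_bounded[OF c]) auto
  then show "spectral ((*\<^sub>R) r ` S) P c' f'"
    using 1 by (auto simp: spectral_def c'_def f'_def)
  have "cis (2 * pi * (a \<bullet> f \<omega>)) * cis (2 * pi * (x \<bullet> f' \<omega>)) = cis (2 * pi * ((a + r *\<^sub>R x) \<bullet> f \<omega>))" for \<omega>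
    unfolding cis_mult by (simp add: f'_def inner_add_left distrib_left)
  then show "trig P c' f' x = trig P c f (a + r *\<^sub>R x)"
    unfolding trig_def c'_def by (simp only: mult.assoc)
qed

lemma trig_mult:
  fixes f :: "'b \<Rightarrow> 'a::euclidean_space"
  assumes 1: "spectral S P c f" and 2: "spectral T Q d g"
    and sub: "\<And>s t. s \<in> S \<Longrightarrow> t \<in> T \<Longrightarrow> r *\<^sub>R s + q *\<^sub>R t \<in> U"
  shows "\<exists>c' g'. spectral U (P \<Otimes>\<^sub>M Q) c' g' \<and> 
     (\<forall>x. trig (P \<Otimes>\<^sub>M Q) c' g' x = trig P c f (a + r *\<^sub>R x) * trig Q d g (b + q *\<^sub>R x))"
proof -
  note A = trig_affine[OF 1, where a=a and r=r] and B = trig_affine[OF 2, where a=b and r=q]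
  have U: "s + t \<in> U" if "s \<in> (*\<^sub>R) r ` S" "t \<in> (*\<^sub>R) q ` T" for s t
    using that sub by auto
  show ?thesis
    using trig_prod[OF A(1) B(1) U] unfolding A(2) B(2) by blast
qed

section \<open>The uniform sampling inequality\<close>

text \<open>
  Decide greedily whether to include the \<open>n\<close>-th term: one of the two choices keeps the \<open>n\<close>-th
  functional away from \<open>0\<close>, and the weights \<open>5\<^sup>-\<^sup>n\<close> make the later terms harmless. This gives the
  positive measure on which balayage fails.
\<close>

lemma gliding_hump_set:
  fixes v :: "nat \<Rightarrow> nat \<Rightarrow> complex"
  assumes diag: "\<And>n. norm (v n n) \<ge> 4/5"
  shows "\<exists>T. \<forall>n. norm (\<Sum>i | i \<in> T \<and> i \<le> n. (1/5)^i * v n i) \<ge> 2/5 * (1/5)^n"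
proof -
  define f where "f n A = (if norm (\<Sum>i\<in>A. (1/5)^i * v n i) \<ge> 2/5 * (1/5)^n then A else insert n A)"
    for n :: nat and A
  define S where "S = rec_nat {} f"
  have S: "S 0 = {}" "S (Suc n) = f n (S n)" for n by (auto simp: S_def)
  have sub: "S n \<subseteq> {..<n}" for n
    by (induction n) (auto simp: S f_def split: if_splits)
  \<comment> \<open>Stage \<open>n\<close> decides only the membership of \<open>n\<close>, so the
    stages are the traces of their union on initial segments, and the sum up to \<open>n\<close> is
    settled by stage n + 1.\<close>
  have mono: "S m = S n \<inter> {..<m}" if "m \<le> n" for m n
    using that
  proof (induction n)
    case (Suc n)
    show ?case
    proof (cases "m = Suc n")
      case True then show ?thesis using sub by auto
    next
      case False
      then have "m \<le> n" using Suc by auto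
      then have "S m = S n \<inter> {..<m}" using Suc by auto
      moreover have "S (Suc n) \<inter> {..<m} = S n \<inter> {..<m}" using \<open>m \<le> n\<close> by (auto simp: S f_def)
      ultimately show ?thesis by simp
    qed
  qed (auto simp: S)
  have T: "{i. i \<in> (\<Union>n. S n) \<and> i \<le> m} = S (Suc m)" for m
  proof -
    have "i \<in> S (Suc m)" if "i \<in> S n" "i \<le> m" for i n
      using mono[of "Suc m" n] mono[of n "Suc m"] that
      by (metis Int_iff le_imp_less_Suc lessThan_iff nat_le_linear)
    moreover have "i \<le> m" if "i \<in> S (Suc m)" for i using sub[of "Suc m"] that by auto
    ultimately show ?thesis by blast
  qed
  have "norm (\<Sum>i\<in>S (Suc n). (1/5)^i * v n i) \<ge> 2/5 * (1/5)^n" for n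
  proof (cases "norm (\<Sum>i\<in>S n. (1/5)^i * v n i) \<ge> 2/5 * (1/5)^n")
    case True then show ?thesis by (simp add: S f_def)
  next
    case False
    have "n \<notin> S n" "finite (S n)" using sub[of n] finite_subset by auto
    then have eq: "(\<Sum>i\<in>S (Suc n). (1/5)^i * v n i) = (1/5)^n * v n n + (\<Sum>i\<in>S n. (1/5)^i * v n i)"
      using False by (simp add: S f_def)
    \<comment> \<open>In this branch the earlier sum stays below 2/5 of \<open>(1/5)^n\<close>,
      while the inserted term is at least 4/5 of it.\<close>
    have "norm ((1/5)^n * v n n) \<ge> 4/5 * (1/5)^n"
      using diag[of n] by (simp add: norm_mult norm_power norm_divide divide_simps)
    then show ?thesis unfolding eq using False
      norm_diff_ineq[of "(1/5)^n * v n n" "\<Sum>i\<in>S n. (1/5)^i * v n i"] by linarith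
  qed
  then show ?thesis using T by (intro exI[of _ "\<Union>n. S n"]) auto
qed

text \<open>The atomic measure with mass \<open>w i\<close> at \<open>Y i\<close>, realised as the
  image of a weighted counting measure; this form allows repeated points. With density 1 it can be
  fed to the balayage hypothesis directly.\<close>

lemma discrete_cmeasure:
  fixes Y :: "nat \<Rightarrow> 'a::euclidean_space" and w :: "nat \<Rightarrow> real"
  assumes w: "\<And>i. w i \<ge> 0" and sw: "summable w"
  shows "\<exists>M. cmeasure M (\<lambda>_. 1) \<and> (\<forall>h. h \<in> borel_measurable borel \<longrightarrow> bounded (range h) \<longrightarrow>
     (\<lambda>i. w i *\<^sub>R h (Y i)) sums (LINT x|M. h x :: complex))"
proof -
  define D where "D = density (count_space UNIV) (\<lambda>i. ennreal (w i))"
  define M where "M = distr D borel Y"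
  have [measurable]: "Y \<in> measurable D borel" by (simp add: D_def)
  have "emeasure D (space D) = (\<Sum>i. ennreal (w i))"
    by (simp add: D_def emeasure_density nn_integral_count_space_nat)
  also have "\<dots> < \<infinity>" using suminf_ennreal2[OF w sw] by simp
  finally have "finite_measure D" by (intro finite_measureI) auto
  then have fin: "finite_measure M" unfolding M_def by (rule finite_measure.finite_measure_distr) simp
  have cm: "cmeasure M (\<lambda>_. 1)"
    unfolding cmeasure_def using fin by (simp add: finite_measure.integrable_const) (simp add: M_def)
  moreover have "(\<lambda>i. w i *\<^sub>R h (Y i)) sums (LINT x|M. h x)"
    if h[measurable]: "h \<in> borel_measurable borel" and b: "bounded (range h)" for h :: "'a \<Rightarrow> complex"
  proof -
    have "integrable M (\<lambda>x. h x * 1)" using cm h b by (rule cmeasure_integrable_bounded)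
    then have "integrable D (\<lambda>i. h (Y i))" unfolding M_def by (simp add: integrable_distr_eq)
    then have int: "integrable (count_space UNIV) (\<lambda>i. w i *\<^sub>R h (Y i))"
      unfolding D_def using w by (subst (asm) integrable_density) auto
    have "(LINT x|M. h x) = (LINT i|D. h (Y i))" unfolding M_def by (simp add: integral_distr)
    also have "\<dots> = (LINT i|count_space UNIV. w i *\<^sub>R h (Y i))"
      unfolding D_def using w by (subst integral_density) auto
    finally show ?thesis using sums_integral_count_space_nat[OF int] by simp
  qed
  ultimately show ?thesis by blast
qed

lemma bal_fun_eq:
  assumes "h \<in> bal_fun \<Lambda>" "cmeasure M k" "cmeasure N l" "\<forall>\<gamma>\<in>\<Lambda>. cm_fourier M k \<gamma> = cm_fourier N l \<gamma>"
  shows "(LINT x|M. h x * k x) = (LINT x|N. h x * l x)"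
  using assms(1) unfolding bal_fun_def mem_Collect_eq using assms(2-4) by meson

text \<open>A uniform boundedness argument carried out by hand. If no constant works, there are
  functions \<open>H n\<close> bounded by 1, of size at least 4/5 at some \<open>Y n\<close>, yet at
  most \<open>(1/6)^n\<close> on \<open>E\<close>. An atomic measure with weights among the
  \<open>(1/5)^i\<close> pairs with \<open>H n\<close> to something of order \<open>(1/5)^n\<close>,
  but any measure on \<open>E\<close> with the same transform on \<Lambda> only to something of
  order \<open>(1/6)^n\<close>.\<close>

lemma balayage_sup_bound:
  fixes E \<Lambda> :: "'a::euclidean_space set"
  assumes bal: "balayage_possible E \<Lambda>"
  shows "\<exists>K>0. \<forall>h\<in>bal_fun \<Lambda>. \<forall>y s. 0 \<le> s \<longrightarrow> (\<forall>x\<in>E. norm (h x) \<le> s) \<longrightarrow> norm (h y) \<le> K * s"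
proof (rule ccontr)
  assume neg: "\<not> ?thesis"
  have "\<exists>h y. h \<in> bal_fun \<Lambda> \<and> (\<forall>x. norm (h x) \<le> 1) \<and> norm (h y) \<ge> 4/5 \<and> (\<forall>x\<in>E. norm (h x) \<le> (1/6)^n)" for n :: nat
  proof -
    have "(6::real)^n > 0" by simp
    then obtain h y s where h: "h \<in> bal_fun \<Lambda>" and s: "0 \<le> s" "\<forall>x\<in>E. norm (h x) \<le> s" and y: "norm (h y) > 6^n * s"
      using neg[unfolded not_ex, rule_format, of "6^n"] by (auto simp: not_le)
    define m where "m = (SUP x. norm (h x))"
    have bdd: "bdd_above (range (\<lambda>x. norm (h x)))"
      using h by (auto simp: bal_fun_def bounded_iff bdd_above_def)
    have m: "norm (h x) \<le> m" for x unfolding m_def by (rule cSUP_upper[OF _ bdd]) simp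
    have pos: "m > 6^n * s" "m > 0" 
    proof -
      show "m > 6^n * s" using m[of y] y by linarith
      moreover have "6^n * s \<ge> 0" using s by simp
      ultimately show "m > 0" by linarith
    qed
    \<comment> \<open>The supremum need not be attained; a fixed fraction of it is what a single
      point can guarantee after normalisation.\<close>
    have "4/5 * m < m" using pos by simp
    then obtain z where z: "norm (h z) > 4/5 * m"
      unfolding m_def by (metis (no_types, lifting) less_cSUP_iff[OF _ bdd] UNIV_not_empty)
    have "(\<lambda>x. (1 / of_real m) * h x) \<in> bal_fun \<Lambda>" by (rule bal_fun_scale[OF h])
    moreover have "norm ((1 / of_real m) * h x) = norm (h x) / m" for x
      using pos by (simp add: norm_mult norm_divide)
    moreover have "norm (h x) / m \<le> (1/6)^n" if "x \<in> E" for x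
    proof -
      have "6^n * norm (h x) \<le> 6^n * s" using s(2) that by (intro mult_left_mono) auto
      then have "6^n * norm (h x) \<le> m" using pos(1) by linarith
      then show ?thesis using pos(2) by (simp add: power_one_over divide_simps mult.commute)
    qed
    moreover have "norm (h x) / m \<le> 1" for x using m pos by simp
    moreover have "norm (h z) / m \<ge> 4/5" using z pos by (simp add: field_simps)
    ultimately show ?thesis 
      by (intro exI[of _ "\<lambda>x. (1 / of_real m) * h x"] exI[of _ z] conjI allI ballI)
         (simp_all only:)
  qed
  then obtain H Y where H: "\<And>n. H n \<in> bal_fun \<Lambda>" "\<And>n x. norm (H n x) \<le> 1"
      "\<And>n. norm (H n (Y n)) \<ge> 4/5" "\<And>n x. x \<in> E \<Longrightarrow> norm (H n x) \<le> (1/6)^n"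
    by metis
  obtain T where T: "\<And>n. norm (\<Sum>i | i \<in> T \<and> i \<le> n. (1/5)^i * H n (Y i)) \<ge> 2/5 * (1/5)^n"
    using gliding_hump_set[of "\<lambda>n i. H n (Y i)"] H(3) by blast
  define w :: "nat \<Rightarrow> real" where "w i = (if i \<in> T then (1/5)^i else 0)" for i
  have w0: "w i \<ge> 0" for i by (simp add: w_def)
  have sw: "summable w" by (rule summable_comparison_test'[of "\<lambda>i. (1/5)^i" 0]) (auto simp: w_def)
  obtain M where M: "cmeasure M (\<lambda>_. 1)" and sums: "\<And>h. h \<in> borel_measurable borel \<Longrightarrow> bounded (range h) \<Longrightarrow>
     (\<lambda>i. w i *\<^sub>R h (Y i)) sums (LINT x|M. h x :: complex)"
    using discrete_cmeasure[of w Y, OF w0 sw] by blast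
  obtain N k where N: "cmeasure N k" "cm_supp_in N k E" "\<forall>\<gamma>\<in>\<Lambda>. cm_fourier M (\<lambda>_. 1) \<gamma> = cm_fourier N k \<gamma>"
    using bal[unfolded balayage_possible_def, rule_format, OF M] by auto
  define L where "L = (LINT x|N. norm (k x))"
  \<comment> \<open>In units of \<open>(1/5)^n\<close> the selected terms up to \<open>n\<close>
    give 2/5 and the later ones at most the geometric tail 1/4; the difference is 3/20.\<close>
  have lower: "norm (LINT x|M. H n x) \<ge> 3/20 * (1/5)^n" for n
  proof -
    define u where "u i = w i *\<^sub>R H n (Y i)" for i
    have s: "u sums (LINT x|M. H n x)" unfolding u_def
      by (rule sums) (use H(1)[of n] in \<open>auto simp: bal_fun_def\<close>)
    have nu: "norm (u i) \<le> (1/5)^i" for i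
      using H(2)[of n "Y i"] by (auto simp: u_def w_def intro!: mult_left_le)
    have "(\<Sum>i. u i) = (\<Sum>i. u (i + Suc n)) + (\<Sum>i<Suc n. u i)"
      using s by (intro suminf_split_initial_segment) (auto simp: sums_iff)
    moreover have "(\<Sum>i<Suc n. u i) = (\<Sum>i | i \<in> T \<and> i \<le> n. (1/5)^i * H n (Y i))"
    proof -
      have "(\<Sum>i<Suc n. u i) = (\<Sum>i\<in>{..<Suc n}. if i \<in> T then (1/5)^i * H n (Y i) else 0)"
        by (intro sum.cong refl) (auto simp: u_def w_def scaleR_conv_of_real)
      also have "\<dots> = (\<Sum>i\<in>{..<Suc n} \<inter> T. (1/5)^i * H n (Y i))" by (simp add: sum.inter_restrict)
      also have "{..<Suc n} \<inter> T = {i. i \<in> T \<and> i \<le> n}" by auto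
      finally show ?thesis .
    qed
    moreover have "norm (\<Sum>i. u (i + Suc n)) \<le> 1/4 * (1/5)^n"
    proof -
      have g: "(\<lambda>i. (1/5::real)^(i + Suc n)) sums (1/4 * (1/5)^n)"
        using sums_mult[OF geometric_sums[of "1/5::real"], of "(1/5)^Suc n"]
        by (simp add: power_add field_simps)
      have "norm (\<Sum>i. u (i + Suc n)) \<le> (\<Sum>i. (1/5::real)^(i + Suc n))"
        using nu sums_summable[OF g] by (intro norm_suminf_le)
      then show ?thesis using g by (simp add: sums_iff)
    qed
    ultimately have "norm (\<Sum>i. u i) \<ge> 2/5 * (1/5)^n - 1/4 * (1/5)^n"
      using T[of n]
        norm_diff_ineq[of "\<Sum>i | i \<in> T \<and> i \<le> n. (1/5)^i * H n (Y i)" "\<Sum>i. u (i + Suc n)"]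
      by (smt (verit) add.commute)
    moreover have "(LINT x|M. H n x) = (\<Sum>i. u i)" using s by (rule sums_unique)
    ultimately show ?thesis by simp
  qed
  \<comment> \<open>The second measure lives on \<open>E\<close>, where \<open>H n\<close> is at
    most \<open>(1/6)^n\<close>, and \<open>L\<close> is its total variation.\<close>
  have upper: "norm (LINT x|M. H n x) \<le> L * (1/6)^n" for n
  proof -
    have b: "H n \<in> borel_measurable borel" "bounded (range (H n))" using H(1)[of n] by (auto simp: bal_fun_def)
    have "(LINT x|M. H n x * 1) = (LINT x|N. H n x * k x)"
      by (rule bal_fun_eq[OF H(1) M N(1) N(3)])
    then have "norm (LINT x|M. H n x) = norm (LINT x|N. H n x * k x)" by simp
    also have "\<dots> \<le> (LINT x|N. norm (H n x * k x))" by simp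
    also have "\<dots> \<le> (LINT x|N. norm (k x) * (1/6)^n)"
    proof (rule integral_mono_AE)
      show "integrable N (\<lambda>x. norm (H n x * k x))"
        using cmeasure_integrable_bounded[OF N(1) b] by simp
      show "integrable N (\<lambda>x. norm (k x) * (1/6)^n)" using N(1) by (simp add: cmeasure_def)
      show "AE x in N. norm (H n x * k x) \<le> norm (k x) * (1/6)^n"
        using N(2) unfolding cm_supp_in_def
      proof eventually_elim
        case (elim x)
        then show ?case using H(4)[of x n] by (cases "k x = 0") (auto simp: norm_mult mult.commute intro!: mult_left_mono)
      qed
    qed
    finally show ?thesis by (simp add: L_def)
  qed
  obtain n where n: "20/3 * L < (6/5::real)^n" using real_arch_pow[of "6/5::real" "20/3 * L"] by force
  have p: "(1/5::real)^n * 6^n = (6/5)^n" "(1/6::real)^n * 6^n = 1"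
    by (subst power_mult_distrib[symmetric], simp)+
  have "3/20 * (1/5)^n \<le> L * (1/6)^n" using lower[of n] upper[of n] by linarith
  then have "3/20 * (1/5)^n * 6^n \<le> L * (1/6)^n * 6^n" by (rule mult_right_mono) simp
  then have "3/20 * (6/5)^n \<le> L" unfolding mult.assoc p by simp
  with n show False by linarith
qed

section \<open>Bernstein's inequality\<close>

text \<open>
  Bernstein's inequality comes from \<open>a = arcsin (sin a) = \<Sum>\<^sub>n c\<^sub>n (sin a)\<^sup>2\<^sup>n\<^sup>+\<^sup>1\<close>: multiplication of the
  spectrum by a sine is a symmetric difference operator of norm at most \<open>1\<close>, and
  \<open>\<Sum>\<^sub>n c\<^sub>n < \<infinity>\<close>.
\<close>

lemma arcsin_sums:
  "\<exists>c :: nat \<Rightarrow> real. (\<forall>n. 0 \<le> c n) \<and> (\<forall>x. \<bar>x\<bar> < 1 \<longrightarrow> (\<lambda>n. c n * x^(2*n+1)) sums arcsin x)"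
proof -
  \<comment> \<open>\<open>b n\<close> is the coefficient of \<open>y^n\<close> in the binomial
    series of \<open>(1 - y) powr (-1/2)\<close>, nonnegative because the alternating signs cancel.
    Division by 2 n + 1 is termwise integration of \<open>b n * x^(2*n)\<close>.\<close>
  define b where "b n = ((-1/2::real) gchoose n) * (-1)^n" for n
  define c where "c n = b n / (2 * real n + 1)" for n
  have b0: "b n \<ge> 0" for n
  proof -
    have "b n = pochhammer (1/2) n / fact n"
      unfolding b_def gbinomial_pochhammer by (cases "even n") simp_all
    then show ?thesis by (simp add: pochhammer_nonneg)
  qed
  have c0: "c n \<ge> 0" and cb: "c n \<le> b n" for n
    using b0[of n] by (auto simp: c_def divide_le_eq mult_le_cancel_left1)
  have bs: "(\<lambda>n. b n * y^n) sums (1 - y) powr (-1/2)" if "\<bar>y\<bar> < 1" for y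
  proof -
    have "((-1/2) gchoose n) * (- y)^n = b n * y^n" for n
      unfolding b_def by (cases "even n") simp_all
    then show ?thesis using gen_binomial_real[of "-y" "-1/2"] that by simp
  qed
  have cs: "summable (\<lambda>n. c n * y^n)" if "\<bar>y\<bar> < 1" for y
  proof (rule summable_comparison_test')
    show "summable (\<lambda>n. b n * \<bar>y\<bar>^n)" using bs[of "\<bar>y\<bar>"] that by (auto simp: sums_iff)
    show "norm (c n * y^n) \<le> b n * \<bar>y\<bar>^n" for n
      using c0[of n] cb[of n] by (auto simp: abs_mult power_abs intro!: mult_right_mono)
  qed
  \<comment> \<open>The candidate for arcsin. Factoring out \<open>x\<close> leaves a power series
    in \<open>x^2\<close>, which is differentiated by the chain rule.\<close>
  define A where "A x = x * (\<Sum>n. c n * (x^2)^n)" for x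
  have deriv: "(A has_real_derivative inverse (sqrt (1 - x^2))) (at x)" if x: "\<bar>x\<bar> < 1" for x
  proof -
    have y: "\<bar>x^2\<bar> < 1" using x by (simp add: abs_square_less_1)
    \<comment> \<open>Termwise differentiation at \<open>x^2\<close> needs summability at a point
      strictly beyond it.\<close>
    then obtain K where K: "x^2 < K" "K < 1" using dense by (metis abs_of_nonneg zero_le_power2)
    then have "summable (\<lambda>n. c n * K^n)" using cs[of K] by (smt (verit) zero_le_power2)
    then have d: "((\<lambda>y. \<Sum>n. c n * y^n) has_real_derivative (\<Sum>n. diffs c n * (x^2)^n)) (at (x^2))"
      by (rule termdiffs_strong) (use K in auto)
    have ds: "summable (\<lambda>n. diffs c n * (x^2)^n)"
      by (rule termdiff_converges[of _ 1]) (use y cs in auto)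
    have "(\<lambda>n. real n * c n * (x^2)^(n - Suc 0)) sums (\<Sum>n. diffs c n * (x^2)^n)"
      using diffs_equiv[OF ds] by simp
    then have "(\<lambda>n. x^2 * (real n * c n * (x^2)^(n - Suc 0))) sums (x^2 * (\<Sum>n. diffs c n * (x^2)^n))"
      by (rule sums_mult)
    moreover have "x^2 * (real n * c n * (x^2)^(n - Suc 0)) = real n * c n * (x^2)^n" for n
      by (cases n) auto
    ultimately have "(\<lambda>n. real n * c n * (x^2)^n) sums (x^2 * (\<Sum>n. diffs c n * (x^2)^n))" by simp
    from sums_add[OF summable_sums[OF cs[OF y]] sums_mult[OF this, of 2]]
    have "(\<lambda>n. c n * (x^2)^n + 2 * (real n * c n * (x^2)^n)) sums
        ((\<Sum>n. c n * (x^2)^n) + 2 * (x^2 * (\<Sum>n. diffs c n * (x^2)^n)))" .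
    \<comment> \<open>The factor 2 n + 1 produced by differentiating \<open>x^(2*n+1)\<close>
      restores the binomial coefficients, so the derivative of \<open>A\<close> sums to the
      derivative of arcsin.\<close>
    moreover have "c n * v + 2 * (real n * c n * v) = b n * v" for n v
    proof -
      have "b n = c n * (2 * real n + 1)" by (simp add: c_def)
      then show ?thesis by (simp add: algebra_simps)
    qed
    ultimately have "(\<lambda>n. b n * (x^2)^n) sums ((\<Sum>n. c n * (x^2)^n) + 2 * (x^2 * (\<Sum>n. diffs c n * (x^2)^n)))"
      by (simp only:)
    with bs[OF y] have eq: "(\<Sum>n. c n * (x^2)^n) + 2 * (x^2 * (\<Sum>n. diffs c n * (x^2)^n)) = (1 - x^2) powr (-1/2)"
      using sums_unique2 by blast
    let ?S = "\<Sum>n. c n * (x^2)^n" and ?D = "\<Sum>n. diffs c n * (x^2)^n"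
    have sq: "((\<lambda>z::real. z^2) has_real_derivative 2 * x) (at x)"
      by (auto intro!: derivative_eq_intros)
    have "((\<lambda>z. \<Sum>n. c n * (z^2)^n) has_real_derivative ?D * (2 * x)) (at x)"
      by (rule DERIV_chain2[where f="\<lambda>y. \<Sum>n. c n * y^n" and g="\<lambda>z. z^2", OF d sq])
    from DERIV_mult[OF DERIV_ident this]
    have "(A has_real_derivative 1 * ?S + ?D * (2 * x) * x) (at x)"
      unfolding A_def .
    moreover have "1 * ?S + ?D * (2 * x) * x = ?S + 2 * (x^2 * ?D)"
      by (simp add: power2_eq_square)
    moreover have "(1 - x^2) powr (-1/2) = inverse (sqrt (1 - x^2))"
      using y by (simp add: powr_minus powr_half_sqrt)
    ultimately show ?thesis using eq by (simp only:)
  qed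
  have "A x = arcsin x" if x: "\<bar>x\<bar> < 1" for x
  proof -
    have d0: "((\<lambda>x. A x - arcsin x) has_real_derivative 0) (at y)" if "y \<in> {-1<..<1}" for y
    proof -
      have "\<bar>y\<bar> < 1" "- 1 < y" "y < 1" using that by auto
      then show ?thesis using DERIV_diff[OF deriv[of y] DERIV_arcsin[of y]] by simp
    qed
    have xx: "- 1 < x" "x < 1" using x by auto
    have "A x - arcsin x = A 0 - arcsin 0"
      using DERIV_isconst3[of "-1" 1 x 0 "\<lambda>x. A x - arcsin x"] d0 xx by simp
    then show ?thesis by (simp add: A_def)
  qed
  moreover have "(\<lambda>n. c n * x^(2*n+1)) sums A x" if x: "\<bar>x\<bar> < 1" for x
  proof -
    have "\<bar>x^2\<bar> < 1" using x by (simp add: abs_square_less_1)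
    from sums_mult[OF summable_sums[OF cs[OF this]], of x]
    have "(\<lambda>n. x * (c n * (x^2)^n)) sums A x" unfolding A_def .
    moreover have "x * (c n * (x^2)^n) = c n * x^(2*n+1)" for n
      by (simp add: power_mult)
    ultimately show ?thesis by (simp only:)
  qed
  ultimately show ?thesis using c0 by (intro exI[of _ c]) auto
qed

text \<open>Since the coefficients are nonnegative, the partial sums of the series at x < 1 lie
  below \<open>arcsin x\<close>, hence below \<open>pi / 2\<close>; letting \<open>x\<close> tend to
  1 in these finite sums bounds the partial sums of \<open>c\<close>. The bound 2 is a coarse form
  of \<open>pi / 2\<close>. As 1 < \<open>pi / 2\<close>, the sine of an admissible \<open>a\<close>
  lies strictly between -1 and 1 and arcsin inverts it.\<close>

lemma angle_sin_sums:
  obtains c :: "nat \<Rightarrow> real" where "\<And>n. 0 \<le> c n" "summable c" "suminf c \<le> 2"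
    "\<And>a. \<bar>a\<bar> \<le> 1 \<Longrightarrow> (\<lambda>n. c n * sin a^(2*n+1)) sums a"
proof -
  obtain c :: "nat \<Rightarrow> real" where c: "\<And>n. 0 \<le> c n" "\<And>x. \<bar>x\<bar> < 1 \<Longrightarrow> (\<lambda>n. c n * x^(2*n+1)) sums arcsin x"
    using arcsin_sums by auto
  have part: "(\<Sum>n<N. c n) \<le> 2" for N
  proof (rule tendsto_upperbound)
    show "((\<lambda>x. \<Sum>n<N. c n * x^(2*n+1)) \<longlongrightarrow> (\<Sum>n<N. c n)) (at_left 1)"
      by (rule tendsto_eq_intros refl | simp)+
    have "eventually (\<lambda>x::real. x \<in> {0<..<1}) (at_left 1)" by (rule eventually_at_left_real) simp
    then show "\<forall>\<^sub>F x in at_left 1. (\<Sum>n<N. c n * x^(2*n+1)) \<le> 2"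
    proof eventually_elim
      case (elim x)
      have "(\<Sum>n<N. c n * x^(2*n+1)) \<le> arcsin x"
      proof -
        have s: "(\<lambda>n. c n * x^(2*n+1)) sums arcsin x" using c(2)[of x] elim by simp
        have "(\<Sum>n<N. c n * x^(2*n+1)) \<le> (\<Sum>n. c n * x^(2*n+1))"
          by (rule sum_le_suminf[OF sums_summable[OF s]]) (use elim c(1) in auto)
        then show ?thesis using sums_unique[OF s] by (simp only:)
      qed
      also have "\<dots> \<le> pi / 2" using elim by (intro arcsin_ubound) auto
      also have "\<dots> \<le> 2" using pi_less_4 by simp
      finally show ?case .
    qed
  qed simp
  have sm: "summable c" using c(1) part by (intro summableI_nonneg_bounded)
  show ?thesis
  proof (rule that[of c])
    show "suminf c \<le> 2" using sm part by (rule suminf_le_const)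
    show "(\<lambda>n. c n * sin a^(2*n+1)) sums a" if a: "\<bar>a\<bar> \<le> 1" for a
    proof -
      have p: "- (pi/2) < a" "a < pi/2" using a pi_gt3 by auto
      have "cos a > 0" using p by (rule cos_gt_zero_pi)
      then have "sin a ^ 2 < 1" 
        using sin_cos_squared_add[of a] zero_less_power[of "cos a" 2] by linarith
      then have "\<bar>sin a\<bar> < 1" by (simp add: abs_square_less_1)
      then show ?thesis using c(2)[of "sin a"] p by (simp add: arcsin_sin)
    qed
  qed (use c sm in auto)
qed

lemma norm_sin_power_le_1: "norm (complex_of_real (sin t ^ n)) \<le> 1"
  unfolding norm_of_real power_abs by (rule power_le_one) auto

text \<open>The Fourier multiplier with symbol sin (2 pi (u \<bullet> \<gamma>)). As a symmetric
  difference divided by 2 \<open>\<i>\<close> it visibly preserves every sup bound.\<close>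

definition sindiff :: "'a::euclidean_space \<Rightarrow> ('a \<Rightarrow> complex) \<Rightarrow> 'a \<Rightarrow> complex" where
  "sindiff u \<phi> x = (\<phi> (x + u) - \<phi> (x - u)) / (2 * \<i>)"

lemma cis_sin: "(cis (a + b) - cis (a - b)) / (2 * \<i>) = cis a * sin b"
proof -
  have "cis (a + b) - cis (a - b) = 2 * \<i> * (cis a * sin b)"
    by (simp add: complex_eq_iff sin_add sin_diff cos_add cos_diff)
  then show ?thesis by simp
qed

lemma sindiff_trig:
  assumes "integrable P c" and [measurable]: "g \<in> borel_measurable P"
  shows "sindiff u (trig P c g) = trig P (\<lambda>\<omega>. c \<omega> * of_real (sin (2 * pi * (u \<bullet> g \<omega>)))) g"
proof
  fix x
  have I: "integrable P (\<lambda>\<omega>. c \<omega> * cis (2 * pi * (y \<bullet> g \<omega>)))" for y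
    by (rule integrable_mult_bounded[OF assms(1)]) auto
  have "sindiff u (trig P c g) x =
      (LINT \<omega>|P. (c \<omega> * cis (2 * pi * ((x + u) \<bullet> g \<omega>)) - c \<omega> * cis (2 * pi * ((x - u) \<bullet> g \<omega>))) / (2 * \<i>))"
    using I by (simp add: sindiff_def trig_def)
  also have "\<dots> = trig P (\<lambda>\<omega>. c \<omega> * of_real (sin (2 * pi * (u \<bullet> g \<omega>)))) g x"
    unfolding trig_def
  proof (intro Bochner_Integration.integral_cong refl)
    fix \<omega>
    show "(c \<omega> * cis (2 * pi * ((x + u) \<bullet> g \<omega>)) - c \<omega> * cis (2 * pi * ((x - u) \<bullet> g \<omega>))) / (2 * \<i>)
      = c \<omega> * of_real (sin (2 * pi * (u \<bullet> g \<omega>))) * cis (2 * pi * (x \<bullet> g \<omega>))"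
    proof -
      define A B where "A = 2 * pi * (x \<bullet> g \<omega>)" and "B = 2 * pi * (u \<bullet> g \<omega>)"
      have e: "2 * pi * ((x + u) \<bullet> g \<omega>) = A + B" "2 * pi * ((x - u) \<bullet> g \<omega>) = A - B"
        by (simp_all add: A_def B_def inner_add_left inner_diff_left distrib_left right_diff_distrib)
      have "(c \<omega> * cis (A + B) - c \<omega> * cis (A - B)) / (2 * \<i>) = c \<omega> * ((cis (A + B) - cis (A - B)) / (2 * \<i>))"
        by (simp only: right_diff_distrib times_divide_eq_right)
      also have "\<dots> = c \<omega> * of_real (sin B) * cis A"
        by (simp only: cis_sin mult.assoc mult.commute[of "cis A"])
      finally show ?thesis unfolding e by (simp only: A_def B_def)
    qed
  qed
  finally show "sindiff u (trig P c g) x = trig P (\<lambda>\<omega>. c \<omega> * of_real (sin (2 * pi * (u \<bullet> g \<omega>)))) g x" .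
qed

lemma sindiff_pow_trig:
  assumes "integrable P c" and [measurable]: "g \<in> borel_measurable P"
  shows "(sindiff u ^^ n) (trig P c g) = trig P (\<lambda>\<omega>. c \<omega> * of_real (sin (2 * pi * (u \<bullet> g \<omega>)) ^ n)) g"
proof (induction n)
  case (Suc n)
  have I: "integrable P (\<lambda>\<omega>. c \<omega> * of_real (sin (2 * pi * (u \<bullet> g \<omega>)) ^ n))"
    by (rule integrable_mult_bounded[OF assms(1) _ norm_sin_power_le_1]) simp
  have "(sindiff u ^^ Suc n) (trig P c g) = sindiff u (trig P (\<lambda>\<omega>. c \<omega> * of_real (sin (2 * pi * (u \<bullet> g \<omega>)) ^ n)) g)"
    by (simp only: funpow.simps o_apply Suc.IH)
  also have "\<dots> = trig P (\<lambda>\<omega>. (c \<omega> * of_real (sin (2 * pi * (u \<bullet> g \<omega>)) ^ n)) * of_real (sin (2 * pi * (u \<bullet> g \<omega>)))) g"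
    by (rule sindiff_trig[OF I assms(2)])
  also have "\<dots> = trig P (\<lambda>\<omega>. c \<omega> * of_real (sin (2 * pi * (u \<bullet> g \<omega>)) ^ Suc n)) g"
    by (simp only: power_Suc2 of_real_mult mult.assoc)
  finally show ?case .
qed simp

lemma sindiff_pow_bound:
  assumes "\<And>x. norm (\<phi> x) \<le> m"
  shows "norm ((sindiff u ^^ n) \<phi> x) \<le> m"
proof (induction n arbitrary: x)
  case (Suc n)
  have "norm ((sindiff u ^^ n) \<phi> (x + u) - (sindiff u ^^ n) \<phi> (x - u)) \<le> m + m"
    using Suc by (intro order_trans[OF norm_triangle_ineq4] add_mono)
  then show ?case by (simp add: sindiff_def[of _ "(sindiff u ^^ n) \<phi>"] norm_divide norm_mult)
qed (use assms in auto)

text \<open>Up to a factor \<open>\<i>\<close> the left side is the derivative of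
  \<open>trig P c g\<close> along \<open>u\<close>. Its symbol is small enough to be expanded in odd
  powers of its sine, so it is a series of iterates of \<open>sindiff u\<close>, each bounded by
  \<open>m\<close>; the sum of the coefficients gives the factor 2.\<close>

lemma trig_dirderiv_bound:
  assumes c: "integrable P c" and [measurable]: "g \<in> borel_measurable P"
    and small: "\<And>\<omega>. \<omega> \<in> space P \<Longrightarrow> c \<omega> \<noteq> 0 \<Longrightarrow> \<bar>2 * pi * (u \<bullet> g \<omega>)\<bar> \<le> 1"
    and m: "\<And>x. norm (trig P c g x) \<le> m"
  shows "norm (trig P (\<lambda>\<omega>. c \<omega> * of_real (2 * pi * (u \<bullet> g \<omega>))) g x) \<le> 2 * m"
proof -
  obtain b :: "nat \<Rightarrow> real" where b: "\<And>n. 0 \<le> b n" "summable b" "suminf b \<le> 2"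
    "\<And>a. \<bar>a\<bar> \<le> 1 \<Longrightarrow> (\<lambda>n. b n * sin a^(2*n+1)) sums a"
    using angle_sin_sums by blast
  define a where "a \<omega> = 2 * pi * (u \<bullet> g \<omega>)" for \<omega>
  have [measurable]: "a \<in> borel_measurable P" unfolding a_def by measurable
  define f where "f n \<omega> = of_real (b n) * (c \<omega> * of_real (sin (a \<omega>)^(2*n+1)) * cis (2 * pi * (x \<bullet> g \<omega>)))" for n \<omega>
  have nf: "norm (f n \<omega>) \<le> b n * norm (c \<omega>)" for n \<omega>
  proof -
    have "norm (f n \<omega>) = b n * (norm (c \<omega>) * norm (complex_of_real (sin (a \<omega>)^(2*n+1))))"
      unfolding f_def norm_mult norm_cis norm_of_real[of "b n"] using b(1)[of n] by simp
    also have "\<dots> \<le> b n * (norm (c \<omega>) * 1)"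
      by (intro mult_left_mono norm_sin_power_le_1 b(1) norm_ge_zero)
    finally show ?thesis by simp
  qed
  have I: "integrable P (\<lambda>\<omega>. c \<omega> * of_real (sin (a \<omega>)^(2*n+1)))" for n
    by (rule integrable_mult_bounded[OF c _ norm_sin_power_le_1]) measurable
  have fi: "integrable P (f n)" for n
    unfolding f_def by (intro integrable_mult_right integrable_mult_bounded[OF I]) auto
  have sn: "summable (\<lambda>n. norm (f n \<omega>))" for \<omega>
    by (rule summable_comparison_test'[of "\<lambda>n. b n * norm (c \<omega>)" 0]) (use nf summable_mult2[OF b(2)] in auto)
  have "(\<lambda>n. LINT \<omega>|P. f n \<omega>) sums (LINT \<omega>|P. (\<Sum>n. f n \<omega>))"
  proof (rule sums_integral)
    show "summable (\<lambda>n. LINT \<omega>|P. norm (f n \<omega>))"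
    proof (rule summable_comparison_test'[of "\<lambda>n. b n * (LINT \<omega>|P. norm (c \<omega>))" 0])
      show "norm (LINT \<omega>|P. norm (f n \<omega>)) \<le> b n * (LINT \<omega>|P. norm (c \<omega>))" for n
      proof -
        have "(LINT \<omega>|P. norm (f n \<omega>)) \<le> (LINT \<omega>|P. b n * norm (c \<omega>))"
          using fi c nf by (intro integral_mono) auto
        then show ?thesis by simp
      qed
    qed (use summable_mult2[OF b(2)] in auto)
  qed (use fi sn in auto)
  moreover have "(LINT \<omega>|P. f n \<omega>) = of_real (b n) * (sindiff u ^^ (2*n+1)) (trig P c g) x" for n
    unfolding sindiff_pow_trig[OF assms(1,2)] trig_def f_def a_def integral_mult_right_zero ..
  moreover have "(LINT \<omega>|P. (\<Sum>n. f n \<omega>)) = trig P (\<lambda>\<omega>. c \<omega> * of_real (a \<omega>)) g x"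
    unfolding trig_def
  proof (intro Bochner_Integration.integral_cong refl)
    fix \<omega> assume w: "\<omega> \<in> space P"
    show "(\<Sum>n. f n \<omega>) = c \<omega> * of_real (a \<omega>) * cis (2 * pi * (x \<bullet> g \<omega>))"
    proof (cases "c \<omega> = 0")
      case False
      then have "(\<lambda>n. b n * sin (a \<omega>)^(2*n+1)) sums a \<omega>" using b(4) small w by (simp add: a_def)
      then have "(\<lambda>n. c \<omega> * cis (2 * pi * (x \<bullet> g \<omega>)) * of_real (b n * sin (a \<omega>)^(2*n+1))) sums
          (c \<omega> * cis (2 * pi * (x \<bullet> g \<omega>)) * of_real (a \<omega>))"
        by (intro sums_mult sums_of_real)
      moreover have "f n \<omega> = c \<omega> * cis (2 * pi * (x \<bullet> g \<omega>)) * of_real (b n * sin (a \<omega>)^(2*n+1))" for n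
        unfolding f_def by (simp only: of_real_mult mult_ac)
      ultimately have "(\<lambda>n. f n \<omega>) sums (c \<omega> * cis (2 * pi * (x \<bullet> g \<omega>)) * of_real (a \<omega>))"
        by (simp only:)
      then have "(\<Sum>n. f n \<omega>) = c \<omega> * cis (2 * pi * (x \<bullet> g \<omega>)) * of_real (a \<omega>)"
        by (rule sums_unique[symmetric])
      then show ?thesis by (simp only: mult_ac)
    qed (simp add: f_def)
  qed
  ultimately have S: "(\<lambda>n. of_real (b n) * (sindiff u ^^ (2*n+1)) (trig P c g) x) sums trig P (\<lambda>\<omega>. c \<omega> * of_real (a \<omega>)) g x"
    by (simp only:)
  have m0: "m \<ge> 0" using m[of 0] norm_ge_zero order_trans by blast
  have "norm (trig P (\<lambda>\<omega>. c \<omega> * of_real (a \<omega>)) g x) \<le> (\<Sum>n. b n * m)"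
    unfolding sums_unique[OF S]
  proof (rule norm_suminf_le)
    show "norm (of_real (b n) * (sindiff u ^^ (2*n+1)) (trig P c g) x) \<le> b n * m" for n
      unfolding norm_mult norm_of_real abs_of_nonneg[OF b(1)]
      by (intro mult_left_mono sindiff_pow_bound m b(1))
  qed (rule summable_mult2[OF b(2)])
  also have "\<dots> = suminf b * m" using suminf_mult2[OF b(2)] by simp
  also have "\<dots> \<le> 2 * m" using b(3) m0 by (intro mult_right_mono)
  finally show ?thesis by (simp add: a_def)
qed

lemma cis_taylor1: "norm (cis t - 1 - \<i> * of_real t) \<le> t^2"
proof -
  have "norm (cis t - 1 - \<i> * of_real t) \<le> t^2 / 2"
    using iexp_approx1[of t 1] by (simp add: cis_conv_exp eval_nat_numeral diff_diff_eq)
  also have "\<dots> \<le> t^2" by simp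
  finally show ?thesis .
qed

text \<open>A first-order Taylor expansion under the integral sign. The remainder is controlled by
  the integral of \<open>norm (c \<omega>)\<close> instead of \<open>m\<close>, but it is quadratic
  in \<open>t\<close> and disappears when a long step is subdivided. Differentiability of
  \<open>trig\<close> need not be established.\<close>

lemma trig_step_bound:
  assumes c: "integrable P c" and [measurable]: "g \<in> borel_measurable P"
    and small: "\<And>\<omega>. \<omega> \<in> space P \<Longrightarrow> c \<omega> \<noteq> 0 \<Longrightarrow> \<bar>2 * pi * (u \<bullet> g \<omega>)\<bar> \<le> 1"
    and m: "\<And>x. norm (trig P c g x) \<le> m" and t: "0 \<le> t"
  shows "norm (trig P c g (x + t *\<^sub>R u) - trig P c g x) \<le> 2 * m * t + t^2 * (LINT \<omega>|P. norm (c \<omega>))"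
proof -
  define a where "a \<omega> = 2 * pi * (u \<bullet> g \<omega>)" for \<omega>
  have [measurable]: "a \<in> borel_measurable P" "c \<in> borel_measurable P" unfolding a_def using c by measurable
  let ?e = "\<lambda>\<omega>. cis (2 * pi * (x \<bullet> g \<omega>))"
  have I1: "integrable P (\<lambda>\<omega>. c \<omega> * cis (2 * pi * (y \<bullet> g \<omega>)))" for y
    by (rule integrable_mult_bounded[OF c]) auto
  have "integrable P (\<lambda>\<omega>. c \<omega> * of_real (a \<omega>))"
    using c
  proof (rule Bochner_Integration.integrable_bound)
    have "norm (c \<omega> * of_real (a \<omega>)) \<le> norm (c \<omega>)" if "\<omega> \<in> space P" for \<omega>
      using small[OF that] by (cases "c \<omega> = 0") (auto simp: norm_mult a_def intro!: mult_left_le)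
    then show "AE \<omega> in P. norm (c \<omega> * of_real (a \<omega>)) \<le> norm (c \<omega>)" by auto
  qed simp
  then have I2: "integrable P (\<lambda>\<omega>. c \<omega> * of_real (a \<omega>) * ?e \<omega>)"
    by (rule integrable_mult_bounded) auto
  let ?D = "trig P (\<lambda>\<omega>. c \<omega> * of_real (a \<omega>)) g x"
  have eq: "trig P c g (x + t *\<^sub>R u) - trig P c g x - \<i> * of_real t * ?D =
     (LINT \<omega>|P. c \<omega> * ?e \<omega> * (cis (t * a \<omega>) - 1 - \<i> * of_real (t * a \<omega>)))"
  proof -
    have alg: "z * (e * v) - z * e - \<i> * r * (z * b * e) = z * e * (v - 1 - \<i> * (r * b))" for z e v r b
      by (simp add: algebra_simps)
    have "trig P c g (x + t *\<^sub>R u) - trig P c g x - \<i> * of_real t * ?D =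
      (LINT \<omega>|P. c \<omega> * cis (2 * pi * ((x + t *\<^sub>R u) \<bullet> g \<omega>)) - c \<omega> * ?e \<omega> - \<i> * of_real t * (c \<omega> * of_real (a \<omega>) * ?e \<omega>))"
      unfolding trig_def using I1 I2 by simp
    also have "\<dots> = (LINT \<omega>|P. c \<omega> * ?e \<omega> * (cis (t * a \<omega>) - 1 - \<i> * of_real (t * a \<omega>)))"
    proof (intro Bochner_Integration.integral_cong refl)
      fix \<omega>
      have "2 * pi * ((x + t *\<^sub>R u) \<bullet> g \<omega>) = 2 * pi * (x \<bullet> g \<omega>) + t * a \<omega>"
        by (simp add: a_def algebra_simps)
      then have "cis (2 * pi * ((x + t *\<^sub>R u) \<bullet> g \<omega>)) = ?e \<omega> * cis (t * a \<omega>)"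
        by (simp add: cis_mult)
      then show "c \<omega> * cis (2 * pi * ((x + t *\<^sub>R u) \<bullet> g \<omega>)) - c \<omega> * ?e \<omega> - \<i> * of_real t * (c \<omega> * of_real (a \<omega>) * ?e \<omega>)
        = c \<omega> * ?e \<omega> * (cis (t * a \<omega>) - 1 - \<i> * of_real (t * a \<omega>))"
        using alg[of "c \<omega>" "?e \<omega>" "cis (t * a \<omega>)" "of_real t" "of_real (a \<omega>)"] by simp
    qed
    finally show ?thesis .
  qed
  have I3: "integrable P (\<lambda>\<omega>. c \<omega> * cis (2 * pi * ((x + t *\<^sub>R u) \<bullet> g \<omega>)) - c \<omega> * ?e \<omega> - \<i> * of_real t * (c \<omega> * of_real (a \<omega>) * ?e \<omega>))"
    using I1 I2 by auto
  have "norm (LINT \<omega>|P. c \<omega> * ?e \<omega> * (cis (t * a \<omega>) - 1 - \<i> * of_real (t * a \<omega>))) \<le> (LINT \<omega>|P. t^2 * norm (c \<omega>))"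
  proof (rule norm_integral_bound)
    have pt: "norm (c \<omega> * ?e \<omega> * (cis (t * a \<omega>) - 1 - \<i> * of_real (t * a \<omega>))) \<le> t^2 * norm (c \<omega>)" if w: "\<omega> \<in> space P" for \<omega>
    proof (cases "c \<omega> = 0")
      case False
      have "\<bar>a \<omega>\<bar> \<le> 1" using small[OF w False] by (simp add: a_def)
      then have "(a \<omega>)^2 \<le> 1" by (simp add: abs_square_le_1)
      then have "(t * a \<omega>)^2 \<le> t^2" by (simp add: power_mult_distrib mult_left_le)
      then have "norm (cis (t * a \<omega>) - 1 - \<i> * of_real (t * a \<omega>)) \<le> t^2" using cis_taylor1 order_trans by blast
      then show ?thesis by (simp add: norm_mult mult.commute[of "t^2"] mult_left_mono)
    qed simp
    show "norm (c \<omega> * ?e \<omega> * (cis (t * a \<omega>) - 1 - \<i> * of_real (t * a \<omega>))) \<le> t^2 * norm (c \<omega>)" if "\<omega> \<in> space P" for \<omega>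
      using pt that .
    show i: "integrable P (\<lambda>\<omega>. t^2 * norm (c \<omega>))" using c by auto
    show "integrable P (\<lambda>\<omega>. c \<omega> * ?e \<omega> * (cis (t * a \<omega>) - 1 - \<i> * of_real (t * a \<omega>)))"
      using i by (rule Bochner_Integration.integrable_bound) (use pt in auto)
  qed
  then have "norm (trig P c g (x + t *\<^sub>R u) - trig P c g x - \<i> * of_real t * ?D) \<le> t^2 * (LINT \<omega>|P. norm (c \<omega>))"
    unfolding eq by simp
  moreover have "norm (\<i> * of_real t * ?D) \<le> 2 * m * t"
    using trig_dirderiv_bound[OF assms(1-4), of x] t by (simp add: norm_mult a_def mult.commute[of _ t] mult_left_mono)
  ultimately show ?thesis
    using norm_triangle_sub[of "trig P c g (x + t *\<^sub>R u) - trig P c g x" "\<i> * of_real t * ?D"] by linarith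
qed

text \<open>Cutting the step \<open>s\<close> into n + 1 equal pieces leaves a total remainder
  \<open>s^2 * ?L / (n + 1)\<close>, which tends to 0; only the term from Bernstein's inequality
  survives.\<close>

lemma trig_lipschitz_dir:
  assumes c: "integrable P c" and g: "g \<in> borel_measurable P"
    and small: "\<And>\<omega>. \<omega> \<in> space P \<Longrightarrow> c \<omega> \<noteq> 0 \<Longrightarrow> \<bar>2 * pi * (u \<bullet> g \<omega>)\<bar> \<le> 1"
    and m: "\<And>x. norm (trig P c g x) \<le> m" and s: "0 \<le> s"
  shows "norm (trig P c g (x + s *\<^sub>R u) - trig P c g x) \<le> 2 * m * s"
proof (rule tendsto_lowerbound)
  let ?L = "LINT \<omega>|P. norm (c \<omega>)"
  show "(\<lambda>n. 2 * m * s + s^2 * ?L * inverse (real (Suc n))) \<longlonglongrightarrow> 2 * m * s"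
    using tendsto_add[OF tendsto_const tendsto_mult[OF tendsto_const LIMSEQ_inverse_real_of_nat], of "2 * m * s" "s^2 * ?L"]
    by simp
  have "norm (trig P c g (x + s *\<^sub>R u) - trig P c g x) \<le> 2 * m * s + s^2 * ?L * inverse (real (Suc n))" for n
  proof -
    define t where "t = s / Suc n"
    have t0: "t \<ge> 0" and ts: "t * Suc n = s" using s by (auto simp: t_def)
    have inv: "r * (2 * m * t + t^2 * L) = 2 * m * (t * r) + (t * r)^2 * L * inverse r" if "r \<noteq> 0" for r L :: real
    proof -
      have "(t * r)^2 * L * inverse r = t^2 * L * (r * (r * inverse r))"
        by (simp only: power_mult_distrib power2_eq_square mult_ac)
      also have "r * inverse r = 1" using that by simp
      finally have e: "(t * r)^2 * L * inverse r = t^2 * L * r" by simp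
      show ?thesis unfolding e by (simp add: distrib_left)
    qed
    have step: "norm (trig P c g (v + t *\<^sub>R u) - trig P c g v) \<le> 2 * m * t + t^2 * ?L" for v
      by (rule trig_step_bound[OF c g small m t0])
    have "norm (trig P c g (x + (real k * t) *\<^sub>R u) - trig P c g x) \<le> real k * (2 * m * t + t^2 * ?L)" for k
    proof (induction k)
      case (Suc k)
      have "x + (real (Suc k) * t) *\<^sub>R u = (x + (real k * t) *\<^sub>R u) + t *\<^sub>R u" by (simp add: algebra_simps)
      then have "norm (trig P c g (x + (real (Suc k) * t) *\<^sub>R u) - trig P c g (x + (real k * t) *\<^sub>R u)) \<le> 2 * m * t + t^2 * ?L"
        by (simp only: step)
      moreover have "norm (F' - F0) \<le> (B + real k * B)" if "norm (F' - F) \<le> B" "norm (F - F0) \<le> real k * B"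
        for F F' F0 :: complex and B
        using norm_triangle_le[of "F' - F" "F - F0"] that by simp
      ultimately have "norm (trig P c g (x + (real (Suc k) * t) *\<^sub>R u) - trig P c g x)
          \<le> (2 * m * t + t^2 * ?L) + real k * (2 * m * t + t^2 * ?L)"
        using Suc by blast
      also have "\<dots> = real (Suc k) * (2 * m * t + t^2 * ?L)" by (simp add: distrib_right)
      finally show ?case .
    qed simp
    from this[of "Suc n"] have "norm (trig P c g (x + s *\<^sub>R u) - trig P c g x) \<le> Suc n * (2 * m * t + t^2 * ?L)"
      using ts by (simp add: mult.commute)
    also have "\<dots> = 2 * m * (t * real (Suc n)) + (t * real (Suc n))^2 * ?L * inverse (real (Suc n))"
      by (rule inv) simp
    also have "\<dots> = 2 * m * s + s^2 * ?L * inverse (real (Suc n))" by (simp only: ts)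
    finally show ?thesis .
  qed
  then show "\<forall>\<^sub>F n in sequentially. norm (trig P c g (x + s *\<^sub>R u) - trig P c g x) \<le> 2 * m * s + s^2 * ?L * inverse (real (Suc n))"
    by simp
qed simp

lemma trig_lipschitz:
  assumes sp: "spectral (cball 0 R) P c g" and R: "R > 0"
    and m: "\<And>x. norm (trig P c g x) \<le> m"
  shows "norm (trig P c g y - trig P c g x) \<le> 4 * pi * R * m * norm (y - x)"
proof (cases "y = x")
  case False
  \<comment> \<open>Scaled so that |2 pi (u \<bullet> \<gamma>)| is at most 1 on the ball of radius
    \<open>R\<close>; \<open>s\<close> counts the steps \<open>u\<close> from \<open>x\<close> to
    \<open>y\<close>.\<close>
  define s where "s = 2 * pi * R * norm (y - x)"
  have s0: "s > 0" using False R by (simp add: s_def)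
  define u where "u = (1 / s) *\<^sub>R (y - x)"
  have y: "x + s *\<^sub>R u = y" using s0 by (simp add: u_def)
  have nu: "norm u * (2 * pi * R) = 1" using s0 R False by (simp add: u_def s_def)
  have "norm (trig P c g (x + s *\<^sub>R u) - trig P c g x) \<le> 2 * m * s"
  proof (rule trig_lipschitz_dir)
    show "\<bar>2 * pi * (u \<bullet> g \<omega>)\<bar> \<le> 1" if "\<omega> \<in> space P" "c \<omega> \<noteq> 0" for \<omega>
    proof -
      have "norm (g \<omega>) \<le> R" using sp that by (auto simp: spectral_def)
      have "\<bar>u \<bullet> g \<omega>\<bar> \<le> norm u * norm (g \<omega>)" by (rule Cauchy_Schwarz_ineq2)
      also have "\<dots> \<le> norm u * R" using \<open>norm (g \<omega>) \<le> R\<close> by (intro mult_left_mono) auto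
      finally have "2 * pi * \<bar>u \<bullet> g \<omega>\<bar> \<le> 2 * pi * (norm u * R)" by (intro mult_left_mono) auto
      also have "2 * pi * (norm u * R) = norm u * (2 * pi * R)" by simp
      also note nu
      finally show ?thesis by (simp add: abs_mult)
    qed
  qed (use sp m s0 in \<open>auto simp: spectral_def\<close>)
  then have "norm (trig P c g y - trig P c g x) \<le> 2 * m * s" by (simp only: y)
  also have "2 * m * s = 4 * pi * R * m * norm (y - x)" by (simp add: s_def)
  finally show ?thesis .
qed simp

section \<open>A decaying function with small spectrum\<close>

definition tent :: "real \<Rightarrow> 'a::euclidean_space \<Rightarrow> real" where
  "tent \<rho> t = max 0 (1 - norm t / \<rho>)"

definition bump :: "real \<Rightarrow> 'a::euclidean_space \<Rightarrow> complex" where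
  "bump \<rho> t = of_real (tent \<rho> t / (LINT s|lborel. tent \<rho> (s::'a)))"

text \<open>This plays both the decaying factor and the square integrable factor of the overview,
  with different radii \<rho>. The normalisation of \<open>bump\<close> gives the value 1 at 0 and
  the bound 1 everywhere. A merely Lipschitz profile suffices, since only decay of order 1 / |u| is
  needed.\<close>

definition bump_ft :: "real \<Rightarrow> 'a::euclidean_space \<Rightarrow> complex" where
  "bump_ft \<rho> = trig lborel (bump \<rho>) (\<lambda>t. t)"

lemma continuous_on_tent [continuous_intros]: "continuous_on S (tent \<rho>)"
  unfolding tent_def divide_inverse by (intro continuous_intros)

lemma tent_measurable [measurable]: "tent \<rho> \<in> borel_measurable borel"
  by (intro borel_measurable_continuous_onI continuous_intros)

lemma bump_measurable [measurable]: "bump \<rho> \<in> borel_measurable borel"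
  unfolding bump_def by measurable

lemma tent_nonneg: "tent \<rho> t \<ge> 0" by (simp add: tent_def)

lemma integrable_indicator_cball:
  "integrable lborel (indicator (cball (a::'a::euclidean_space) r) :: 'a \<Rightarrow> real)"
  using emeasure_lborel_cball_finite[of a r] by (intro integrable_real_indicator) auto

context
  fixes \<rho> :: real assumes \<rho>: "\<rho> > 0"
begin

lemma tent_zero: "norm t \<ge> \<rho> \<Longrightarrow> tent \<rho> t = 0" and tent_le_1: "tent \<rho> t \<le> 1"
  using \<rho> by (auto simp: tent_def)

lemma tent_integrable: "integrable lborel (tent \<rho> :: 'a::euclidean_space \<Rightarrow> real)"
proof (rule Bochner_Integration.integrable_bound[of _ "indicator (cball 0 \<rho>) :: 'a \<Rightarrow> real"])
  show "AE t in lborel. norm (tent \<rho> (t::'a)) \<le> norm (indicator (cball 0 \<rho>) t :: real)"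
    by (intro AE_I2) (auto simp: indicator_def tent_zero abs_of_nonneg[OF tent_nonneg] tent_le_1)
qed (simp_all add: integrable_indicator_cball)

lemma tent_integral_pos: "(LINT t|lborel. tent \<rho> (t::'a::euclidean_space)) > 0"
proof -
  have "0 < measure lborel (ball (0::'a) (\<rho>/2)) * (1/2)"
    using \<rho> content_ball_pos[of "\<rho>/2" "0::'a"] by simp
  also have "\<dots> = (LINT t|lborel. indicator (ball (0::'a) (\<rho>/2)) t * (1/2))"
    by simp
  also have "\<dots> \<le> (LINT t|lborel. tent \<rho> (t::'a))"
  proof (rule integral_mono)
    show "indicator (ball (0::'a) (\<rho>/2)) t * (1/2) \<le> tent \<rho> t" for t :: 'a
      using \<rho> by (auto simp: indicator_def tent_def field_simps)
    show "integrable lborel (\<lambda>t. indicator (ball (0::'a) (\<rho>/2)) t * (1/2::real))"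
      by (intro integrable_mult_left integrable_real_indicator) (use emeasure_lborel_ball_finite[of "0::'a" "\<rho>/2"] in auto)
  qed (rule tent_integrable)
  finally show ?thesis .
qed

lemma bump_integrable: "integrable lborel (bump \<rho> :: 'a::euclidean_space \<Rightarrow> complex)"
  unfolding bump_def by (intro integrable_of_real integrable_divide_zero tent_integrable)

lemma spectral_bump: "spectral (cball 0 \<rho>) lborel (bump \<rho> :: 'a::euclidean_space \<Rightarrow> complex) (\<lambda>t. t)"
proof -
  have "norm t \<le> \<rho>" if "bump \<rho> t \<noteq> 0" for t :: 'a
    using tent_zero[of t] that by (cases "norm t \<le> \<rho>") (auto simp: bump_def)
  then show ?thesis using bump_integrable
    by (simp add: spectral_def lborel.sigma_finite_measure_axioms)
qed

lemma norm_bump: "norm (bump \<rho> (t::'a::euclidean_space)) = tent \<rho> t / (LINT s|lborel. tent \<rho> (s::'a))"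
  unfolding bump_def norm_of_real
  using tent_nonneg[of \<rho> t] tent_integral_pos[where 'a='a] by (intro abs_of_nonneg divide_nonneg_pos)

lemma bump_ft_0: "bump_ft \<rho> (0::'a::euclidean_space) = 1"
  using tent_integral_pos[where 'a='a] by (simp add: bump_ft_def trig_def bump_def)

lemma norm_bump_ft_le_1: "norm (bump_ft \<rho> (u::'a::euclidean_space)) \<le> 1"
  using norm_trig_le[OF bump_integrable, of "\<lambda>t. t" u] tent_integral_pos[where 'a='a]
  by (simp add: bump_ft_def norm_bump)

text \<open>The half-period shift from the Riemann-Lebesgue lemma: averaging the integral with its
  translate by \<open>h\<close> leaves differences of \<open>bump\<close>, which the Lipschitz bound
  makes of order |h| = 1 / (2 |u|). Near the origin the trivial bound 1 is enough.\<close>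

lemma bump_ft_decay:
  "\<exists>C>0. \<forall>u::'a::euclidean_space. norm (bump_ft \<rho> u) * norm u \<le> C"
proof -
  define Z where "Z = (LINT s|lborel. tent \<rho> (s::'a))"
  have Z: "Z > 0" using tent_integral_pos by (simp add: Z_def)
  define V where "V = measure lborel (cball (0::'a) (2 * \<rho>))"
  have main: "norm (bump_ft \<rho> u) * norm u \<le> V / (\<rho> * Z)" if u: "norm u \<ge> 1 / (2 * \<rho>)" for u :: 'a
  proof -
    have u0: "norm u > 0" using u \<rho> by (smt (verit) divide_pos_pos)
    define h where "h = (1 / (2 * (norm u)^2)) *\<^sub>R u"
    have nh: "norm h = 1 / (2 * norm u)" using u0 by (simp add: h_def power2_eq_square)
    \<comment> \<open>The restriction on \<open>u\<close> keeps the shift within \<rho>, so the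
      shifted and the unshifted tent both vanish outside the ball of radius 2 \<rho>.\<close>
    have hr: "norm h \<le> \<rho>" using u u0 \<rho> by (simp add: nh field_simps)
    \<comment> \<open>translating by \<open>h\<close> flips the sign of the exponential\<close>
    have uh: "u \<bullet> h = 1/2" using u0 by (simp add: h_def power2_norm_eq_inner[symmetric])
    have I: "integrable lborel (\<lambda>t. bump \<rho> t * cis (2 * pi * (u \<bullet> t)))"
      by (rule integrable_mult_bounded[OF bump_integrable]) auto
    have eqd: "distr lborel borel (\<lambda>t. h + t) = lborel" using lborel_distr_plus[of h] by simp
    have bu: "bump_ft \<rho> u = (LINT t|distr lborel borel (\<lambda>t. h + t). bump \<rho> t * cis (2 * pi * (u \<bullet> t)))"
      unfolding eqd by (simp add: bump_ft_def trig_def)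
    also have "\<dots> = (LINT t|lborel. bump \<rho> (h + t) * cis (2 * pi * (u \<bullet> (h + t))))"
      by (subst integral_distr) auto
    also have "\<dots> = (LINT t|lborel. - (bump \<rho> (h + t) * cis (2 * pi * (u \<bullet> t))))"
    proof (intro Bochner_Integration.integral_cong refl)
      fix t
      have "cis (2 * pi * (u \<bullet> (h + t))) = cis pi * cis (2 * pi * (u \<bullet> t))"
        unfolding cis_mult by (simp add: inner_add_right uh distrib_left)
      then show "bump \<rho> (h + t) * cis (2 * pi * (u \<bullet> (h + t))) = - (bump \<rho> (h + t) * cis (2 * pi * (u \<bullet> t)))"
        by simp
    qed
    finally have e2: "bump_ft \<rho> u = (LINT t|lborel. - (bump \<rho> (h + t) * cis (2 * pi * (u \<bullet> t))))" .
    have "integrable (distr lborel borel (\<lambda>t. h + t)) (bump \<rho> :: 'a \<Rightarrow> complex)" unfolding eqd by (rule bump_integrable)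
    then have "integrable lborel (\<lambda>t. bump \<rho> (h + t))" by (subst (asm) integrable_distr_eq) auto
    then have I2: "integrable lborel (\<lambda>t. bump \<rho> (h + t) * cis (2 * pi * (u \<bullet> t)))"
      by (rule integrable_mult_bounded) auto
    have "2 * bump_ft \<rho> u = bump_ft \<rho> u + bump_ft \<rho> u" by simp
    also have "\<dots> = (LINT t|lborel. bump \<rho> t * cis (2 * pi * (u \<bullet> t)) - bump \<rho> (h + t) * cis (2 * pi * (u \<bullet> t)))"
      by (subst (2) e2) (use I I2 in \<open>simp add: bump_ft_def trig_def\<close>)
    finally have e3: "2 * bump_ft \<rho> u = \<dots>" .
    have "norm (2 * bump_ft \<rho> u) \<le> (LINT t|lborel. norm h / (\<rho> * Z) * indicator (cball (0::'a) (2 * \<rho>)) t)"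
      unfolding e3
    proof (rule norm_integral_bound)
      show "integrable lborel (\<lambda>t. bump \<rho> t * cis (2 * pi * (u \<bullet> t)) - bump \<rho> (h + t) * cis (2 * pi * (u \<bullet> t)))"
        using I I2 by simp
      show "integrable lborel (\<lambda>t. norm h / (\<rho> * Z) * indicator (cball (0::'a) (2 * \<rho>)) t)"
        by (intro integrable_mult_right integrable_indicator_cball)
      fix t :: 'a
      have "norm (bump \<rho> t * cis (2 * pi * (u \<bullet> t)) - bump \<rho> (h + t) * cis (2 * pi * (u \<bullet> t))) = norm (bump \<rho> t - bump \<rho> (h + t))"
        by (simp add: norm_mult flip: left_diff_distrib)
      also have "\<dots> = norm (complex_of_real ((tent \<rho> t - tent \<rho> (h + t)) / Z))"
        by (simp add: bump_def Z_def[symmetric] diff_divide_distrib)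
      also have "\<dots> = \<bar>tent \<rho> t - tent \<rho> (h + t)\<bar> / Z" using Z by (simp only: norm_of_real) simp
      also have "\<dots> \<le> norm h / (\<rho> * Z) * indicator (cball (0::'a) (2 * \<rho>)) t"
      proof (cases "norm t \<le> 2 * \<rho>")
        case True
        have "\<bar>norm t - norm (h + t)\<bar> \<le> norm h" using norm_triangle_ineq3[of t "h + t"] by simp
        then have "\<bar>norm t / \<rho> - norm (h + t) / \<rho>\<bar> \<le> norm h / \<rho>"
          using \<rho> by (simp add: divide_right_mono flip: diff_divide_distrib)
        then have "\<bar>tent \<rho> t - tent \<rho> (h + t)\<bar> \<le> norm h / \<rho>" by (auto simp: tent_def)
        then have "\<bar>tent \<rho> t - tent \<rho> (h + t)\<bar> / Z \<le> norm h / \<rho> / Z" using Z by (intro divide_right_mono) auto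
        then show ?thesis using True by simp
      next
        case False
        have "norm (h + t) \<ge> norm t - norm h" by (metis add.commute norm_diff_ineq)
        then have "tent \<rho> t = 0" "tent \<rho> (h + t) = 0" using False hr \<rho> by (auto intro!: tent_zero)
        then show ?thesis using False by simp
      qed
      finally show "norm (bump \<rho> t * cis (2 * pi * (u \<bullet> t)) - bump \<rho> (h + t) * cis (2 * pi * (u \<bullet> t))) \<le> norm h / (\<rho> * Z) * indicator (cball (0::'a) (2 * \<rho>)) t" .
    qed
    also have "\<dots> = norm h / (\<rho> * Z) * V" by (simp add: V_def)
    finally have "2 * norm (bump_ft \<rho> u) \<le> norm h / (\<rho> * Z) * V" by (simp add: norm_mult)
    then have "2 * norm (bump_ft \<rho> u) * norm u \<le> norm h / (\<rho> * Z) * V * norm u"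
      by (rule mult_right_mono) simp
    also have "norm h / (\<rho> * Z) * V * norm u = (norm h * norm u) * (V / (\<rho> * Z))" by simp
    also have "norm h * norm u = 1 / 2" using u0 by (simp add: nh)
    finally have "norm (bump_ft \<rho> u) * norm u \<le> 1 / 4 * (V / (\<rho> * Z))" by simp
    also have "\<dots> \<le> 1 * (V / (\<rho> * Z))" using \<rho> Z by (intro mult_right_mono) (auto simp: V_def)
    finally show ?thesis by simp
  qed
  have "norm (bump_ft \<rho> u) * norm u \<le> V / (\<rho> * Z) + 1 / (2 * \<rho>)" for u :: 'a
  proof (cases "norm u \<ge> 1 / (2 * \<rho>)")
    case True then show ?thesis using main[OF True] \<rho> by (smt (verit) divide_pos_pos)
  next
    case False
    have "norm (bump_ft \<rho> u) * norm u \<le> 1 * norm u" by (intro mult_right_mono norm_bump_ft_le_1) auto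
    moreover have "V / (\<rho> * Z) \<ge> 0" using \<rho> Z by (simp add: V_def)
    ultimately show ?thesis using False by simp
  qed
  moreover have "V / (\<rho> * Z) + 1 / (2 * \<rho>) > 0" using \<rho> Z by (simp add: V_def add_nonneg_pos)
  ultimately show ?thesis by blast
qed

end

section \<open>Enlarging the spectrum\<close>

text \<open>The terms decay geometrically on both sides of the index where \<open>q / 2^j\<close> is
  about 1, so the bound depends neither on \<open>J\<close> nor on \<open>q\<close>.\<close>

lemma sum_min_dyadic:
  fixes q :: real assumes "q \<ge> 0"
  shows "(\<Sum>j<J. min (q / 2^j) (1 / (q / 2^j))) \<le> 4"
proof -
  \<comment> \<open>The strengthening survives the passage from \<open>q\<close> to
    \<open>q / 2\<close>: a small \<open>q\<close> has a linear bound, and for a large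
    \<open>q\<close> the reserve 1 / q makes room for the next term.\<close>
  have "(q \<le> 1 \<longrightarrow> (\<Sum>j<J. min (q / 2^j) (1 / (q / 2^j))) \<le> 2 * q) \<and>
        (1 \<le> q \<longrightarrow> (\<Sum>j<J. min (q / 2^j) (1 / (q / 2^j))) \<le> 4 - 1 / q)"
    using assms
  proof (induction J arbitrary: q)
    case (Suc J)
    let ?S = "\<lambda>q. \<Sum>j<J. min (q / 2^j) (1 / (q / 2^j))"
    have eq: "(\<Sum>j<Suc J. min (q / 2^j) (1 / (q / 2^j))) = min q (1/q) + ?S (q/2)"
      unfolding sum.lessThan_Suc_shift by (simp add: field_simps)
    have IH: "q / 2 \<le> 1 \<longrightarrow> ?S (q/2) \<le> 2 * (q / 2)" "1 \<le> q / 2 \<longrightarrow> ?S (q/2) \<le> 4 - 1 / (q / 2)"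
      using Suc.IH[of "q/2"] Suc.prems by auto
    have "min q (1/q) + ?S (q/2) \<le> 2 * q" if "q \<le> 1" using IH(1) that by linarith
    moreover have "min q (1/q) + ?S (q/2) \<le> 4 - 1 / q" if q: "1 \<le> q"
    proof (cases "q \<le> 2")
      case True
      \<comment> \<open>Here \<open>q / 2\<close> has dropped to at most 1, so the linear bound
        applies to the rest and q + 2 / q must be compared with 4.\<close>
      have "(q - 1) * (q - 2) \<le> 0" using q True by (intro mult_nonneg_nonpos) auto
      then have "q + 2 / q \<le> 3" using q by (simp add: field_simps)
      then show ?thesis using IH(1) True by linarith
    next
      case False
      then show ?thesis using IH(2) by simp
    qed
    ultimately show ?case using eq by simp
  qed (auto simp: divide_le_eq)
  then show ?thesis using assms by (cases "q \<le> 1") (auto intro: order_trans)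
qed

lemma convex_combine_0:
  fixes S :: "'a::real_vector set"
  assumes "convex S" "0 \<in> S" "s \<in> S" "t \<in> S" "a \<ge> 0" "b \<ge> 0" "a + b \<le> 1"
  shows "a *\<^sub>R s + b *\<^sub>R t \<in> S"
proof (cases "a + b = 0")
  case True
  then have "a = 0" "b = 0" using assms by auto
  then show ?thesis using assms by simp
next
  case False
  then have pos: "a + b > 0" using assms by linarith
  have ab: "a / (a + b) + b / (a + b) = 1"
    using pos by (metis add_divide_distrib divide_self less_irrefl)
  have st: "(a / (a + b)) *\<^sub>R s + (b / (a + b)) *\<^sub>R t \<in> S"
    by (intro convexD[OF assms(1,3,4)] divide_nonneg_pos assms pos ab)
  then have "(a + b) *\<^sub>R ((a / (a + b)) *\<^sub>R s + (b / (a + b)) *\<^sub>R t) + (1 - (a + b)) *\<^sub>R 0 \<in> S"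
    by (intro convexD[OF assms(1) st assms(2)]) (use assms in auto)
  then show ?thesis using pos by (simp add: scaleR_add_right)
qed

text \<open>Let \<open>m\<close> be the supremum of the given function, finite since its coefficient
  is integrable. The inequality for \<Lambda>, applied to the averages, gives m <= K (s + 4 D m /
  J), and \<open>J\<close> is so large that the last term is at most m / 2. The type
  \<open>'b\<close> belongs to the whole statement because types cannot be quantified inside
  it.\<close>

lemma sup_bound_enlarged:
  fixes E \<Lambda> :: "'a::euclidean_space set"
  assumes bal: "balayage_possible E \<Lambda>" and cvx: "convex \<Lambda>" and sym: "\<forall>\<gamma>\<in>\<Lambda>. - \<gamma> \<in> \<Lambda>"
    and \<rho>: "\<rho> > 0" "cball 0 \<rho> \<subseteq> \<Lambda>" and R: "R > 0" "\<Lambda> \<subseteq> cball 0 R"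
  shows "\<exists>\<epsilon> K. 0 < \<epsilon> \<and> 0 < K \<and> (\<forall>(P::'b measure) c g s y. spectral ((\<lambda>\<gamma>. (1 + \<epsilon>) *\<^sub>R \<gamma>) ` \<Lambda>) P c g \<longrightarrow>
     0 \<le> s \<longrightarrow> (\<forall>x\<in>E. norm (trig P c g x) \<le> s) \<longrightarrow> norm (trig P c g y) \<le> K * s)"
proof -
  obtain K where K: "K > 0" "\<And>h y s. h \<in> bal_fun \<Lambda> \<Longrightarrow> 0 \<le> s \<Longrightarrow> (\<forall>x\<in>E. norm (h x) \<le> s) \<Longrightarrow> norm (h y) \<le> K * s"
    using balayage_sup_bound[OF bal] by blast
  obtain C where C: "C > 0" "\<And>u::'a. norm (bump_ft \<rho> u) * norm u \<le> C" using bump_ft_decay[OF \<rho>(1)] by blast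
  \<comment> \<open>The Lipschitz constant from Bernstein's inequality for the enlarged spectrum,
    which lies in the ball of radius 2 R because \<epsilon> is at most 1.\<close>
  define A where "A = 4 * pi * (2 * R)"
  have A: "A > 0" using R by (simp add: A_def)
  \<comment> \<open>\<open>D\<close> dominates both forms of the error, A m t for small t and 4 C m
    / t for large t.\<close>
  define D where "D = A + 4 * C"
  have D: "D > 0" using A C by (simp add: D_def)
  obtain J :: nat where J: "real J \<ge> 8 * K * D" using real_arch_simple by blast
  have J0: "J > 0" using J K D by (smt (verit) mult_pos_pos of_nat_0_less_iff)
  \<comment> \<open>Half of the smallest scale \<open>\<delta> (J - 1)\<close>. This makes (1 -
    \<open>\<delta> j\<close>) (1 + \<epsilon>) + \<open>\<delta> j\<close> / 2 at most 1 for all j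
    < J, which keeps the spectrum of the products inside \<Lambda>.\<close>
  define \<epsilon> where "\<epsilon> = (1/2::real)^(J+1)"
  have \<epsilon>: "\<epsilon> > 0" "\<epsilon> \<le> 1" using power_le_one[of "1/2::real" "J+1"] by (simp_all add: \<epsilon>_def)
  define \<delta> where "\<delta> j = (1/2::real)^(j+1)" for j
  have \<delta>: "\<delta> j > 0" "\<delta> j \<le> 1" for j 
    using power_le_one[of "1/2::real" "j+1"] by (simp_all add: \<delta>_def)
  have \<epsilon>\<delta>: "\<epsilon> \<le> \<delta> j / 2" if "j < J" for j
  proof -
    have "(1/2::real)^(J+1) \<le> (1/2)^(j+2)" using that by (intro power_decreasing) auto
    then show ?thesis by (simp add: \<epsilon>_def \<delta>_def)
  qed
  have zero: "0 \<in> \<Lambda>" using \<rho> by auto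
  have "norm (trig P c g y) \<le> (2 * K) * s"
    if sp: "spectral ((\<lambda>\<gamma>. (1 + \<epsilon>) *\<^sub>R \<gamma>) ` \<Lambda>) P c g" and s: "0 \<le> s" and le: "\<forall>x\<in>E. norm (trig P c g x) \<le> s"
    for P :: "'b measure" and c g s y
  proof -
    define \<phi> where "\<phi> = trig P c g"
    define m where "m = (SUP x. norm (\<phi> x))"
    have "integrable P c" using sp by (simp add: spectral_def)
    then have bdd: "bdd_above (range (\<lambda>x. norm (\<phi> x)))"
      using norm_trig_le[of P c g] by (auto simp: \<phi>_def bdd_above_def)
    have m: "norm (\<phi> x) \<le> m" for x unfolding m_def by (rule cSUP_upper[OF _ bdd]) simp
    have m0: "m \<ge> 0" using m[of 0] norm_ge_zero order_trans by blast
    have "spectral (cball 0 (2 * R)) P c g"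
    proof -
      have "(\<lambda>\<gamma>. (1 + \<epsilon>) *\<^sub>R \<gamma>) ` \<Lambda> \<subseteq> cball 0 (2 * R)"
        using R \<epsilon> by (auto intro!: mult_mono dest!: subsetD)
      then show ?thesis using sp unfolding spectral_def by blast
    qed
    then have lip: "norm (\<phi> v - \<phi> x) \<le> A * m * norm (v - x)" for v x
      unfolding A_def \<phi>_def using R m[unfolded \<phi>_def] by (intro trig_lipschitz) auto
    have main: "norm (\<phi> z) \<le> K * (s + 4 * D * m / J)" for z
    proof -
      \<comment> \<open>Contraction towards \<open>z\<close> frees the fraction
        \<open>\<delta> j\<close> of the spectrum. The cutoff takes one half of it, the other half
        absorbs \<epsilon>. The point \<open>z\<close> is fixed by the contraction and the cutoff is
        1 there.\<close>
      define h where "h j x = \<phi> (\<delta> j *\<^sub>R z + (1 - \<delta> j) *\<^sub>R x) * bump_ft \<rho> (- (\<delta> j / 2) *\<^sub>R z + (\<delta> j / 2) *\<^sub>R x)" for j x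
      have hb: "h j \<in> bal_fun \<Lambda>" if j: "j < J" for j
      proof -
        have "(1 - \<delta> j) *\<^sub>R v + (\<delta> j / 2) *\<^sub>R t \<in> \<Lambda>"
          if v: "v \<in> (\<lambda>\<gamma>. (1 + \<epsilon>) *\<^sub>R \<gamma>) ` \<Lambda>" and t: "t \<in> cball 0 \<rho>" for v t
        proof -
          obtain \<gamma> where \<gamma>: "\<gamma> \<in> \<Lambda>" "v = (1 + \<epsilon>) *\<^sub>R \<gamma>" using v by auto
          have "((1 - \<delta> j) * (1 + \<epsilon>)) *\<^sub>R \<gamma> + (\<delta> j / 2) *\<^sub>R t \<in> \<Lambda>"
          proof (rule convex_combine_0[OF cvx zero \<gamma>(1)])
            have "\<delta> j * \<epsilon> \<ge> 0" using \<delta>[of j] \<epsilon> by simp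
            then show "(1 - \<delta> j) * (1 + \<epsilon>) + \<delta> j / 2 \<le> 1" using \<epsilon>\<delta>[OF j] by (simp add: algebra_simps)
          qed (use t \<rho> \<delta>[of j] \<epsilon> in auto)
          then show ?thesis using \<gamma> by simp
        qed
        then obtain c' g' where cg: "spectral \<Lambda> (P \<Otimes>\<^sub>M (lborel :: 'a measure)) c' g'" "\<forall>x. trig (P \<Otimes>\<^sub>M (lborel :: 'a measure)) c' g' x = h j x"
          using trig_mult[OF sp spectral_bump[OF \<rho>(1)], of "1 - \<delta> j" "\<delta> j / 2" \<Lambda> "\<delta> j *\<^sub>R z" "- (\<delta> j / 2) *\<^sub>R z"]
          unfolding h_def \<phi>_def bump_ft_def by blast
        then have "h j = trig (P \<Otimes>\<^sub>M (lborel :: 'a measure)) c' g'" by auto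
        then show ?thesis using trig_in_bal_fun[OF cg(1) sym] by simp
      qed
      define H where "H x = (1 / of_nat J) * (\<Sum>j<J. h j x)" for x
      have Hb: "H \<in> bal_fun \<Lambda>" unfolding H_def by (intro bal_fun_scale bal_fun_sum) (auto intro: hb)
      have "h j z = \<phi> z" for j
        by (simp add: h_def scaleR_add_left[symmetric] bump_ft_0[OF \<rho>(1)] del: scaleR_minus_left)
      then have Hz: "H z = \<phi> z" using J0 by (simp add: H_def)
      have "norm (H x) \<le> s + 4 * D * m / J" if x: "x \<in> E" for x
      proof -
        \<comment> \<open>Since \<open>\<delta> j\<close> is \<open>(1/2)^(j+1)\<close>, this choice
          makes \<open>q / 2^j\<close> equal to \<open>\<delta> j * norm (x - z)\<close>.\<close>
        define q where "q = norm (x - z) / 2"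
        have hj: "norm (h j x) \<le> s + D * m * min (q / 2^j) (1 / (q / 2^j))" for j
        proof -
          define t where "t = q / 2^j"
          have t: "t = \<delta> j * norm (x - z)" "t \<ge> 0" by (auto simp: t_def q_def \<delta>_def power_one_over field_simps)
          define e where "e = norm (bump_ft \<rho> (- (\<delta> j / 2) *\<^sub>R z + (\<delta> j / 2) *\<^sub>R x))"
          have e: "0 \<le> e" "e \<le> 1" by (auto simp: e_def norm_bump_ft_le_1[OF \<rho>(1)])
          \<comment> \<open>The cutoff is evaluated at distance t / 2 from its centre, hence the
            decay constant 2 C.\<close>
          have et: "e * t \<le> 2 * C"
          proof -
            have "- (\<delta> j / 2) *\<^sub>R z + (\<delta> j / 2) *\<^sub>R x = (\<delta> j / 2) *\<^sub>R (x - z)" by (simp add: scaleR_diff_right)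
            then have nv: "norm (- (\<delta> j / 2) *\<^sub>R z + (\<delta> j / 2) *\<^sub>R x) = t / 2" using \<delta>[of j] by (simp add: t)
            have "e * (t / 2) \<le> C"
              using C(2)[of "- (\<delta> j / 2) *\<^sub>R z + (\<delta> j / 2) *\<^sub>R x"] unfolding nv e_def .
            then show ?thesis by simp
          qed
          define d where "d = norm (\<phi> (\<delta> j *\<^sub>R z + (1 - \<delta> j) *\<^sub>R x) - \<phi> x)"
          have d0: "d \<ge> 0" by (simp add: d_def)
          have d1: "d \<le> A * m * t"
          proof -
            have "\<delta> j *\<^sub>R z + (1 - \<delta> j) *\<^sub>R x - x = - \<delta> j *\<^sub>R (x - z)" by (simp add: algebra_simps)
            then have "norm (\<delta> j *\<^sub>R z + (1 - \<delta> j) *\<^sub>R x - x) = t" using \<delta>[of j] by (simp add: t)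
            then show ?thesis using lip[of "\<delta> j *\<^sub>R z + (1 - \<delta> j) *\<^sub>R x" x] by (simp add: d_def)
          qed
          have d2: "d \<le> 2 * m"
            using norm_triangle_ineq4[of "\<phi> (\<delta> j *\<^sub>R z + (1 - \<delta> j) *\<^sub>R x)" "\<phi> x"] m[of "\<delta> j *\<^sub>R z + (1 - \<delta> j) *\<^sub>R x"] m[of x]
            by (simp add: d_def)
          \<comment> \<open>Displacement against damping: the Lipschitz bound with e <= 1 yields the
            factor t, the trivial bound d <= 2 m with the decay of \<open>e\<close> yields 1 /
            t.\<close>
          have de: "d * e \<le> D * m * min t (1/t)"
          proof (cases "t = 0")
            case True then show ?thesis using d1 d0 by simp
          next
            case False
            have Am: "A * m \<le> D * m" and Cm: "4 * C * m \<le> D * m"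
              using A C m0 by (auto simp: D_def intro!: mult_right_mono)
            have "d * e \<le> A * m * t * 1" 
              by (intro mult_mono d1 e) (use A m0 t(2) in auto)
            also have "\<dots> \<le> D * m * t" using mult_right_mono[OF Am t(2)] by simp
            finally have 1: "d * e \<le> D * m * t" .
            have "d * e * t = d * (e * t)" by simp
            also have "\<dots> \<le> (2 * m) * (2 * C)" 
              by (intro mult_mono d2 et) (use e(1) t(2) m0 in auto)
            also have "(2 * m) * (2 * C) = 4 * C * m" by simp
            also note Cm
            finally have 2: "d * e \<le> D * m * (1 / t)" using False t(2) by (simp add: field_simps)
            show ?thesis using 1 2 by (auto simp: min_def)
          qed
          have "norm (h j x) = norm (\<phi> (\<delta> j *\<^sub>R z + (1 - \<delta> j) *\<^sub>R x)) * e" by (simp add: h_def norm_mult e_def)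
          also have "\<dots> \<le> (norm (\<phi> x) + d) * e"
            using norm_triangle_sub[of "\<phi> (\<delta> j *\<^sub>R z + (1 - \<delta> j) *\<^sub>R x)" "\<phi> x"] e by (intro mult_right_mono) (auto simp: d_def)
          also have "\<dots> = norm (\<phi> x) * e + d * e" by (simp add: distrib_right)
          also have "norm (\<phi> x) * e \<le> s * 1" using le x e s by (intro mult_mono) (auto simp: \<phi>_def)
          also note de
          finally show ?thesis by (simp add: t_def)
        qed
        have "norm (\<Sum>j<J. h j x) \<le> (\<Sum>j<J. s + D * m * min (q / 2^j) (1 / (q / 2^j)))"
          by (rule sum_norm_le) (rule hj)
        also have "\<dots> = J * s + D * m * (\<Sum>j<J. min (q / 2^j) (1 / (q / 2^j)))"
          by (simp add: sum.distrib sum_distrib_left)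
        also have "\<dots> \<le> J * s + D * m * 4"
          using sum_min_dyadic[of q J] D m0 by (intro add_left_mono mult_left_mono) (auto simp: q_def)
        finally show ?thesis using J0 by (simp add: H_def norm_mult norm_divide field_simps)
      qed
      then have "norm (H z) \<le> K * (s + 4 * D * m / J)"
        using Hb s m0 D by (intro K(2)) auto
      then show ?thesis by (simp add: Hz)
    qed
    \<comment> \<open>The right side does not depend on \<open>z\<close>, so the supremum may be
      taken and its own contribution on the right absorbed.\<close>
    have "(SUP x. norm (\<phi> x)) \<le> K * (s + 4 * D * m / J)" by (rule cSUP_least) (use main in auto)
    then have "m \<le> K * (s + 4 * D * m / J)" by (simp only: m_def[symmetric])
    moreover have "K * (4 * D * m / J) \<le> m / 2"
    proof -
      have "8 * K * D * m \<le> J * m" using J m0 by (rule mult_right_mono)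
      then show ?thesis using J0 by (simp add: field_simps)
    qed
    ultimately have "m \<le> 2 * K * s" by (simp add: distrib_left)
    then show ?thesis using m[of y] by (simp add: \<phi>_def)
  qed
  then show ?thesis using \<epsilon>(1) K(1) by (intro exI[of _ \<epsilon>] exI[of _ "2 * K"]) auto
qed

section \<open>Gaussian weights\<close>

text \<open>Lebesgue measure is the image of a product of one-dimensional Lebesgue measures, so
  integrals of functions that split over the coordinates are products. This reduces Gaussians to
  dimension one.\<close>

lemma
  fixes f :: "'a::euclidean_space \<Rightarrow> real \<Rightarrow> complex"
  assumes f: "\<And>b. b \<in> Basis \<Longrightarrow> integrable lborel (f b)"
  shows integrable_lborel_prod: "integrable lborel (\<lambda>x::'a. \<Prod>b\<in>Basis. f b (x \<bullet> b))"
    and integral_lborel_prod: "(LINT x|lborel. (\<Prod>b\<in>Basis. f b (x \<bullet> b))) = (\<Prod>b\<in>Basis. LINT t|lborel. f b t)"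
proof -
  interpret product_sigma_finite "\<lambda>_::'a. lborel :: real measure" by standard
  have [measurable]: "f b \<in> borel_measurable borel" if "b \<in> Basis" for b using f[OF that] by auto
  let ?P = "Pi\<^sub>M Basis (\<lambda>_::'a. lborel :: real measure)"
  let ?T = "\<lambda>g. \<Sum>b\<in>Basis. g b *\<^sub>R b :: 'a"
  let ?h = "\<lambda>x::'a. \<Prod>b\<in>Basis. f b (x \<bullet> b)"
  have T: "?T \<in> measurable ?P borel" by simp
  have h: "?h \<in> borel_measurable borel" by measurable
  have hT: "?h (?T g) = (\<Prod>b\<in>Basis. f b (g b))" for g
    by (intro prod.cong refl) simp
  have "integrable ?P (\<lambda>g. ?h (?T g))"
    unfolding hT by (rule product_integrable_prod) (use f in auto)
  then have "integrable (distr ?P borel ?T) ?h" using integrable_distr_eq[OF T h] by simp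
  then show "integrable lborel ?h" unfolding lborel_eq[symmetric] .
  have "integral\<^sup>L (distr ?P borel ?T) ?h = (LINT g|?P. ?h (?T g))"
    by (rule integral_distr[OF T h])
  also have "\<dots> = (\<Prod>b\<in>Basis. LINT t|lborel. f b t)"
    unfolding hT by (rule product_integral_prod) (use f in auto)
  finally show "(LINT x|lborel. ?h x) = (\<Prod>b\<in>Basis. LINT t|lborel. f b t)"
    unfolding lborel_eq[symmetric] .
qed

text \<open>After the substitution of \<sigma> x for x this is the characteristic function of the
  standard normal distribution.\<close>

lemma gauss_char_real:
  fixes \<sigma> b :: real
  assumes "\<sigma> > 0"
  shows "integrable lborel (\<lambda>x. complex_of_real (exp (- (x^2) / (2 * \<sigma>^2))) * cis (b * x))"
    and "(LINT x|lborel. complex_of_real (exp (- (x^2) / (2 * \<sigma>^2))) * cis (b * x)) =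
      of_real (\<sigma> * sqrt (2 * pi) * exp (- ((\<sigma> * b)^2) / 2))"
proof -
  have n: "integrable lborel (\<lambda>x. exp (- (x^2) / (2 * \<sigma>^2)))"
  proof -
    have "integrable lborel (\<lambda>x. sqrt (2 * pi * \<sigma>^2) * normal_density 0 \<sigma> x)"
      using assms by simp
    moreover have "(\<lambda>x. sqrt (2 * pi * \<sigma>^2) * normal_density 0 \<sigma> x) = (\<lambda>x. exp (- (x^2) / (2 * \<sigma>^2)))"
      using assms by (auto simp: normal_density_def)
    ultimately show ?thesis by simp
  qed
  then have "integrable lborel (\<lambda>x. complex_of_real (exp (- (x^2) / (2 * \<sigma>^2))))" by (rule integrable_of_real)
  then show "integrable lborel (\<lambda>x. complex_of_real (exp (- (x^2) / (2 * \<sigma>^2))) * cis (b * x))"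
    by (rule integrable_mult_bounded) auto
  have "(LINT x|lborel. complex_of_real (std_normal_density x) * cis (\<sigma> * b * x)) = exp (- ((\<sigma> * b)^2) / 2)"
    using fun_cong[OF char_std_normal_distribution, of "\<sigma> * b"]
    unfolding char_def by (subst (asm) integral_density) (auto simp: scaleR_conv_of_real cis_conv_exp)
  moreover have "complex_of_real (exp (- ((\<sigma> * x)^2) / (2 * \<sigma>^2))) * cis (b * (\<sigma> * x)) =
     of_real (sqrt (2 * pi)) * (complex_of_real (std_normal_density x) * cis (\<sigma> * b * x))" for x
    using assms by (simp add: normal_density_def power_mult_distrib mult_ac)
  ultimately show "(LINT x|lborel. complex_of_real (exp (- (x^2) / (2 * \<sigma>^2))) * cis (b * x)) =
      of_real (\<sigma> * sqrt (2 * pi) * exp (- ((\<sigma> * b)^2) / 2))"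
    using assms by (subst lborel_integral_real_affine[where c=\<sigma> and t=0]) (simp_all add: scaleR_conv_of_real mult.assoc)
qed

definition gauss :: "real \<Rightarrow> 'a::euclidean_space \<Rightarrow> real" where
  "gauss \<sigma> x = exp (- ((norm x)^2) / (2 * \<sigma>^2))"

text \<open>The Fourier transform of \<open>gauss \<sigma>\<close>. It has total mass 1 and
  concentrates at 0 as \<sigma> grows: an approximate identity in frequency, while
  \<open>gauss \<sigma>\<close> tends to 1 in space.\<close>

definition gkern :: "real \<Rightarrow> 'a::euclidean_space \<Rightarrow> real" where
  "gkern \<sigma> x = (\<sigma> * sqrt (2 * pi))^DIM('a) * exp (- 2 * pi^2 * \<sigma>^2 * (norm x)^2)"

lemma gauss_measurable [measurable]: "gauss \<sigma> \<in> borel_measurable borel"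
  unfolding gauss_def by measurable

lemma gkern_measurable [measurable]: "gkern \<sigma> \<in> borel_measurable borel"
  unfolding gkern_def by measurable

lemma gauss_pos: "gauss \<sigma> x > 0" and gkern_nonneg: "\<sigma> > 0 \<Longrightarrow> gkern \<sigma> x \<ge> 0"
  by (auto simp: gauss_def gkern_def)

lemma gauss_fourier:
  fixes \<xi> :: "'a::euclidean_space"
  assumes s: "\<sigma> > 0"
  shows "integrable lborel (gauss \<sigma> :: 'a \<Rightarrow> real)"
    and "(LINT x|lborel. of_real (gauss \<sigma> x) * cis (2 * pi * (x \<bullet> \<xi>))) = of_real (gkern \<sigma> \<xi>)"
proof -
  define f :: "'a \<Rightarrow> 'a \<Rightarrow> real \<Rightarrow> complex" where
    "f \<xi> b t = complex_of_real (exp (- (t^2) / (2 * \<sigma>^2))) * cis ((2 * pi * (b \<bullet> \<xi>)) * t)" for \<xi> b t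
  have prod: "(\<Prod>b\<in>Basis. f \<xi> b (x \<bullet> b)) = of_real (gauss \<sigma> x) * cis (2 * pi * (x \<bullet> \<xi>))" for x \<xi>
  proof -
    have "(\<Prod>b\<in>Basis. complex_of_real (exp (- ((x \<bullet> b)^2) / (2 * \<sigma>^2)))) = of_real (gauss \<sigma> x)"
    proof -
      have "(norm x)^2 = (\<Sum>b\<in>Basis. (x \<bullet> b)^2)"
        unfolding power2_norm_eq_inner euclidean_inner[of x x] by (simp add: power2_eq_square)
      then show ?thesis
        unfolding of_real_prod[symmetric] exp_sum[OF finite_Basis, symmetric] gauss_def
        by (simp add: sum_negf sum_divide_distrib)
    qed
    moreover have "(\<Prod>b\<in>Basis. cis ((2 * pi * (b \<bullet> \<xi>)) * (x \<bullet> b))) = cis (2 * pi * (x \<bullet> \<xi>))"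
    proof -
      have "(\<Prod>b\<in>Basis. cis ((2 * pi * (b \<bullet> \<xi>)) * (x \<bullet> b))) = cis (\<Sum>b\<in>Basis. (2 * pi * (b \<bullet> \<xi>)) * (x \<bullet> b))"
        by (simp add: cis_conv_exp exp_sum sum_distrib_left)
      also have "(\<Sum>b\<in>Basis. (2 * pi * (b \<bullet> \<xi>)) * (x \<bullet> b)) = 2 * pi * (x \<bullet> \<xi>)"
        by (subst euclidean_inner[of x \<xi>]) (simp add: sum_distrib_left mult_ac inner_commute)
      finally show ?thesis .
    qed
    ultimately show ?thesis by (simp add: f_def prod.distrib)
  qed
  have i: "integrable lborel (f \<xi> b)" for \<xi> b unfolding f_def by (rule gauss_char_real[OF s])
  have "integrable lborel (\<lambda>x::'a. complex_of_real (gauss \<sigma> x))"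
    using integrable_lborel_prod[of "f 0", OF i] unfolding prod by simp
  then show "integrable lborel (gauss \<sigma> :: 'a \<Rightarrow> real)"
    by (simp only: complex_of_real_integrable_eq)
  have "(LINT x|lborel. of_real (gauss \<sigma> x) * cis (2 * pi * (x \<bullet> \<xi>))) = (\<Prod>b\<in>Basis. LINT t|lborel. f \<xi> b t)"
    using integral_lborel_prod[of "f \<xi>", OF i] unfolding prod by simp
  also have "\<dots> = (\<Prod>b\<in>Basis. of_real (\<sigma> * sqrt (2 * pi) * exp (- ((\<sigma> * (2 * pi * (b \<bullet> \<xi>)))^2) / 2)))"
    unfolding f_def gauss_char_real(2)[OF s] ..
  also have "\<dots> = of_real (\<Prod>b\<in>Basis. (\<sigma> * sqrt (2 * pi) * exp (- ((\<sigma> * (2 * pi * (b \<bullet> \<xi>)))^2) / 2)))"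
    by simp
  also have "(\<Prod>b\<in>Basis. (\<sigma> * sqrt (2 * pi) * exp (- ((\<sigma> * (2 * pi * (b \<bullet> \<xi>)))^2) / 2))) = gkern \<sigma> \<xi>"
  proof -
    have "(\<Sum>b\<in>Basis. - ((\<sigma> * (2 * pi * (b \<bullet> \<xi>)))^2) / 2) = - 2 * pi^2 * \<sigma>^2 * (norm \<xi>)^2"
      unfolding power2_norm_eq_inner euclidean_inner[of \<xi> \<xi>]
      by (simp add: sum_distrib_left power2_eq_square mult_ac inner_commute sum_negf[symmetric])
    then show ?thesis
      unfolding gkern_def prod.distrib exp_sum[OF finite_Basis, symmetric] by (simp add: power_mult_distrib)
  qed
  finally show "(LINT x|lborel. of_real (gauss \<sigma> x) * cis (2 * pi * (x \<bullet> \<xi>))) = of_real (gkern \<sigma> \<xi>)" .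
qed

lemma gauss_integral: "\<sigma> > 0 \<Longrightarrow> (LINT x::'a::euclidean_space|lborel. gauss \<sigma> x) = (\<sigma> * sqrt (2 * pi))^DIM('a)"
  using gauss_fourier(2)[of \<sigma> "0::'a"] by (simp add: gkern_def flip: of_real_mult of_real_power)

lemma gkern_eq_gauss:
  assumes "\<sigma> > 0"
  shows "gkern \<sigma> (x::'a::euclidean_space) = (\<sigma> * sqrt (2 * pi))^DIM('a) * gauss (1 / (2 * pi * \<sigma>)) x"
  using assms by (simp add: gkern_def gauss_def power_divide power_mult_distrib field_simps)

lemma gkern_integral:
  assumes s: "\<sigma> > 0"
  shows "integrable lborel (gkern \<sigma> :: 'a::euclidean_space \<Rightarrow> real)" and "(LINT x::'a|lborel. gkern \<sigma> x) = 1"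
proof -
  have p: "1 / (2 * pi * \<sigma>) > 0" using s by simp
  show "integrable lborel (gkern \<sigma> :: 'a \<Rightarrow> real)"
    unfolding gkern_eq_gauss[OF s] by (intro integrable_mult_right gauss_fourier(1)[OF p])
  have "(\<sigma> * sqrt (2 * pi)) * (1 / (2 * pi * \<sigma>) * sqrt (2 * pi)) = 1" using s by (simp add: field_simps)
  then show "(LINT x::'a|lborel. gkern \<sigma> x) = 1"
    unfolding gkern_eq_gauss[OF s] using gauss_integral[OF p, where 'a='a] 
    by (simp only: integral_mult_right_zero power_mult_distrib[symmetric] power_one)
qed

abbreviation ift :: "('a::euclidean_space \<Rightarrow> complex) \<Rightarrow> 'a \<Rightarrow> complex" where
  "ift F \<equiv> trig lborel F (\<lambda>t. t)"

text \<open>The Gaussian weight as a finite measure, so that the pairing formula for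
  \<open>cmeasure\<close> evaluates weighted integrals of \<open>trig\<close> functions.\<close>

definition gmeas :: "real \<Rightarrow> 'a::euclidean_space measure" where
  "gmeas \<sigma> = density lborel (\<lambda>x. ennreal (gauss \<sigma> x))"

lemma sets_gmeas [measurable_cong, simp]: "sets (gmeas \<sigma>) = sets borel"
  by (simp add: gmeas_def)

lemma cmeasure_gmeas:
  assumes "\<sigma> > 0" shows "cmeasure (gmeas \<sigma> :: 'a::euclidean_space measure) (\<lambda>_. 1)"
proof -
  have "(\<integral>\<^sup>+x. ennreal (gauss \<sigma> (x::'a)) \<partial>lborel) = ennreal (LINT x|lborel. gauss \<sigma> (x::'a))"
    by (intro nn_integral_eq_integral gauss_fourier(1) assms) (simp add: less_imp_le[OF gauss_pos])
  then have "emeasure (gmeas \<sigma>) (space (gmeas \<sigma> :: 'a measure)) < \<infinity>"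
    by (simp add: gmeas_def emeasure_density)
  then have "finite_measure (gmeas \<sigma> :: 'a measure)" by (intro finite_measureI) auto
  then show ?thesis by (simp add: cmeasure_def finite_measure.integrable_const)
qed

lemma gmeas_fourier:
  assumes "\<sigma> > 0"
  shows "(LINT x|gmeas \<sigma>. cis (2 * pi * (x \<bullet> \<xi>))) = of_real (gkern \<sigma> (\<xi>::'a::euclidean_space))"
proof -
  have "(LINT x|gmeas \<sigma>. cis (2 * pi * (x \<bullet> \<xi>))) = (LINT x|lborel. gauss \<sigma> x *\<^sub>R cis (2 * pi * (x \<bullet> \<xi>)))"
    unfolding gmeas_def by (rule integral_density) (auto simp: less_imp_le[OF gauss_pos])
  also have "\<dots> = of_real (gkern \<sigma> \<xi>)"
    unfolding scaleR_conv_of_real by (rule gauss_fourier(2)[OF assms])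
  finally show ?thesis .
qed

lemma gkern_minus: "gkern \<sigma> (x - y) = gkern \<sigma> (y - x)"
  by (simp add: gkern_def norm_minus_commute)

lemma gkern_translate:
  fixes x :: "'a::euclidean_space"
  assumes "\<sigma> > 0"
  shows "integrable lborel (\<lambda>y. gkern \<sigma> (x - y))" and "(LINT y|lborel. gkern \<sigma> (x - y)) = 1"
proof -
  have eq: "distr lborel borel (\<lambda>y. - x + y) = lborel" by (rule lborel_distr_plus)
  have "integrable (distr lborel borel (\<lambda>y. - x + y)) (gkern \<sigma>)"
    unfolding eq by (rule gkern_integral(1)[OF assms])
  then have "integrable lborel (\<lambda>y. gkern \<sigma> (- x + y))"
    by (subst (asm) integrable_distr_eq) auto
  then show "integrable lborel (\<lambda>y. gkern \<sigma> (x - y))"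
    by (subst gkern_minus) simp
  have "1 = (LINT y|distr lborel borel (\<lambda>y. - x + y). gkern \<sigma> y)"
    unfolding eq by (rule gkern_integral(2)[OF assms, symmetric])
  also have "\<dots> = (LINT y|lborel. gkern \<sigma> (- x + y))"
    by (rule integral_distr) auto
  finally show "(LINT y|lborel. gkern \<sigma> (x - y)) = 1"
    by (subst gkern_minus) simp
qed

text \<open>By translation invariance the kernel has mass 1 in either variable; the two cases are
  the input of Schur's test.\<close>

lemma gkern_schur:
  fixes u :: "'a::euclidean_space \<Rightarrow> real"
  assumes s: "\<sigma> > 0" and u: "integrable lborel u"
  shows "integrable (lborel \<Otimes>\<^sub>M lborel) (\<lambda>z. u (fst z) * gkern \<sigma> (fst z - snd z))" (is "integrable _ ?f")
    and "(LINT z|(lborel \<Otimes>\<^sub>M lborel). u (fst z) * gkern \<sigma> (fst z - snd z)) = (LINT x|lborel. u x)"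
    and "integrable (lborel \<Otimes>\<^sub>M lborel) (\<lambda>z. u (snd z) * gkern \<sigma> (fst z - snd z))"
    and "(LINT z|(lborel \<Otimes>\<^sub>M lborel). u (snd z) * gkern \<sigma> (fst z - snd z)) = (LINT x|lborel. u x)"
proof -
  have [measurable]: "u \<in> borel_measurable borel" using u by auto
  have in1: "(LINT y|lborel. norm (?f (x, y))) = norm (u x)" for x
    using gkern_translate(2)[OF s, of x] by (simp add: abs_mult abs_of_nonneg[OF gkern_nonneg[OF s]])
  show i: "integrable (lborel \<Otimes>\<^sub>M lborel) ?f"
  proof (rule lborel_pair.Fubini_integrable)
    show "?f \<in> borel_measurable (lborel \<Otimes>\<^sub>M lborel)" by measurable
    show "integrable lborel (\<lambda>x. LINT y|lborel. norm (?f (x, y)))"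
      unfolding in1 using u by simp
    show "AE x in lborel. integrable lborel (\<lambda>y. ?f (x, y))"
      using gkern_translate(1)[OF s] by auto
  qed
  have "integral\<^sup>L (lborel \<Otimes>\<^sub>M lborel) ?f = (LINT x|lborel. LINT y|lborel. ?f (x, y))"
    by (rule lborel_pair.integral_fst'[OF i, symmetric])
  also have "\<dots> = (LINT x|lborel. u x)" by (simp add: gkern_translate(2)[OF s])
  finally show e: "integral\<^sup>L (lborel \<Otimes>\<^sub>M lborel) ?f = (LINT x|lborel. u x)" .
  have sw: "(\<lambda>z. u (snd z) * gkern \<sigma> (fst z - snd z)) = (\<lambda>(x, y). ?f (y, x))"
    by (auto simp: gkern_minus)
  show "integrable (lborel \<Otimes>\<^sub>M lborel) (\<lambda>z. u (snd z) * gkern \<sigma> (fst z - snd z))"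
    unfolding sw by (rule lborel_pair.integrable_product_swap[OF i])
  show "(LINT z|(lborel \<Otimes>\<^sub>M lborel). u (snd z) * gkern \<sigma> (fst z - snd z)) = (LINT x|lborel. u x)"
    unfolding sw e[symmetric] by (rule lborel_pair.integral_product_swap) measurable
qed

section \<open>Substitutes for Plancherel's theorem\<close>

text \<open>The square is a \<open>trig\<close> function on the product space, with differences of
  two points as frequencies. Pairing it with the Gaussian replaces each exponential by its transform
  \<open>gkern\<close>.\<close>

lemma ift_energy:
  fixes F :: "'a::euclidean_space \<Rightarrow> complex"
  assumes s: "\<sigma> > 0" and F: "integrable lborel F"
  shows "of_real (LINT x|gmeas \<sigma>. (norm (ift F x))^2) =
    (LINT z|(lborel \<Otimes>\<^sub>M lborel). F (fst z) * cnj (F (snd z)) * of_real (gkern \<sigma> (fst z - snd z)))"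
proof -
  have sp1: "spectral UNIV lborel F (\<lambda>t. t)"
    using F by (simp add: spectral_def lborel.sigma_finite_measure_axioms)
  have sp2: "spectral UNIV lborel (\<lambda>t. cnj (F t)) (\<lambda>t. - t)"
    using F by (simp add: spectral_def lborel.sigma_finite_measure_axioms)
  have cnj: "trig lborel (\<lambda>t. cnj (F t)) (\<lambda>t. - t) x = cnj (ift F x)" for x
    unfolding trig_def Bochner_Integration.integral_cnj[symmetric] by (simp add: cis_cnj)
  note TP = trig_prod[OF sp1 sp2, of UNIV]
  have "of_real (LINT x|gmeas \<sigma>. (norm (ift F x))^2) = (LINT x|gmeas \<sigma>. complex_of_real ((norm (ift F x))^2))"
    by (rule integral_complex_of_real[symmetric])
  also have "\<dots> = (LINT x|gmeas \<sigma>. ift F x * trig lborel (\<lambda>t. cnj (F t)) (\<lambda>t. - t) x * 1)"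
    unfolding cnj complex_norm_square by simp
  also have "\<dots> = (LINT x|gmeas \<sigma>. trig (lborel \<Otimes>\<^sub>M lborel) (\<lambda>z. F (fst z) * cnj (F (snd z))) (\<lambda>z. fst z + - snd z) x * 1)"
    using TP(2) by simp
  also have "\<dots> = (LINT z|(lborel \<Otimes>\<^sub>M lborel). F (fst z) * cnj (F (snd z)) * (LINT x|gmeas \<sigma>. 1 * cis (2 * pi * (x \<bullet> (fst z + - snd z)))))"
    by (rule trig_pair_integral[OF TP(1) cmeasure_gmeas[OF s]]) simp
  also have "\<dots> = (LINT z|(lborel \<Otimes>\<^sub>M lborel). F (fst z) * cnj (F (snd z)) * of_real (gkern \<sigma> (fst z - snd z)))"
    by (simp add: gmeas_fourier[OF s])
  finally show ?thesis .
qed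

text \<open>Schur's test: the arithmetic-geometric mean inequality separates the two values of
  \<open>F\<close>, and the kernel has mass 1 in each variable. The bound is uniform in
  \<sigma>.\<close>

lemma ift_energy_le:
  fixes F :: "'a::euclidean_space \<Rightarrow> complex"
  assumes s: "\<sigma> > 0" and F: "integrable lborel F" and F2: "integrable lborel (\<lambda>t. (norm (F t))^2)"
  shows "(LINT x|gmeas \<sigma>. (norm (ift F x))^2) \<le> (LINT t|lborel. (norm (F t))^2)"
proof -
  let ?g = "\<lambda>z. F (fst z) * cnj (F (snd z)) * of_real (gkern \<sigma> (fst z - snd z))"
  let ?h = "\<lambda>z. (norm (F (fst z)))^2 * gkern \<sigma> (fst z - snd z) + (norm (F (snd z)))^2 * gkern \<sigma> (fst z - snd z)"
  have [measurable]: "F \<in> borel_measurable borel" using F by auto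
  note S = gkern_schur[OF s F2]
  have le: "norm (?g z) \<le> 1/2 * ?h z" for z
  proof -
    have "norm (F (fst z)) * norm (F (snd z)) \<le> 1/2 * ((norm (F (fst z)))^2 + (norm (F (snd z)))^2)"
      using sum_squares_bound[of "norm (F (fst z))" "norm (F (snd z))"] by simp
    then have "norm (F (fst z)) * norm (F (snd z)) * gkern \<sigma> (fst z - snd z) \<le> 1/2 * ((norm (F (fst z)))^2 + (norm (F (snd z)))^2) * gkern \<sigma> (fst z - snd z)"
      by (rule mult_right_mono) (rule gkern_nonneg[OF s])
    then show ?thesis using gkern_nonneg[OF s, of "fst z - snd z"] by (simp add: norm_mult distrib_right distrib_left)
  qed
  have ih: "integrable (lborel \<Otimes>\<^sub>M lborel) (\<lambda>z. 1/2 * ?h z)"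
    using S(1,3) by (intro integrable_mult_right Bochner_Integration.integrable_add)
  have ig: "integrable (lborel \<Otimes>\<^sub>M lborel) ?g"
    using ih
  proof (rule Bochner_Integration.integrable_bound)
    have [measurable]: "(\<lambda>t. cnj (F t)) \<in> borel_measurable borel"
      using borel_measurable_integrable[OF integrable_cnj[OF F]] by simp
    have "(\<lambda>z. (\<lambda>t. cnj (F t)) (snd z)) \<in> borel_measurable (lborel \<Otimes>\<^sub>M lborel :: ('a \<times> 'a) measure)" by measurable
    then show "?g \<in> borel_measurable (lborel \<Otimes>\<^sub>M lborel)" by measurable
    show "AE z in lborel \<Otimes>\<^sub>M lborel. norm (?g z) \<le> norm (1/2 * ?h z)"
      unfolding real_norm_def by (intro AE_I2 order_trans[OF le abs_ge_self])
  qed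
  have "norm (integral\<^sup>L (lborel \<Otimes>\<^sub>M lborel) ?g) \<le> (LINT z|(lborel \<Otimes>\<^sub>M lborel). 1/2 * ?h z)"
    by (rule norm_integral_bound[OF ig ih le])
  also have "\<dots> = 1/2 * ((LINT t|lborel. (norm (F t))^2) + (LINT t|lborel. (norm (F t))^2))"
    using S by (simp only: integral_mult_right_zero Bochner_Integration.integral_add)
  also have "\<dots> = (LINT t|lborel. (norm (F t))^2)" by simp
  finally have "norm (complex_of_real (LINT x|gmeas \<sigma>. (norm (ift F x))^2)) \<le> (LINT t|lborel. (norm (F t))^2)"
    unfolding ift_energy[OF s F] .
  then show ?thesis by (simp only: norm_of_real)
qed

text \<open>Half of the Gaussian exponent pays for the small factor. The other half is, up to
  normalisation, the kernel at \<sigma> / sqrt 2, which again has mass 1.\<close>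

lemma gkern_tail:
  fixes s :: "'a::euclidean_space"
  assumes "\<sigma> > 0" "0 \<le> d" "norm s \<ge> d"
  shows "gkern \<sigma> s \<le> sqrt 2 ^ DIM('a) * exp (- (pi^2 * d^2 * \<sigma>^2)) * gkern (\<sigma> / sqrt 2) s"
proof -
  have eq: "(\<sigma> * sqrt (2 * pi))^DIM('a) = sqrt 2 ^ DIM('a) * (\<sigma> / sqrt 2 * sqrt (2 * pi))^DIM('a)"
    unfolding power_mult_distrib[symmetric] by simp
  have "d^2 \<le> (norm s)^2" using assms by (intro power_mono) auto
  then have le: "pi^2 * \<sigma>^2 * d^2 \<le> pi^2 * \<sigma>^2 * (norm s)^2" by (intro mult_left_mono) auto
  have half: "(\<sigma> / sqrt 2)^2 = \<sigma>^2 / 2" by (simp add: power_divide)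
  have "- 2 * pi^2 * \<sigma>^2 * (norm s)^2 = - 2 * (pi^2 * \<sigma>^2 * (norm s)^2)"
    "pi^2 * d^2 * \<sigma>^2 = pi^2 * \<sigma>^2 * d^2"
    "- 2 * pi^2 * (\<sigma> / sqrt 2)^2 * (norm s)^2 = - (pi^2 * \<sigma>^2 * (norm s)^2)"
    unfolding half by simp_all
  then have "- 2 * pi^2 * \<sigma>^2 * (norm s)^2 \<le> - (pi^2 * d^2 * \<sigma>^2) + - 2 * pi^2 * (\<sigma> / sqrt 2)^2 * (norm s)^2"
    using le by linarith
  then have ex: "exp (- 2 * pi^2 * \<sigma>^2 * (norm s)^2) \<le> exp (- (pi^2 * d^2 * \<sigma>^2)) * exp (- 2 * pi^2 * (\<sigma> / sqrt 2)^2 * (norm s)^2)"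
    by (simp only: exp_add[symmetric] exp_le_cancel_iff)
  have "gkern \<sigma> s \<le> (\<sigma> * sqrt (2 * pi))^DIM('a) * (exp (- (pi^2 * d^2 * \<sigma>^2)) * exp (- 2 * pi^2 * (\<sigma> / sqrt 2)^2 * (norm s)^2))"
    unfolding gkern_def by (rule mult_left_mono[OF ex]) (use assms(1) in simp)
  also have "\<dots> = sqrt 2 ^ DIM('a) * exp (- (pi^2 * d^2 * \<sigma>^2)) * gkern (\<sigma> / sqrt 2) s"
    unfolding eq gkern_def by (simp only: mult_ac)
  finally show ?thesis .
qed

text \<open>On a bounded set \<open>norm (F t)\<close> is dominated by 1 plus its square.\<close>

lemma integrable_sq_norm_supp:
  fixes F :: "'a::euclidean_space \<Rightarrow> complex"
  assumes "F \<in> borel_measurable borel" "integrable lborel (\<lambda>t. (norm (F t))^2)" "\<And>t. norm t > R \<Longrightarrow> F t = 0"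
  shows "integrable lborel F"
proof (rule Bochner_Integration.integrable_bound)
  show "integrable lborel (\<lambda>t. indicator (cball (0::'a) R) t + (norm (F t))^2 :: real)"
    by (intro Bochner_Integration.integrable_add integrable_indicator_cball assms)
  have "norm (F t) \<le> indicator (cball (0::'a) R) t + (norm (F t))^2" for t
  proof (cases "norm t \<le> R")
    case True
    have "norm (F t) \<le> 1 + (norm (F t))^2"
    proof (cases "norm (F t) \<le> 1")
      case True
      then show ?thesis using zero_le_power2[of "norm (F t)"] by (rule add_increasing2[rotated])
    next
      case False
      then have "norm (F t) \<le> (norm (F t))^2" by (intro self_le_power) auto
      then show ?thesis by simp
    qed
    then show ?thesis using True by simp
  next
    case False
    then show ?thesis using assms(3)[of t] by simp
  qed
  then show "AE t in lborel. norm (F t) \<le> norm (indicator (cball (0::'a) R) t + (norm (F t))^2 :: real)"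
    unfolding real_norm_def by (intro AE_I2) (rule order_trans[OF _ abs_ge_self])
qed (use assms in simp)

text \<open>The weighted energy tends to the full square integral as \<sigma> grows: replacing
  \<open>\<Phi> (snd z)\<close> by \<open>\<Phi> (fst z)\<close> costs at most \<open>e\<close> near
  the diagonal, by uniform continuity, and an exponentially small amount away from it, by
  \<open>gkern_tail\<close>.\<close>

lemma continuous_energy_limit:
  fixes \<Phi> :: "'a::euclidean_space \<Rightarrow> complex"
  assumes cont: "continuous_on UNIV \<Phi>" and supp: "\<And>t. norm t > R \<Longrightarrow> \<Phi> t = 0"
    and le: "\<And>\<sigma>. \<sigma> > 0 \<Longrightarrow> (LINT x|gmeas \<sigma>. (norm (ift \<Phi> x))^2) \<le> c"
  shows "(LINT t|lborel. (norm (\<Phi> t))^2) \<le> c"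
proof (rule field_le_epsilon)
  fix \<eta> :: real assume \<eta>: "\<eta> > 0"
  have meas: "\<Phi> \<in> borel_measurable borel" using cont by (rule borel_measurable_continuous_onI)
  have cb: "compact (cball (0::'a) (R+1))" by simp
  have supp': "\<Phi> t = 0" if "t \<notin> cball 0 R" for t using supp[of t] that by simp
  have "compact (\<Phi> ` cball 0 R)" by (intro compact_continuous_image continuous_on_subset[OF cont]) auto
  then obtain M where M: "M > 0" "\<And>t. t \<in> cball 0 R \<Longrightarrow> norm (\<Phi> t) \<le> M"
    using compact_imp_bounded[of "\<Phi> ` cball 0 R"] unfolding bounded_pos by blast
  have M': "norm (\<Phi> t) \<le> M" for t using M supp'[of t] by (cases "t \<in> cball 0 R") auto
  have sq: "integrable lborel (\<lambda>t. (norm (\<Phi> t))^2)"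
  proof (rule Bochner_Integration.integrable_bound)
    show "integrable lborel (\<lambda>t. M^2 * indicator (cball (0::'a) R) t)"
      by (intro integrable_mult_right integrable_indicator_cball)
    have le: "(norm (\<Phi> t))^2 \<le> M^2 * indicator (cball (0::'a) R) t" for t
      using M'[of t] supp'[of t] by (cases "t \<in> cball 0 R") (simp_all add: power_mono)
    then show "AE t in lborel. norm ((norm (\<Phi> t))^2) \<le> norm (M^2 * indicator (cball (0::'a) R) t :: real)"
      unfolding real_norm_def abs_of_nonneg[OF zero_le_power2]
      by (intro AE_I2 order_trans[OF le abs_ge_self])
  qed (use meas in measurable)
  have int: "integrable lborel \<Phi>" by (rule integrable_sq_norm_supp[OF meas sq supp])
  define I where "I = (LINT t|lborel. norm (\<Phi> t))"
  have I0: "I \<ge> 0" by (simp add: I_def)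
  \<comment> \<open>Dividing by I + 1 instead of I also covers I = 0.\<close>
  define e where "e = \<eta> / (I + 1)"
  have e: "e > 0" "e * I \<le> \<eta>"
  proof -
    show "e > 0" using \<eta> I0 by (simp add: e_def)
    then have "e * I \<le> e * (I + 1)" by (intro mult_left_mono) auto
    also have "e * (I + 1) = \<eta>" using I0 by (simp add: e_def)
    finally show "e * I \<le> \<eta>" .
  qed
  have ucU: "uniformly_continuous_on UNIV \<Phi>"
  proof -
    have uc: "uniformly_continuous_on (cball 0 (R+1)) \<Phi>"
      by (rule compact_uniformly_continuous[OF continuous_on_subset[OF cont] cb]) auto
    show ?thesis unfolding uniformly_continuous_on_def
    proof (intro allI impI)
      fix \<epsilon> :: real assume "\<epsilon> > 0"
      then obtain d where d: "d > 0" "\<And>x y. x \<in> cball 0 (R+1) \<Longrightarrow> y \<in> cball 0 (R+1) \<Longrightarrow> dist y x < d \<Longrightarrow> dist (\<Phi> y) (\<Phi> x) < \<epsilon>"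
        using uniformly_continuous_onE[OF uc \<open>\<epsilon> > 0\<close>] by metis
      \<comment> \<open>With distances below 1, a pair not contained in the ball of radius R + 1
        lies entirely outside the ball of radius R, where \<Phi> vanishes.\<close>
      have "dist (\<Phi> y) (\<Phi> x) < \<epsilon>" if xy: "dist y x < min d 1" for x y
      proof (cases "x \<in> cball 0 (R+1) \<and> y \<in> cball 0 (R+1)")
        case True then show ?thesis using d xy by auto
      next
        case False
        have "norm y \<le> norm x + dist y x" "norm x \<le> norm y + dist y x"
          using norm_triangle_sub[of y x] norm_triangle_sub[of x y] by (auto simp: dist_norm norm_minus_commute)
        then have "x \<notin> cball 0 R" "y \<notin> cball 0 R" using False xy by auto
        then show ?thesis using supp' \<open>\<epsilon> > 0\<close> by simp
      qed
      then show "\<exists>d>0. \<forall>x\<in>UNIV. \<forall>x'\<in>UNIV. dist x' x < d \<longrightarrow> dist (\<Phi> x') (\<Phi> x) < \<epsilon>"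
        using d(1) by (intro exI[of _ "min d 1"]) auto
    qed
  qed
  obtain d where d: "d > 0" "\<And>x y. dist y x < d \<Longrightarrow> dist (\<Phi> y) (\<Phi> x) < e"
    using uniformly_continuous_onE[OF ucU e(1)] by (metis UNIV_I)
  define C where "C \<sigma> = sqrt 2 ^ DIM('a) * exp (- (pi^2 * d^2 * \<sigma>^2))" for \<sigma> :: real
  have main: "(LINT t|lborel. (norm (\<Phi> t))^2) \<le> c + (e * I + 2 * M * C \<sigma> * I)" if s: "\<sigma> > 0" for \<sigma>
  proof -
    have s2: "\<sigma> / sqrt 2 > 0" using s by simp
    have C0: "C \<sigma> \<ge> 0" by (simp add: C_def)
    let ?k = "\<lambda>z. gkern \<sigma> (fst z - snd z :: 'a)" and ?k2 = "\<lambda>z. gkern (\<sigma> / sqrt 2) (fst z - snd z :: 'a)"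
    let ?N = "lborel \<Otimes>\<^sub>M lborel :: ('a \<times> 'a) measure"
    let ?a = "\<lambda>z. \<Phi> (fst z) * cnj (\<Phi> (snd z)) * of_real (?k z)"
    let ?b = "\<lambda>z. complex_of_real ((norm (\<Phi> (fst z)))^2 * ?k z)"
    let ?h = "\<lambda>z. e * (norm (\<Phi> (fst z)) * ?k z) + 2 * M * C \<sigma> * (norm (\<Phi> (fst z)) * ?k2 z)"
    note S1 = gkern_schur[OF s integrable_norm[OF int]] and S2 = gkern_schur[OF s2 integrable_norm[OF int]]
      and S3 = gkern_schur[OF s sq]
    have ib: "integrable ?N ?b" using S3(1) by (intro integrable_of_real)
    have ih: "integrable ?N ?h" using S1(1) S2(1) by (intro Bochner_Integration.integrable_add integrable_mult_right)
    have pt: "norm (?a z - ?b z) \<le> ?h z" for z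
    proof -
      have k0: "?k z \<ge> 0" "?k2 z \<ge> 0" using gkern_nonneg[OF s] gkern_nonneg[OF s2] by auto
      have "?b z = \<Phi> (fst z) * cnj (\<Phi> (fst z)) * of_real (?k z)"
        by (simp only: of_real_mult complex_norm_square)
      then have "?a z - ?b z = \<Phi> (fst z) * (cnj (\<Phi> (snd z)) - cnj (\<Phi> (fst z))) * of_real (?k z)"
        by (simp only: left_diff_distrib right_diff_distrib)
      then have eq: "norm (?a z - ?b z) = norm (\<Phi> (fst z)) * (norm (\<Phi> (snd z) - \<Phi> (fst z)) * ?k z)"
        using k0 by (simp only: norm_mult complex_cnj_diff[symmetric] complex_mod_cnj norm_of_real abs_of_nonneg mult.assoc)
      have "norm (\<Phi> (snd z) - \<Phi> (fst z)) * ?k z \<le> e * ?k z + 2 * M * C \<sigma> * ?k2 z"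
      proof (cases "dist (snd z) (fst z) < d")
        case True
        then have "norm (\<Phi> (snd z) - \<Phi> (fst z)) \<le> e" using d(2) by (simp add: dist_norm less_imp_le)
        then have "norm (\<Phi> (snd z) - \<Phi> (fst z)) * ?k z \<le> e * ?k z" using k0 by (intro mult_right_mono)
        moreover have "2 * M * C \<sigma> * ?k2 z \<ge> 0" using M(1) C0 k0 by simp
        ultimately show ?thesis by linarith
      next
        case False
        have "norm (\<Phi> (snd z) - \<Phi> (fst z)) \<le> 2 * M"
          using norm_triangle_ineq4[of "\<Phi> (snd z)" "\<Phi> (fst z)"] M'[of "fst z"] M'[of "snd z"] by linarith
        moreover have "?k z \<le> C \<sigma> * ?k2 z" unfolding C_def
          by (rule gkern_tail[OF s]) (use d False in \<open>auto simp: dist_norm norm_minus_commute\<close>)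
        ultimately have "norm (\<Phi> (snd z) - \<Phi> (fst z)) * ?k z \<le> 2 * M * (C \<sigma> * ?k2 z)"
          using k0 M(1) by (intro mult_mono) auto
        moreover have "e * ?k z \<ge> 0" using e k0 by simp
        ultimately show ?thesis by (simp add: mult.assoc)
      qed
      then have "norm (\<Phi> (fst z)) * (norm (\<Phi> (snd z) - \<Phi> (fst z)) * ?k z) \<le> norm (\<Phi> (fst z)) * (e * ?k z + 2 * M * C \<sigma> * ?k2 z)"
        by (rule mult_left_mono) simp
      also have "\<dots> = ?h z" by (simp only: distrib_left mult.left_commute[of "norm (\<Phi> (fst z))"])
      finally show ?thesis unfolding eq .
    qed
    have mab: "(\<lambda>z. ?a z - ?b z) \<in> borel_measurable ?N"
    proof -
      have [measurable]: "\<Phi> \<in> borel_measurable borel" "(\<lambda>t. cnj (\<Phi> t)) \<in> borel_measurable borel"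
        using meas borel_measurable_integrable[OF integrable_cnj[OF int]] by simp_all
      have "(\<lambda>z. (\<lambda>t. cnj (\<Phi> t)) (snd z)) \<in> borel_measurable ?N" by measurable
      then show ?thesis by measurable
    qed
    have iab: "integrable ?N (\<lambda>z. ?a z - ?b z)"
      using ih mab by (rule Bochner_Integration.integrable_bound)
        (unfold real_norm_def, intro AE_I2 order_trans[OF pt abs_ge_self])
    then have ia: "integrable ?N ?a" using Bochner_Integration.integrable_add[OF iab ib] by simp
    have "norm ((LINT z|?N. ?a z) - (LINT z|?N. ?b z)) = norm (LINT z|?N. ?a z - ?b z)"
      using ia ib by (simp only: Bochner_Integration.integral_diff)
    also have "\<dots> \<le> (LINT z|?N. ?h z)" by (rule norm_integral_bound[OF iab ih pt])
    also have "\<dots> = e * I + 2 * M * C \<sigma> * I"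
      using S1(1,2) S2(1,2) by (simp only: Bochner_Integration.integral_add integrable_mult_right integral_mult_right_zero I_def)
    finally have "norm (complex_of_real (LINT x|gmeas \<sigma>. (norm (ift \<Phi> x))^2) - complex_of_real (LINT t|lborel. (norm (\<Phi> t))^2)) \<le> e * I + 2 * M * C \<sigma> * I"
      unfolding ift_energy[OF s int, symmetric] integral_complex_of_real S3(2) .
    then have "\<bar>(LINT x|gmeas \<sigma>. (norm (ift \<Phi> x))^2) - (LINT t|lborel. (norm (\<Phi> t))^2)\<bar> \<le> e * I + 2 * M * C \<sigma> * I"
      by (simp only: of_real_diff[symmetric] norm_of_real)
    then show ?thesis using le[OF s] by linarith
  qed
  have "(LINT t|lborel. (norm (\<Phi> t))^2) \<le> c + (e * I + 0)"
  proof (rule tendsto_lowerbound)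
    have "((\<lambda>\<sigma>::real. exp (- (pi^2 * d^2 * \<sigma>^2))) \<longlongrightarrow> 0) at_top"
    proof -
      have "((\<lambda>\<sigma>::real. exp (- (a * \<sigma>^2))) \<longlongrightarrow> 0) at_top" if "a > 0" for a :: real
        using that by real_asymp
      moreover have "pi^2 * d^2 > 0" using d by simp
      ultimately show ?thesis by blast
    qed
    then have "((\<lambda>\<sigma>. 2 * M * C \<sigma> * I) \<longlongrightarrow> 2 * M * (sqrt 2 ^ DIM('a) * 0) * I) at_top"
      unfolding C_def by (intro tendsto_intros)
    then have "((\<lambda>\<sigma>. 2 * M * C \<sigma> * I) \<longlongrightarrow> 0) at_top" by simp
    then show "((\<lambda>\<sigma>. c + (e * I + 2 * M * C \<sigma> * I)) \<longlongrightarrow> c + (e * I + 0)) at_top"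
      by (intro tendsto_intros)
    show "\<forall>\<^sub>F \<sigma> in at_top. (LINT t|lborel. (norm (\<Phi> t))^2) \<le> c + (e * I + 2 * M * C \<sigma> * I)"
      using eventually_gt_at_top[of 0] by eventually_elim (rule main)
  qed simp
  then show "(LINT t|lborel. (norm (\<Phi> t))^2) \<le> c + \<eta>" using e(2) by simp
qed

lemma norm_add_sq_le: "(norm (a + b))^2 \<le> 2 * (norm a)^2 + 2 * (norm (b::'a::real_normed_vector))^2"
proof -
  have "(norm (a + b))^2 \<le> (norm a + norm b)^2" by (intro power_mono norm_triangle_ineq) simp
  also have "\<dots> \<le> 2 * (norm a)^2 + 2 * (norm b)^2"
    using sum_squares_bound[of "norm a" "norm b"] by (simp add: power2_sum)
  finally show ?thesis .
qed

text \<open>The values are truncated, and continuous functions converging almost everywhere to the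
  truncation are taken. These need be neither bounded nor compactly supported; projecting their
  values onto a disc and multiplying by a cutoff restores both without changing the limit, so
  dominated convergence applies.\<close>

lemma L2_approx_continuous:
  fixes F :: "'a::euclidean_space \<Rightarrow> complex"
  assumes [measurable]: "F \<in> borel_measurable borel" and sq: "integrable lborel (\<lambda>t. (norm (F t))^2)"
    and supp: "\<And>t. norm t > R \<Longrightarrow> F t = 0" and e: "e > 0"
  shows "\<exists>\<Phi>. continuous_on UNIV \<Phi> \<and> (\<forall>t. norm t > R + 1 \<longrightarrow> \<Phi> t = 0) \<and>
    integrable lborel (\<lambda>t. (norm (\<Phi> t - F t))^2) \<and> (LINT t|lborel. (norm (\<Phi> t - F t))^2) \<le> e"
proof -
  define H where "H k t = (if norm (F t) \<le> real k then F t else 0)" for k :: nat and t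
  have [measurable]: "H k \<in> borel_measurable borel" for k unfolding H_def by measurable
  have "(\<lambda>k. LINT t|lborel. (norm (H k t - F t))^2) \<longlonglongrightarrow> (LINT t::'a|lborel. (0::real))"
  proof (rule integral_dominated_convergence[where w="\<lambda>t. (norm (F t))^2"])
    show "AE t in lborel. (\<lambda>k. (norm (H k t - F t))^2) \<longlonglongrightarrow> 0"
    proof (intro AE_I2)
      fix t :: 'a
      obtain K :: nat where K: "norm (F t) \<le> real K" using real_arch_simple by blast
      have "\<forall>\<^sub>F k in sequentially. (norm (H k t - F t))^2 = 0"
        
        using eventually_ge_at_top[of K]
      proof eventually_elim
        case (elim k)
        then have "norm (F t) \<le> real k" using K by linarith
        then show ?case by (simp add: H_def)
      qed
      then show "(\<lambda>k. (norm (H k t - F t))^2) \<longlonglongrightarrow> 0" by (rule tendsto_eventually)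
    qed
    show "AE t in lborel. norm ((norm (H k t - F t))^2) \<le> (norm (F t))^2" for k
      by (intro AE_I2) (auto simp: H_def)
  qed (use sq in simp_all)
  \<comment> \<open>Two approximations are made, and the square of a sum doubles each error; a
    quarter of \<open>e\<close> apiece is therefore enough.\<close>
  then have "\<forall>\<^sub>F k in sequentially. (LINT t|lborel. (norm (H k t - F t))^2) < e / 4"
    using e by (intro order_tendstoD(2)[where y=0]) auto
  then obtain k where k: "(LINT t|lborel. (norm (H k t - F t))^2) < e / 4"
    by (auto simp: eventually_sequentially)
  define h where "h = H k"
  have [measurable]: "h \<in> borel_measurable borel" by (simp add: h_def)
  have hk: "norm (h t) \<le> real k" for t by (simp add: h_def H_def)
  have hs: "h t = 0" if "norm t > R" for t using supp[OF that] by (simp add: h_def H_def)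
  have "h \<in> borel_measurable lebesgue" by (rule measurable_completion) simp
  then have "h measurable_on UNIV"
    by (rule lebesgue_measurable_imp_measurable_on) simp
  then obtain N g where N: "negligible N" and g: "\<And>n. continuous_on UNIV (g n)" "\<And>t. t \<notin> N \<Longrightarrow> (\<lambda>n. g n t) \<longlonglongrightarrow> h t"
    unfolding measurable_on_def if_P[OF UNIV_I] by blast
  \<comment> \<open>The nearest-point projection is continuous and fixes the values of
    \<open>h\<close>.\<close>
  define P where "P = closest_point (cball (0::complex) (real k))"
  have Pc: "continuous_on A P" for A unfolding P_def by (rule continuous_on_closest_point) auto
  have Pn: "norm (P z) \<le> real k" for z
    using closest_point_in_set[of "cball (0::complex) (real k)" z] by (simp add: P_def)
  have Ph: "P (h t) = h t" for t unfolding P_def by (rule closest_point_self) (simp add: hk)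
  define cut where "cut t = max 0 (min 1 (R + 1 - norm (t::'a)))" for t
  have cutc: "continuous_on UNIV cut" unfolding cut_def by (intro continuous_intros)
  define \<Phi> where "\<Phi> n t = complex_of_real (cut t) * P (g n t)" for n t
  have \<Phi>c: "continuous_on UNIV (\<Phi> n)" for n
    unfolding \<Phi>_def

  proof (intro continuous_on_mult continuous_on_of_real cutc)
    show "continuous_on UNIV (\<lambda>t. P (g n t))"
      by (rule continuous_on_compose2[OF Pc[of UNIV] g(1)]) simp
  qed
  have [measurable]: "\<Phi> n \<in> borel_measurable borel" for n by (rule borel_measurable_continuous_onI[OF \<Phi>c])
  have \<Phi>0: "\<Phi> n t = 0" if "norm t > R + 1" for n t using that by (simp add: \<Phi>_def cut_def)
  have \<Phi>n: "norm (\<Phi> n t) \<le> real k" for n t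
  proof -
    have "\<bar>cut t\<bar> \<le> 1" by (simp add: cut_def)
    then have "\<bar>cut t\<bar> * norm (P (g n t)) \<le> 1 * real k" by (intro mult_mono Pn) auto
    then show ?thesis by (simp add: \<Phi>_def norm_mult)
  qed
  define w where "w t = (2 * real k)^2 * indicator (cball (0::'a) (R + 1)) t" for t
  have iw: "integrable lborel w" unfolding w_def by (intro integrable_mult_right integrable_indicator_cball)
  have dom: "(norm (\<Phi> n t - h t))^2 \<le> w t" for n t
  proof (cases "norm t \<le> R + 1")
    case True
    have "norm (\<Phi> n t - h t) \<le> 2 * real k" using norm_triangle_ineq4[of "\<Phi> n t" "h t"] \<Phi>n[of n t] hk[of t] by linarith
    then have "(norm (\<Phi> n t - h t))^2 \<le> (2 * real k)^2" by (intro power_mono) auto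
    then show ?thesis using True by (simp add: w_def)
  next
    case False
    then show ?thesis using \<Phi>0[of t n] hs[of t] by (simp add: w_def)
  qed
  have "(\<lambda>n. LINT t|lborel. (norm (\<Phi> n t - h t))^2) \<longlonglongrightarrow> (LINT t::'a|lborel. (0::real))"
  proof (rule integral_dominated_convergence[where w=w])
    have "N \<in> null_sets lebesgue" using N by (simp add: negligible_iff_null_sets)
    then have "AE t in lebesgue. t \<notin> N" by (rule AE_not_in)
    then have "AE t in lborel. t \<notin> N" by (simp add: AE_completion_iff)
    then show "AE t in lborel. (\<lambda>n. (norm (\<Phi> n t - h t))^2) \<longlonglongrightarrow> 0"
    proof eventually_elim
      case (elim t)
      have "isCont P (h t)" using Pc[of UNIV] by (simp add: continuous_on_eq_continuous_at)
      then have "(\<lambda>n. P (g n t)) \<longlonglongrightarrow> P (h t)" using g(2)[OF elim] by (rule isCont_tendsto_compose)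
      then have "(\<lambda>n. \<Phi> n t) \<longlonglongrightarrow> complex_of_real (cut t) * h t"
        unfolding \<Phi>_def Ph by (intro tendsto_intros)
      moreover have "complex_of_real (cut t) * h t = h t"
        using hs[of t] by (cases "norm t \<le> R") (auto simp: cut_def)
      ultimately have "(\<lambda>n. \<Phi> n t) \<longlonglongrightarrow> h t" by simp
      then have "(\<lambda>n. (norm (\<Phi> n t - h t))^2) \<longlonglongrightarrow> (norm (h t - h t))^2" by (intro tendsto_intros)
      then show ?case by simp
    qed
    show "AE t in lborel. norm ((norm (\<Phi> n t - h t))^2) \<le> w t" for n
      unfolding real_norm_def abs_power2 by (intro AE_I2 dom)
  qed (use iw in simp_all)
  then have "\<forall>\<^sub>F n in sequentially. (LINT t|lborel. (norm (\<Phi> n t - h t))^2) < e / 4"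
    using e by (intro order_tendstoD(2)[where y=0]) auto
  then obtain n where n: "(LINT t|lborel. (norm (\<Phi> n t - h t))^2) < e / 4"
    by (auto simp: eventually_sequentially)
  have i1: "integrable lborel (\<lambda>t. (norm (\<Phi> n t - h t))^2)"
    using iw
  proof (rule Bochner_Integration.integrable_bound)
    show "AE t in lborel. norm ((norm (\<Phi> n t - h t))^2) \<le> norm (w t)"
      unfolding real_norm_def abs_power2 by (intro AE_I2 order_trans[OF dom abs_ge_self])
  qed measurable
  have i2: "integrable lborel (\<lambda>t. (norm (h t - F t))^2)"
    using sq by (rule Bochner_Integration.integrable_bound) (auto simp: h_def H_def)
  have le: "(norm (\<Phi> n t - F t))^2 \<le> 2 * (norm (\<Phi> n t - h t))^2 + 2 * (norm (h t - F t))^2" for t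
    using norm_add_sq_le[of "\<Phi> n t - h t" "h t - F t"] by simp
  have i12: "integrable lborel (\<lambda>t. 2 * (norm (\<Phi> n t - h t))^2 + 2 * (norm (h t - F t))^2)" using i1 i2 by simp
  have i: "integrable lborel (\<lambda>t. (norm (\<Phi> n t - F t))^2)"
    using i12
  proof (rule Bochner_Integration.integrable_bound)
    show "AE t in lborel. norm ((norm (\<Phi> n t - F t))^2) \<le> norm (2 * (norm (\<Phi> n t - h t))^2 + 2 * (norm (h t - F t))^2)"
      unfolding real_norm_def abs_power2 by (intro AE_I2 order_trans[OF le abs_ge_self])
  qed measurable
  have "(LINT t|lborel. (norm (\<Phi> n t - F t))^2) \<le> (LINT t|lborel. 2 * (norm (\<Phi> n t - h t))^2 + 2 * (norm (h t - F t))^2)"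
    by (rule integral_mono[OF i i12 le])
  also have "\<dots> = 2 * (LINT t|lborel. (norm (\<Phi> n t - h t))^2) + 2 * (LINT t|lborel. (norm (h t - F t))^2)"
    using i1 i2 by simp
  also have "\<dots> \<le> e" using n k by (simp add: h_def)
  finally show ?thesis using \<Phi>c \<Phi>0 i by (intro exI[of _ "\<Phi> n"]) auto
qed

lemma integrable_gmeas_ift_sq:
  assumes "\<sigma> > 0" "integrable lborel F"
  shows "integrable (gmeas \<sigma>) (\<lambda>x. (norm (ift F x))^2)"
proof -
  interpret finite_measure "gmeas \<sigma>" using cmeasure_gmeas[OF assms(1)] unfolding cmeasure_def by blast
  have [measurable]: "ift F \<in> borel_measurable borel"
    using assms(2) by (intro borel_measurable_trig lborel.sigma_finite_measure_axioms) auto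
  show ?thesis
  proof (rule integrable_const_bound)
    show "AE x in gmeas \<sigma>. norm ((norm (ift F x))^2) \<le> (LINT t|lborel. norm (F t))^2"
      using norm_trig_le[OF assms(2), of "\<lambda>t. t"] by (intro AE_I2) (simp add: power_mono)
  qed measurable
qed

text \<open>Approximation by a continuous function reduces this to
  \<open>continuous_energy_limit\<close>. Passing from \<open>F\<close> to the approximant and back
  each costs a factor 2, hence the 4.\<close>

lemma ift_energy_lower:
  fixes F :: "'a::euclidean_space \<Rightarrow> complex"
  assumes F: "F \<in> borel_measurable borel" and sq: "integrable lborel (\<lambda>t. (norm (F t))^2)"
    and supp: "\<And>t. norm t > R \<Longrightarrow> F t = 0"
    and le: "\<And>\<sigma>. \<sigma> > 0 \<Longrightarrow> (LINT x|gmeas \<sigma>. (norm (ift F x))^2) \<le> c"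
  shows "(LINT t|lborel. (norm (F t))^2) \<le> 4 * c"
proof (rule field_le_epsilon)
  fix e :: real assume "e > 0"
  \<comment> \<open>The approximation error enters with factor 4 on the way to the approximant and
    with factor 2 on the way back.\<close>
  then have e: "e / 6 > 0" by simp
  obtain \<Phi> where \<Phi>: "continuous_on UNIV \<Phi>" "\<And>t. norm t > R + 1 \<Longrightarrow> \<Phi> t = 0"
    "integrable lborel (\<lambda>t. (norm (\<Phi> t - F t))^2)" "(LINT t|lborel. (norm (\<Phi> t - F t))^2) \<le> e / 6"
    using L2_approx_continuous[OF F sq supp e] by blast
  have \<Phi>m: "\<Phi> \<in> borel_measurable borel" by (rule borel_measurable_continuous_onI[OF \<Phi>(1)])
  have iF: "integrable lborel F" by (rule integrable_sq_norm_supp[OF F sq supp])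
  have iD: "integrable lborel (\<lambda>t. \<Phi> t - F t)"
    by (rule integrable_sq_norm_supp[OF _ \<Phi>(3), of "R + 1"]) (use F \<Phi>m \<Phi>(2) supp in auto)
  have i\<Phi>: "integrable lborel \<Phi>" using Bochner_Integration.integrable_add[OF iD iF] by simp
  have lin: "ift \<Phi> x = ift F x + ift (\<lambda>t. \<Phi> t - F t) x" for x
  proof -
    have "integrable lborel (\<lambda>t. F t * cis (2 * pi * (x \<bullet> t)))" "integrable lborel (\<lambda>t. (\<Phi> t - F t) * cis (2 * pi * (x \<bullet> t)))"
      by (intro integrable_mult_bounded iF iD; simp)+
    from Bochner_Integration.integral_add[OF this] show ?thesis by (simp add: trig_def distrib_right[symmetric])
  qed
  have "(LINT x|gmeas \<sigma>. (norm (ift \<Phi> x))^2) \<le> 2 * c + 2 * (e / 6)" if s: "\<sigma> > 0" for \<sigma>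
  proof -
    note I = integrable_gmeas_ift_sq[OF s iF] integrable_gmeas_ift_sq[OF s iD]
    have "(LINT x|gmeas \<sigma>. (norm (ift \<Phi> x))^2) \<le> (LINT x|gmeas \<sigma>. 2 * (norm (ift F x))^2 + 2 * (norm (ift (\<lambda>t. \<Phi> t - F t) x))^2)"
    proof (rule integral_mono)
      show "integrable (gmeas \<sigma>) (\<lambda>x. (norm (ift \<Phi> x))^2)" by (rule integrable_gmeas_ift_sq[OF s i\<Phi>])
    qed (use I norm_add_sq_le in \<open>auto simp: lin\<close>)
    also have "\<dots> = 2 * (LINT x|gmeas \<sigma>. (norm (ift F x))^2) + 2 * (LINT x|gmeas \<sigma>. (norm (ift (\<lambda>t. \<Phi> t - F t) x))^2)"
      using I by simp
    also have "\<dots> \<le> 2 * c + 2 * (e / 6)"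
      using le[OF s] ift_energy_le[OF s iD \<Phi>(3)] \<Phi>(4) by linarith
    finally show ?thesis .
  qed
  from continuous_energy_limit[OF \<Phi>(1,2) this]
  have c: "(LINT t|lborel. (norm (\<Phi> t))^2) \<le> 2 * c + 2 * (e / 6)" .
  have le1: "(norm (\<Phi> t))^2 \<le> 2 * (norm (\<Phi> t - F t))^2 + 2 * (norm (F t))^2" for t
    using norm_add_sq_le[of "\<Phi> t - F t" "F t"] by simp
  have sqD: "integrable lborel (\<lambda>t. 2 * (norm (\<Phi> t - F t))^2 + 2 * (norm (F t))^2)" using \<Phi>(3) sq by simp
  have sq\<Phi>: "integrable lborel (\<lambda>t. (norm (\<Phi> t))^2)"
    using sqD
  proof (rule Bochner_Integration.integrable_bound)
    show "AE t in lborel. norm ((norm (\<Phi> t))^2) \<le> norm (2 * (norm (\<Phi> t - F t))^2 + 2 * (norm (F t))^2)"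
      unfolding real_norm_def abs_power2 by (intro AE_I2 order_trans[OF le1 abs_ge_self])
  qed (use \<Phi>m in measurable)
  have le2: "(norm (F t))^2 \<le> 2 * (norm (\<Phi> t))^2 + 2 * (norm (\<Phi> t - F t))^2" for t
    using norm_add_sq_le[of "\<Phi> t" "F t - \<Phi> t"] by (simp add: norm_minus_commute)
  have "(LINT t|lborel. (norm (F t))^2) \<le> (LINT t|lborel. 2 * (norm (\<Phi> t))^2 + 2 * (norm (\<Phi> t - F t))^2)"
    by (rule integral_mono[OF sq _ le2]) (use sq\<Phi> \<Phi>(3) in simp)
  also have "\<dots> = 2 * (LINT t|lborel. (norm (\<Phi> t))^2) + 2 * (LINT t|lborel. (norm (\<Phi> t - F t))^2)"
    using sq\<Phi> \<Phi>(3) by simp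
  also have "\<dots> \<le> 4 * c + e" using c \<Phi>(4) by linarith
  finally show "(LINT t|lborel. (norm (F t))^2) \<le> 4 * c + e" .
qed

section \<open>The upper frame bound\<close>

text \<open>Each kernel value is compared with an average of a slightly wider kernel over a ball
  around its point. Separation makes these balls disjoint, so the sum is at most a multiple of one
  integral.\<close>

lemma separated_gkern_sum:
  fixes E :: "'a::euclidean_space set"
  assumes "separated E"
  shows "\<exists>C>0. \<forall>A x. finite A \<longrightarrow> A \<subseteq> E \<longrightarrow> (\<Sum>y\<in>A. gkern 1 (x - y)) \<le> C"
proof -
  obtain \<delta> where \<delta>: "\<delta> > 0" "\<And>x y. x \<in> E \<Longrightarrow> y \<in> E \<Longrightarrow> x \<noteq> y \<Longrightarrow> \<delta> \<le> dist x y"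
    using assms unfolding separated_def by blast
  define r where "r = \<delta> / 2"
  have r: "r > 0" using \<delta> by (simp add: r_def)
  define V where "V = measure lborel (ball (0::'a) r)"
  have V: "V > 0" unfolding V_def using content_ball_pos[OF r, of "0::'a"] by simp
  define C where "C = sqrt 2 ^ DIM('a) * exp (2 * pi^2 * r^2)"
  have C: "C > 0" by (simp add: C_def)
  \<comment> \<open>The doubled squared distance in |x - t|^2 <= 2 |x - y|^2 + 2 r^2 is offset by
    the parameter 1 / sqrt 2, and the exponential in \<open>C\<close> pays for the radius.\<close>
  have pt: "gkern 1 (x - y) \<le> C * gkern (1 / sqrt 2) (x - t)" if t: "dist y t < r" for x y t :: 'a
  proof -
    have "(norm (x - t))^2 \<le> 2 * (norm (x - y))^2 + 2 * (norm (y - t))^2"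
      using norm_add_sq_le[of "x - y" "y - t"] by simp
    moreover have "(norm (y - t))^2 \<le> r^2" using t by (intro power_mono) (auto simp: dist_norm)
    ultimately have "(norm (x - t))^2 \<le> 2 * (norm (x - y))^2 + 2 * r^2" by linarith
    then have "pi^2 * (norm (x - t))^2 \<le> pi^2 * (2 * (norm (x - y))^2 + 2 * r^2)" by (intro mult_left_mono) auto
    moreover have "(1 / sqrt 2)^2 = (1/2::real)" by (simp add: power_divide)
    then have "- 2 * pi^2 * 1^2 * (norm (x - y))^2 = - (pi^2 * (2 * (norm (x - y))^2))"
      "- 2 * pi^2 * (1 / sqrt 2)^2 * (norm (x - t))^2 = - (pi^2 * (norm (x - t))^2)"
      "2 * pi^2 * r^2 = pi^2 * (2 * r^2)"
      by simp_all
    ultimately have ex: "- 2 * pi^2 * 1^2 * (norm (x - y))^2 \<le> 2 * pi^2 * r^2 + - 2 * pi^2 * (1 / sqrt 2)^2 * (norm (x - t))^2"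
      unfolding distrib_left by linarith
    have eq: "(1 * sqrt (2 * pi))^DIM('a) = sqrt 2 ^ DIM('a) * (1 / sqrt 2 * sqrt (2 * pi))^DIM('a)"
      unfolding power_mult_distrib[symmetric] by simp
    have ex': "exp (- 2 * pi^2 * 1^2 * (norm (x - y))^2) \<le> exp (2 * pi^2 * r^2) * exp (- 2 * pi^2 * (1 / sqrt 2)^2 * (norm (x - t))^2)"
      using ex by (simp only: exp_add[symmetric] exp_le_cancel_iff)
    have "gkern 1 (x - y) \<le> (1 * sqrt (2 * pi))^DIM('a) * (exp (2 * pi^2 * r^2) * exp (- 2 * pi^2 * (1 / sqrt 2)^2 * (norm (x - t))^2))"
      unfolding gkern_def by (rule mult_left_mono[OF ex']) simp
    also have "\<dots> = C * gkern (1 / sqrt 2) (x - t)"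
      unfolding eq gkern_def C_def by (simp only: mult_ac)
    finally show ?thesis .
  qed
  have s2: "1 / sqrt 2 > (0::real)" by simp
  have "(\<Sum>y\<in>A. gkern 1 (x - y)) \<le> C / V" if A: "finite A" "A \<subseteq> E" for A x
  proof -
    let ?f = "\<lambda>t. C * gkern (1 / sqrt 2) (x - t)"
    have if': "integrable lborel ?f" by (intro integrable_mult_right gkern_translate(1)[OF s2])
    have iy: "integrable lborel (\<lambda>t. indicator (ball y r) t * ?f t)" for y
      using integrable_mult_indicator[OF _ if', of "ball y r"] by simp
    have "V * gkern 1 (x - y) \<le> (LINT t|lborel. indicator (ball y r) t * ?f t)" for y
    proof -
      have "V = measure lborel (ball y r)"
        using content_ball_conv_unit_ball[of r "0::'a"] content_ball_conv_unit_ball[of r y] r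
        by (simp add: V_def)
      then have "V * gkern 1 (x - y) = (LINT t|lborel. indicator (ball y r) t * gkern 1 (x - y))" by simp
      also have "\<dots> \<le> (LINT t|lborel. indicator (ball y r) t * ?f t)"
      proof (rule integral_mono[OF _ iy])
        show "integrable lborel (\<lambda>t. indicator (ball y r) t * gkern 1 (x - y))"
          using emeasure_lborel_ball_finite[of y r] by (intro integrable_mult_left integrable_real_indicator) auto
        show "indicator (ball y r) t * gkern 1 (x - y) \<le> indicator (ball y r) t * ?f t" for t
          using pt[of y t x] by (simp add: indicator_def)
      qed
      finally show ?thesis .
    qed
    then have "(\<Sum>y\<in>A. V * gkern 1 (x - y)) \<le> (\<Sum>y\<in>A. (LINT t|lborel. indicator (ball y r) t * ?f t))"
      by (intro sum_mono)
    also have "\<dots> = (LINT t|lborel. (\<Sum>y\<in>A. indicator (ball y r) t * ?f t))"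
      by (rule Bochner_Integration.integral_sum[symmetric]) (rule iy)
    also have "\<dots> \<le> (LINT t|lborel. ?f t)"
    proof (rule integral_mono[OF _ if'])
      show "integrable lborel (\<lambda>t. \<Sum>y\<in>A. indicator (ball y r) t * ?f t)"
        by (rule Bochner_Integration.integrable_sum) (rule iy)
      fix t
      have f0: "?f t \<ge> 0" using C gkern_nonneg[OF s2, of "x - t"] by (intro mult_nonneg_nonneg) auto
      have "(\<Sum>y\<in>A. indicator (ball y r) t * ?f t) = (\<Sum>y\<in>A. indicator (ball y r) t) * ?f t"
        by (simp add: sum_distrib_right)
      also have "\<dots> \<le> 1 * ?f t"
      proof (rule mult_right_mono[OF _ f0])
        show "(\<Sum>y\<in>A. indicator (ball y r) t :: real) \<le> 1"
        proof (cases "\<exists>y\<in>A. t \<in> ball y r")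
          case True
          then obtain y where y: "y \<in> A" "t \<in> ball y r" by blast
          have "indicator (ball z r) t = (0::real)" if "z \<in> A - {y}" for z
          proof -
            have "\<delta> \<le> dist z y" using \<delta>(2)[of z y] that y A by auto
            then have "\<not> dist z t < r" using dist_triangle2[of z y t] y by (auto simp: r_def)
            then show ?thesis by simp
          qed
          then have "(\<Sum>z\<in>A. indicator (ball z r) t :: real) = indicator (ball y r) t"
            using A(1) y(1) by (simp add: sum.remove[of A y])
          then show ?thesis by (simp add: indicator_def)
        next
          case False
          then have "(\<Sum>y\<in>A. indicator (ball y r) t :: real) = 0" by (intro sum.neutral) auto
          then show ?thesis by simp
        qed
      qed
      finally show "(\<Sum>y\<in>A. indicator (ball y r) t * ?f t) \<le> ?f t" by simp
    qed
    also have "\<dots> = C" by (simp only: integral_mult_right_zero gkern_translate(2)[OF s2] mult_1_right)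
    finally have "V * (\<Sum>y\<in>A. gkern 1 (x - y)) \<le> C" by (simp add: sum_distrib_left)
    then show ?thesis using V by (simp add: field_simps)
  qed
  then show ?thesis using C V by (intro exI[of _ "C / V"]) auto
qed

text \<open>Expanding the square gives the quadratic form of the symmetric matrix
  \<open>gkern 1 (x - y)\<close>, whose row sums are at most \<open>C\<close>; Schur's test applies.
  This bounds the adjoint of the sampling map.\<close>

lemma trig_poly_energy:
  fixes A :: "'a::euclidean_space set" and a :: "'a \<Rightarrow> complex"
  assumes A: "finite A" and C: "\<And>x. x \<in> A \<Longrightarrow> (\<Sum>y\<in>A. gkern 1 (x - y)) \<le> C"
  shows "integrable (gmeas 1) (\<lambda>t. (norm (\<Sum>x\<in>A. a x * cis (2 * pi * (x \<bullet> t))))^2)"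
    and "(LINT t|gmeas 1. (norm (\<Sum>x\<in>A. a x * cis (2 * pi * (x \<bullet> t))))^2) \<le> C * (\<Sum>x\<in>A. (norm (a x))^2)"
proof -
  have cm: "cmeasure (gmeas 1 :: 'a measure) (\<lambda>_. 1)" by (rule cmeasure_gmeas) simp
  let ?T = "\<lambda>t. \<Sum>x\<in>A. a x * cis (2 * pi * (x \<bullet> t))"
  have sq: "complex_of_real ((norm (?T t))^2) = (\<Sum>x\<in>A. \<Sum>y\<in>A. a x * cnj (a y) * cis (2 * pi * (t \<bullet> (x - y))))" for t
  proof -
    have "complex_of_real ((norm (?T t))^2) = ?T t * (\<Sum>y\<in>A. cnj (a y) * cis (- (2 * pi * (y \<bullet> t))))"
      unfolding complex_norm_square by (simp add: cis_cnj)
    also have "\<dots> = (\<Sum>x\<in>A. \<Sum>y\<in>A. (a x * cis (2 * pi * (x \<bullet> t))) * (cnj (a y) * cis (- (2 * pi * (y \<bullet> t)))))"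
      by (rule sum_product)
    also have "\<dots> = (\<Sum>x\<in>A. \<Sum>y\<in>A. a x * cnj (a y) * cis (2 * pi * (t \<bullet> (x - y))))"
    proof (intro sum.cong refl)
      fix x y
      have "cis (2 * pi * (x \<bullet> t)) * cis (- (2 * pi * (y \<bullet> t))) = cis (2 * pi * (t \<bullet> (x - y)))"
        unfolding cis_mult by (simp add: inner_diff_right right_diff_distrib inner_commute)
      then show "(a x * cis (2 * pi * (x \<bullet> t))) * (cnj (a y) * cis (- (2 * pi * (y \<bullet> t)))) = a x * cnj (a y) * cis (2 * pi * (t \<bullet> (x - y)))"
        by (metis (no_types, lifting) mult.assoc mult.left_commute)
    qed
    finally show ?thesis .
  qed
  have ic: "integrable (gmeas 1) (\<lambda>t::'a. cis (2 * pi * (t \<bullet> \<xi>)))" for \<xi> :: 'a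
    using cmeasure_integrable_bounded[OF cm, of "\<lambda>t. cis (2 * pi * (t \<bullet> \<xi>))"] by (auto simp: bounded_iff)
  have i2: "integrable (gmeas 1) (\<lambda>t. complex_of_real ((norm (?T t))^2))"
    unfolding sq by (intro Bochner_Integration.integrable_sum integrable_mult_right ic)
  then show "integrable (gmeas 1) (\<lambda>t. (norm (?T t))^2)" by (simp only: complex_of_real_integrable_eq)
  have "complex_of_real (LINT t|gmeas 1. (norm (?T t))^2) = (LINT t|gmeas 1. complex_of_real ((norm (?T t))^2))"
    by (rule integral_complex_of_real[symmetric])
  also have "\<dots> = (\<Sum>x\<in>A. \<Sum>y\<in>A. a x * cnj (a y) * of_real (gkern 1 (x - y)))"
    unfolding sq using ic by (simp add: Bochner_Integration.integral_sum gmeas_fourier del: complex_integrable_cnj)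
  finally have eq: "complex_of_real (LINT t|gmeas 1. (norm (?T t))^2) = (\<Sum>x\<in>A. \<Sum>y\<in>A. a x * cnj (a y) * of_real (gkern 1 (x - y)))" .
  have g0: "gkern 1 (x::'a) \<ge> 0" for x by (rule gkern_nonneg) simp
  have "(LINT t|gmeas 1. (norm (?T t))^2) \<le> norm (complex_of_real (LINT t|gmeas 1. (norm (?T t))^2))"
    by simp
  also have "\<dots> \<le> (\<Sum>x\<in>A. \<Sum>y\<in>A. norm (a x * cnj (a y) * of_real (gkern 1 (x - y))))"
    unfolding eq by (intro order_trans[OF norm_sum] sum_mono norm_sum)
  also have "\<dots> \<le> (\<Sum>x\<in>A. \<Sum>y\<in>A. 1/2 * ((norm (a x))^2 * gkern 1 (x - y)) + 1/2 * ((norm (a y))^2 * gkern 1 (x - y)))"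
  proof (intro sum_mono)
    fix x y
    have "norm (a x) * norm (a y) \<le> 1/2 * (norm (a x))^2 + 1/2 * (norm (a y))^2"
      using sum_squares_bound[of "norm (a x)" "norm (a y)"] by simp
    then have "norm (a x) * norm (a y) * gkern 1 (x - y) \<le> (1/2 * (norm (a x))^2 + 1/2 * (norm (a y))^2) * gkern 1 (x - y)"
      by (rule mult_right_mono[OF _ g0])
    then show "norm (a x * cnj (a y) * of_real (gkern 1 (x - y))) \<le> 1/2 * ((norm (a x))^2 * gkern 1 (x - y)) + 1/2 * ((norm (a y))^2 * gkern 1 (x - y))"
      using g0[of "x - y"] by (simp add: norm_mult distrib_right)
  qed
  also have "\<dots> = 1/2 * (\<Sum>x\<in>A. \<Sum>y\<in>A. (norm (a x))^2 * gkern 1 (x - y)) + 1/2 * (\<Sum>x\<in>A. \<Sum>y\<in>A. (norm (a y))^2 * gkern 1 (x - y))"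
    by (simp only: sum.distrib sum_distrib_left)
  also have "(\<Sum>x\<in>A. \<Sum>y\<in>A. (norm (a y))^2 * gkern 1 (x - y)) = (\<Sum>x\<in>A. \<Sum>y\<in>A. (norm (a x))^2 * gkern 1 (x - y))"
    by (subst sum.swap) (simp only: gkern_minus[of 1])
  also have "1/2 * (\<Sum>x\<in>A. \<Sum>y\<in>A. (norm (a x))^2 * gkern 1 (x - y)) + 1/2 * (\<Sum>x\<in>A. \<Sum>y\<in>A. (norm (a x))^2 * gkern 1 (x - y))
      = (\<Sum>x\<in>A. (norm (a x))^2 * (\<Sum>y\<in>A. gkern 1 (x - y)))"
    by (simp add: sum_distrib_left)
  also have "\<dots> \<le> (\<Sum>x\<in>A. (norm (a x))^2 * C)"
    by (intro sum_mono mult_left_mono C) auto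
  also have "\<dots> = C * (\<Sum>x\<in>A. (norm (a x))^2)" by (simp add: sum_distrib_left mult.commute)
  finally show "(LINT t|gmeas 1. (norm (?T t))^2) \<le> C * (\<Sum>x\<in>A. (norm (a x))^2)" .
qed

text \<open>Duality: the sum of squares is the integral of \<open>F\<close> against the
  trigonometric polynomial whose coefficients are the conjugate samples. On the support of
  \<open>F\<close> the Gaussian is bounded below, so the weighted energy of that polynomial controls
  it; this energy is at most \<open>C\<close> times the sum itself, which is then absorbed. The
  constant is uniform over finite subsets of \<open>E\<close>, as summability will require.\<close>

lemma plancherel_polya:
  fixes E :: "'a::euclidean_space set"
  assumes "separated E"
  shows "\<exists>B>0. \<forall>F A. F \<in> borel_measurable borel \<longrightarrow> integrable lborel (\<lambda>t. (norm (F t))^2) \<longrightarrow>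
    (\<forall>t. norm t > R \<longrightarrow> F t = 0) \<longrightarrow> finite A \<longrightarrow> A \<subseteq> E \<longrightarrow>
    (\<Sum>x\<in>A. (norm (ift F x))^2) \<le> B * (LINT t|lborel. (norm (F t))^2)"
proof -
  obtain C where C: "C > 0" "\<And>A x. finite A \<Longrightarrow> A \<subseteq> E \<Longrightarrow> (\<Sum>y\<in>A. gkern 1 (x - y)) \<le> C"
    using separated_gkern_sum[OF assms] by blast
  \<comment> \<open>The reciprocal of the value of \<open>gauss 1\<close> at distance
    \<open>R\<close> from the origin.\<close>
  define G where "G = exp (R^2 / 2)"
  have G: "G > 0" by (simp add: G_def)
  \<comment> \<open>the weight in \<open>2 X Y \<le> p X\<^sup>2 + Y\<^sup>2 / p\<close> for which the second term contributes exactly half of the sum\<close>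
  define p where "p = G * C"
  have p: "p > 0" using G C by (simp add: p_def)
  have gG: "1 \<le> G * gauss 1 t" if "norm t \<le> R" for t :: 'a
  proof -
    have "(norm t)^2 \<le> R^2" using that by (intro power_mono) auto
    then have "0 \<le> R^2 / 2 + - ((norm t)^2) / (2 * 1^2)" by simp
    then have "exp 0 \<le> exp (R^2 / 2 + - ((norm t)^2) / (2 * 1^2))" by (simp only: exp_le_cancel_iff)
    then show ?thesis by (simp only: exp_zero exp_add G_def gauss_def)
  qed
  have "(\<Sum>x\<in>A. (norm (ift F x))^2) \<le> p * (LINT t|lborel. (norm (F t))^2)"
    if F: "F \<in> borel_measurable borel" and sq: "integrable lborel (\<lambda>t. (norm (F t))^2)"
      and supp: "\<And>t. norm t > R \<Longrightarrow> F t = 0" and A: "finite A" "A \<subseteq> E" for F A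
  proof -
    have iF: "integrable lborel F" by (rule integrable_sq_norm_supp[OF F sq supp])
    define S where "S = (\<Sum>x\<in>A. (norm (ift F x))^2)"
    define a where "a x = cnj (ift F x)" for x
    define T where "T t = (\<Sum>x\<in>A. a x * cis (2 * pi * (x \<bullet> t)))" for t
    have [measurable]: "T \<in> borel_measurable borel" unfolding T_def by measurable
    have Sa: "(\<Sum>x\<in>A. (norm (a x))^2) = S" by (simp add: S_def a_def)
    note TE = trig_poly_energy[of A C a, OF A(1) C(2)[OF A], folded T_def, unfolded Sa]
    have iT: "integrable lborel (\<lambda>t. gauss 1 t * (norm (T t))^2)"
    proof -
      have "integrable (density lborel (\<lambda>x. ennreal (gauss 1 x))) (\<lambda>t::'a. (norm (T t))^2)" using TE(1) by (simp add: gmeas_def)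
      then show ?thesis by (subst (asm) integrable_density) (auto simp: less_imp_le[OF gauss_pos])
    qed
    have eT: "(LINT t|lborel. gauss 1 t * (norm (T t))^2) \<le> C * S"
    proof -
      have "(LINT t|gmeas 1. (norm (T t))^2) = (LINT t|lborel. gauss 1 t *\<^sub>R (norm (T t))^2)"
        unfolding gmeas_def by (rule integral_density) (auto simp: less_imp_le[OF gauss_pos])
      then show ?thesis using TE(2) by simp
    qed
    have ix: "integrable lborel (\<lambda>t. F t * cis (2 * pi * (x \<bullet> t)))" for x
      by (rule integrable_mult_bounded[OF iF]) auto
    have eqS: "complex_of_real S = (LINT t|lborel. F t * T t)"
    proof -
      have "complex_of_real S = (\<Sum>x\<in>A. a x * ift F x)"
        unfolding S_def a_def of_real_sum by (intro sum.cong refl) (simp only: complex_norm_square mult.commute)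
      also have "\<dots> = (\<Sum>x\<in>A. LINT t|lborel. a x * (F t * cis (2 * pi * (x \<bullet> t))))"
        by (simp only: trig_def integral_mult_right_zero)
      also have "\<dots> = (LINT t|lborel. (\<Sum>x\<in>A. a x * (F t * cis (2 * pi * (x \<bullet> t)))))"
        by (rule Bochner_Integration.integral_sum[symmetric]) (intro integrable_mult_right ix)
      also have "\<dots> = (LINT t|lborel. F t * T t)"
        by (simp only: T_def sum_distrib_left mult.left_commute)
      finally show ?thesis .
    qed
    have iFT: "integrable lborel (\<lambda>t. F t * T t)"
    proof -
      have "integrable lborel (\<lambda>t. \<Sum>x\<in>A. a x * (F t * cis (2 * pi * (x \<bullet> t))))"
        by (intro Bochner_Integration.integrable_sum integrable_mult_right ix)
      then show ?thesis by (simp only: T_def sum_distrib_left mult.left_commute)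
    qed
    have pt: "norm (F t * T t) \<le> p / 2 * (norm (F t))^2 + G / (2 * p) * (gauss 1 t * (norm (T t))^2)" for t
    proof (cases "norm t \<le> R")
      case True
      define X Y where "X = norm (F t)" and "Y = norm (T t)"
      have "0 \<le> (p * X - Y)^2 / (2 * p)" using p by simp
      also have "\<dots> = p / 2 * X^2 - X * Y + 1 / (2 * p) * Y^2"
        using p by (simp add: power2_diff power2_eq_square field_simps)
      finally have "X * Y \<le> p / 2 * X^2 + 1 / (2 * p) * Y^2" by linarith
      also have "1 / (2 * p) * Y^2 \<le> 1 / (2 * p) * (G * gauss 1 t * Y^2)"
        using mult_right_mono[OF gG[OF True], of "Y^2"] p by (intro mult_left_mono) auto
      finally show ?thesis unfolding X_def Y_def norm_mult by (simp add: mult.assoc)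
    next
      case False
      then show ?thesis using supp[of t] p G less_imp_le[OF gauss_pos[of 1 t]] by simp
    qed
    have "S \<le> norm (complex_of_real S)" by simp
    also have "\<dots> \<le> (LINT t|lborel. p / 2 * (norm (F t))^2 + G / (2 * p) * (gauss 1 t * (norm (T t))^2))"
      unfolding eqS by (rule norm_integral_bound[OF iFT _ pt])
        (intro Bochner_Integration.integrable_add integrable_mult_right sq iT)
    also have "\<dots> = p / 2 * (LINT t|lborel. (norm (F t))^2) + G / (2 * p) * (LINT t|lborel. gauss 1 t * (norm (T t))^2)"
      using sq iT by (simp only: Bochner_Integration.integral_add integrable_mult_right integral_mult_right_zero)
    also have "\<dots> \<le> p / 2 * (LINT t|lborel. (norm (F t))^2) + G / (2 * p) * (C * S)"
      using eT p G by (intro add_left_mono mult_left_mono) auto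
    also have "G / (2 * p) * (C * S) = S / 2" using G C by (simp add: p_def)
    finally show ?thesis by (simp add: S_def)
  qed
  then show ?thesis using p by blast
qed

section \<open>The lower frame bound\<close>

lemma bump_sq_integrable:
  assumes "\<rho> > 0"
  shows "integrable lborel (\<lambda>t. (norm (bump \<rho> (t::'a::euclidean_space)))^2)"
proof -
  define Z where "Z = (LINT s|lborel. tent \<rho> (s::'a))"
  have Z: "Z > 0" unfolding Z_def by (rule tent_integral_pos[OF assms])
  have "integrable lborel (\<lambda>t::'a. 1 / Z * norm (bump \<rho> t))"
    by (intro integrable_mult_right integrable_norm bump_integrable assms)
  then show ?thesis
  proof (rule Bochner_Integration.integrable_bound)
    have "(norm (bump \<rho> t))^2 \<le> norm (1 / Z * norm (bump \<rho> t))" for t :: 'a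
    proof -
      have "norm (bump \<rho> t) \<le> 1 / Z"
        unfolding norm_bump[OF assms] Z_def[symmetric] using Z tent_le_1[OF assms, of t] by (intro divide_right_mono) auto
      then have "norm (bump \<rho> t) * norm (bump \<rho> t) \<le> 1 / Z * norm (bump \<rho> t)" by (rule mult_right_mono) simp
      then show ?thesis using Z by (simp add: power2_eq_square)
    qed
    then show "AE t in lborel. norm ((norm (bump \<rho> (t::'a)))^2) \<le> norm (1 / Z * norm (bump \<rho> t))"
      unfolding real_norm_def abs_power2 by (intro AE_I2)
  qed measurable
qed

lemma norm_bump_ft_minus: "norm (bump_ft \<rho> (- u)) = norm (bump_ft \<rho> u)"
proof -
  have "bump_ft \<rho> (- u) = cnj (bump_ft \<rho> u)"
    unfolding bump_ft_def trig_def Bochner_Integration.integral_cnj[symmetric]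
    by (simp add: cis_cnj bump_def)
  then show ?thesis by simp
qed

text \<open>Up to reflection, the function of \<open>y\<close> is the transform of a modulated bump,
  and modulation does not change the square integral. The bound is therefore uniform in
  \<open>x\<close> and \<sigma>.\<close>

lemma bump_ft_energy:
  fixes x :: "'a::euclidean_space"
  assumes \<rho>: "\<rho> > 0" and s: "\<sigma> > 0"
  shows "integrable (gmeas \<sigma>) (\<lambda>y. (norm (bump_ft \<rho> (x - y)))^2)"
    and "(LINT y|gmeas \<sigma>. (norm (bump_ft \<rho> (x - y)))^2) \<le> (LINT t::'a|lborel. (norm (bump \<rho> t))^2)"
proof -
  define b where "b t = bump \<rho> t * cis (2 * pi * (- x \<bullet> t))" for t
  have eq: "norm (bump_ft \<rho> (x - y)) = norm (ift b y)" for y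
  proof -
    have "ift b y = bump_ft \<rho> (- x + y)"
      using trig_affine(2)[OF spectral_bump[OF \<rho>], of "- x" 1 y] by (simp add: b_def[abs_def] bump_ft_def)
    then show ?thesis using norm_bump_ft_minus[of \<rho> "x - y"] by simp
  qed
  have ib: "integrable lborel b" unfolding b_def by (rule integrable_mult_bounded[OF bump_integrable[OF \<rho>]]) auto
  have nb: "norm (b t) = norm (bump \<rho> t)" for t by (simp add: b_def norm_mult)
  show "integrable (gmeas \<sigma>) (\<lambda>y. (norm (bump_ft \<rho> (x - y)))^2)"
    unfolding eq by (rule integrable_gmeas_ift_sq[OF s ib])
  show "(LINT y|gmeas \<sigma>. (norm (bump_ft \<rho> (x - y)))^2) \<le> (LINT t::'a|lborel. (norm (bump \<rho> t))^2)"
    unfolding eq using ift_energy_le[OF s ib] bump_sq_integrable[OF \<rho>] unfolding nb by blast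
qed

text \<open>The sum over \<open>E\<close> is treated through a finite subset with a uniformly small
  remainder, so that no infinite sum is exchanged with an integral. The type
  \<open>'a \<times> 'a\<close> is that of the parameter space of the localised function, and the
  factor 4 is that of \<open>ift_energy_lower\<close>.\<close>

lemma sampling_lower_bound:
  fixes E \<Lambda> :: "'a::euclidean_space set"
  assumes bal: "balayage_possible E \<Lambda>" and cvx: "convex \<Lambda>" and sym: "\<forall>\<gamma>\<in>\<Lambda>. - \<gamma> \<in> \<Lambda>"
    and \<rho>: "\<rho> > 0" "cball 0 \<rho> \<subseteq> \<Lambda>" and R: "R > 0" "\<Lambda> \<subseteq> cball 0 R"
  shows "\<exists>c>0. \<forall>F. F \<in> borel_measurable borel \<longrightarrow> integrable lborel (\<lambda>t. (norm (F t))^2) \<longrightarrow>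
    (\<forall>t. t \<notin> \<Lambda> \<longrightarrow> F t = 0) \<longrightarrow> (\<lambda>x. (norm (ift F x))^2) summable_on E \<longrightarrow>
    (LINT t|lborel. (norm (F t))^2) \<le> c * (\<Sum>\<^sub>\<infinity>x\<in>E. (norm (ift F x))^2)"
proof -
  obtain \<epsilon> K where \<epsilon>: "\<epsilon> > 0" and K: "K > 0" and bd:
    "\<And>(P::('a \<times> 'a) measure) c g s y. spectral ((\<lambda>\<gamma>. (1 + \<epsilon>) *\<^sub>R \<gamma>) ` \<Lambda>) P c g \<Longrightarrow>
     0 \<le> s \<Longrightarrow> (\<forall>x\<in>E. norm (trig P c g x) \<le> s) \<Longrightarrow> norm (trig P c g y) \<le> K * s"
    using sup_bound_enlarged[OF assms, where 'b="'a \<times> 'a"] by blast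
  \<comment> \<open>The ball of radius \<epsilon> \<rho> lies in \<epsilon> \<Lambda>, and by
    convexity \<Lambda> + \<epsilon> \<Lambda> lies in (1 + \<epsilon>) \<Lambda>.\<close>
  define r where "r = \<epsilon> * \<rho>"
  have r: "r > 0" using \<epsilon> \<rho> by (simp add: r_def)
  define N where "N = (LINT t::'a|lborel. (norm (bump r t))^2)"
  have N: "N \<ge> 0" by (simp add: N_def)
  have sub: "1 *\<^sub>R s + 1 *\<^sub>R t \<in> (\<lambda>\<gamma>. (1 + \<epsilon>) *\<^sub>R \<gamma>) ` \<Lambda>" if s: "s \<in> \<Lambda>" and t: "t \<in> cball 0 r" for s t
  proof -
    define u where "u = (1 / \<epsilon>) *\<^sub>R t"
    have t_eq: "t = \<epsilon> *\<^sub>R u" using \<epsilon> by (simp add: u_def)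
    have "norm u \<le> \<rho>" using t \<epsilon> by (simp add: u_def r_def field_simps)
    then have u: "u \<in> \<Lambda>" using \<rho> by auto
    have "(1 / (1 + \<epsilon>)) *\<^sub>R s + (\<epsilon> / (1 + \<epsilon>)) *\<^sub>R u \<in> \<Lambda>"
      by (intro convexD[OF cvx s u]) (use \<epsilon> in \<open>auto simp: field_simps\<close>)
    moreover have "1 *\<^sub>R s + 1 *\<^sub>R t = (1 + \<epsilon>) *\<^sub>R ((1 / (1 + \<epsilon>)) *\<^sub>R s + (\<epsilon> / (1 + \<epsilon>)) *\<^sub>R u)"
      using \<epsilon> by (simp add: t_eq scaleR_add_right)
    ultimately show ?thesis by blast
  qed
  have "(LINT t|lborel. (norm (F t))^2) \<le> (4 * K^2 * N + 1) * (\<Sum>\<^sub>\<infinity>x\<in>E. (norm (ift F x))^2)"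
    if F: "F \<in> borel_measurable borel" and sq: "integrable lborel (\<lambda>t. (norm (F t))^2)"
      and supp: "\<And>t. t \<notin> \<Lambda> \<Longrightarrow> F t = 0" and sm: "(\<lambda>x. (norm (ift F x))^2) summable_on E" for F
  proof -
    have suppR: "F t = 0" if "norm t > R" for t
      by (rule supp) (use R that in auto)
    have iF: "integrable lborel F" by (rule integrable_sq_norm_supp[OF F sq suppR])
    have spF: "spectral \<Lambda> lborel F (\<lambda>t. t)"
      using iF supp by (auto simp: spectral_def lborel.sigma_finite_measure_axioms)
    define I where "I = (\<Sum>\<^sub>\<infinity>x\<in>E. (norm (ift F x))^2)"
    have I0: "I \<ge> 0" unfolding I_def by (rule infsum_nonneg) simp
    \<comment> \<open>At a point of \<open>A\<close> the localised square is one term of the sum; at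
      any other point of \<open>E\<close> it is at most \<eta>, as the cutoff is bounded by 1. At
      \<open>y\<close> the cutoff equals 1.\<close>
    have pw: "(norm (ift F y))^2 \<le> K^2 * ((\<Sum>x\<in>A. (norm (ift F x))^2 * (norm (bump_ft r (x - y)))^2) + \<eta>)"
      if A: "finite A" "A \<subseteq> E" and \<eta>: "\<eta> \<ge> 0" "\<And>x. x \<in> E - A \<Longrightarrow> (norm (ift F x))^2 \<le> \<eta>" for A \<eta> y
    proof -
      have "\<exists>c' g'. spectral ((\<lambda>\<gamma>. (1 + \<epsilon>) *\<^sub>R \<gamma>) ` \<Lambda>) (lborel \<Otimes>\<^sub>M lborel :: ('a \<times> 'a) measure) c' g' \<and>
          (\<forall>x. trig (lborel \<Otimes>\<^sub>M lborel :: ('a \<times> 'a) measure) c' g' x = ift F (0 + 1 *\<^sub>R x) * ift (bump r) (- y + 1 *\<^sub>R x))"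
        using trig_mult[where r=1 and q=1 and a=0 and b="- y" and U="(\<lambda>\<gamma>. (1 + \<epsilon>) *\<^sub>R \<gamma>) ` \<Lambda>",
          OF spF spectral_bump[OF r]] sub by blast
      then obtain c' g' where sp: "spectral ((\<lambda>\<gamma>. (1 + \<epsilon>) *\<^sub>R \<gamma>) ` \<Lambda>) (lborel \<Otimes>\<^sub>M lborel :: ('a \<times> 'a) measure) c' g'"
        and tr: "\<And>x. trig (lborel \<Otimes>\<^sub>M lborel :: ('a \<times> 'a) measure) c' g' x = ift F (0 + 1 *\<^sub>R x) * bump_ft r (- y + 1 *\<^sub>R x)"
        unfolding bump_ft_def by blast
      define S where "S = (\<Sum>x\<in>A. (norm (ift F x))^2 * (norm (bump_ft r (x - y)))^2) + \<eta>"
      have sum0: "(\<Sum>x\<in>A. (norm (ift F x))^2 * (norm (bump_ft r (x - y)))^2) \<ge> 0" by (intro sum_nonneg) simp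
      then have S0: "S \<ge> 0" using \<eta> by (simp add: S_def)
      have "norm (trig (lborel \<Otimes>\<^sub>M lborel :: ('a \<times> 'a) measure) c' g' x) \<le> sqrt S" if x: "x \<in> E" for x
      proof (rule real_le_rsqrt)
        have e: "(norm (trig (lborel \<Otimes>\<^sub>M lborel :: ('a \<times> 'a) measure) c' g' x))^2 = (norm (ift F x))^2 * (norm (bump_ft r (x - y)))^2"
          unfolding tr by (simp add: norm_mult power_mult_distrib)
        show "(norm (trig (lborel \<Otimes>\<^sub>M lborel :: ('a \<times> 'a) measure) c' g' x))^2 \<le> S"
        proof (cases "x \<in> A")
          case True
          have "(norm (ift F x))^2 * (norm (bump_ft r (x - y)))^2 \<le> (\<Sum>x\<in>A. (norm (ift F x))^2 * (norm (bump_ft r (x - y)))^2)"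
            by (rule member_le_sum[OF True _ A(1)]) simp
          then show ?thesis unfolding e S_def using \<eta>(1) by linarith
        next
          case False
          have "(norm (bump_ft r (x - y)))^2 \<le> 1" using norm_bump_ft_le_1[OF r, of "x - y"] by (simp add: power_le_one)
          then have "(norm (ift F x))^2 * (norm (bump_ft r (x - y)))^2 \<le> (norm (ift F x))^2 * 1"
            by (rule mult_left_mono) simp
          also have "\<dots> \<le> \<eta>" using \<eta>(2)[of x] False x by simp
          finally show ?thesis unfolding e S_def using sum0 by linarith
        qed
      qed
      then have "norm (trig (lborel \<Otimes>\<^sub>M lborel :: ('a \<times> 'a) measure) c' g' y) \<le> K * sqrt S"
        by (intro bd[OF sp]) (use S0 in auto)
      then have "norm (ift F y) \<le> K * sqrt S" unfolding tr by (simp add: bump_ft_0[OF r])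
      then have "(norm (ift F y))^2 \<le> (K * sqrt S)^2" by (rule power_mono) simp
      then show ?thesis using S0 by (simp add: power_mult_distrib S_def)
    qed
    have Q: "(LINT y|gmeas \<sigma>. (norm (ift F y))^2) \<le> K^2 * N * I" if s: "\<sigma> > 0" for \<sigma>
    proof (rule field_le_epsilon)
      fix e :: real assume e: "e > 0"
      interpret finite_measure "gmeas \<sigma> :: 'a measure" using cmeasure_gmeas[OF s] unfolding cmeasure_def by blast
      define m where "m = measure (gmeas \<sigma>) (space (gmeas \<sigma> :: 'a measure))"
      have m: "m \<ge> 0" by (simp add: m_def)
      \<comment> \<open>Chosen after the total mass \<open>m\<close>, since the remainder is
        integrated against the whole Gaussian measure.\<close>
      define \<eta> where "\<eta> = e / (K^2 * (m + 1))"
      have \<eta>: "\<eta> > 0" using e K m by (simp add: \<eta>_def)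
      have \<eta>e: "K^2 * (\<eta> * m) \<le> e"
      proof -
        have "K^2 * (\<eta> * m) \<le> K^2 * (\<eta> * (m + 1))" using \<eta> by (intro mult_left_mono) auto
        also have "\<dots> = e" using K m by (simp add: \<eta>_def)
        finally show ?thesis .
      qed
      obtain A where A: "finite A" "A \<subseteq> E" "dist (\<Sum>x\<in>A. (norm (ift F x))^2) I \<le> \<eta>"
        using infsum_finite_approximation[OF sm \<eta>] unfolding I_def by blast
      have AI: "(\<Sum>x\<in>A. (norm (ift F x))^2) \<le> I"
        unfolding I_def by (rule finite_sum_le_infsum[OF sm A(1,2)]) simp
      \<comment> \<open>Adding one more point cannot push the sum beyond \<open>I\<close>, and
        \<open>A\<close> alone already comes within \<eta> of it.\<close>
      have tail: "(norm (ift F x))^2 \<le> \<eta>" if x: "x \<in> E - A" for x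
      proof -
        have "(\<Sum>x\<in>insert x A. (norm (ift F x))^2) \<le> I"
          unfolding I_def by (rule finite_sum_le_infsum[OF sm]) (use A x in auto)
        then show ?thesis using A(1,3) AI x by (simp add: dist_real_def)
      qed
      have ib: "integrable (gmeas \<sigma>) (\<lambda>y. (norm (bump_ft r (x - y)))^2)" for x :: 'a by (rule bump_ft_energy(1)[OF r s])
      have isum: "integrable (gmeas \<sigma>) (\<lambda>y. \<Sum>x\<in>A. (norm (ift F x))^2 * (norm (bump_ft r (x - y)))^2)"
        by (intro Bochner_Integration.integrable_sum integrable_mult_right ib)
      have ic: "integrable (gmeas \<sigma>) (\<lambda>y::'a. \<eta>)" by (rule integrable_const)
      have "(LINT y|gmeas \<sigma>. (norm (ift F y))^2) \<le> (LINT y|gmeas \<sigma>. K^2 * ((\<Sum>x\<in>A. (norm (ift F x))^2 * (norm (bump_ft r (x - y)))^2) + \<eta>))"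
        by (intro integral_mono integrable_gmeas_ift_sq[OF s iF] integrable_mult_right Bochner_Integration.integrable_add isum ic
              pw A(1,2) less_imp_le[OF \<eta>] tail)
      also have "\<dots> = K^2 * ((\<Sum>x\<in>A. (norm (ift F x))^2 * (LINT y|gmeas \<sigma>. (norm (bump_ft r (x - y)))^2)) + m * \<eta>)"
        unfolding integral_mult_right_zero Bochner_Integration.integral_add[OF isum ic]
        using ib by (simp add: Bochner_Integration.integral_sum m_def)
      also have "\<dots> \<le> K^2 * ((\<Sum>x\<in>A. (norm (ift F x))^2 * N) + m * \<eta>)"
        unfolding N_def by (intro mult_left_mono add_right_mono sum_mono bump_ft_energy(2)[OF r s]) auto
      also have "\<dots> \<le> K^2 * (I * N + m * \<eta>)"
        unfolding sum_distrib_right[symmetric] by (intro mult_left_mono add_right_mono mult_right_mono AI N) simp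
      also have "\<dots> = K^2 * N * I + K^2 * (\<eta> * m)" by (simp add: distrib_left mult.commute mult.left_commute)
      also have "\<dots> \<le> K^2 * N * I + e" using \<eta>e by simp
      finally show "(LINT y|gmeas \<sigma>. (norm (ift F y))^2) \<le> K^2 * N * I + e" .
    qed
    have "(LINT t|lborel. (norm (F t))^2) \<le> 4 * (K^2 * N * I)"
      by (rule ift_energy_lower[OF F sq suppR Q])
    \<comment> \<open>The added 1 makes the constant positive, given only that \<open>N\<close> is
      nonnegative.\<close>
    also have "\<dots> \<le> (4 * K^2 * N + 1) * I" using I0 by (simp add: distrib_right)
    finally show ?thesis unfolding I_def .
  qed
  moreover have "4 * K^2 * N + 1 > 0" using N by (simp add: add_nonneg_pos)
  ultimately show ?thesis by blast
qed

section \<open>The weighted inequality\<close>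

text \<open>The arguments on product spaces are carried out for Borel functions. The replacement is
  reset to 0 off the closed set, so that the support condition holds everywhere and not just almost
  everywhere.\<close>

lemma borel_version:
  fixes F :: "'a::euclidean_space \<Rightarrow> complex"
  assumes F: "F \<in> borel_measurable lebesgue" and L: "closed \<Lambda>" and supp: "\<And>t. t \<notin> \<Lambda> \<Longrightarrow> F t = 0"
  shows "\<exists>F'. F' \<in> borel_measurable borel \<and> (\<forall>t. t \<notin> \<Lambda> \<longrightarrow> F' t = 0) \<and> (AE t in lebesgue. F t = F' t)"
proof -
  have "(\<lambda>t. Re (F t)) \<in> borel_measurable lebesgue" "(\<lambda>t. Im (F t)) \<in> borel_measurable lebesgue" using F by auto
  from this[THEN completion_ex_borel_measurable_real]
  obtain g h where g: "g \<in> borel_measurable lborel" "AE t in lborel. Re (F t) = g t"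
    and h: "h \<in> borel_measurable lborel" "AE t in lborel. Im (F t) = h t"
    by blast
  have [measurable]: "g \<in> borel_measurable borel" "h \<in> borel_measurable borel" "\<Lambda> \<in> sets borel"
    using g h L by auto
  define F' where "F' t = (if t \<in> \<Lambda> then complex_of_real (g t) + \<i> * complex_of_real (h t) else 0)" for t
  have "F' \<in> borel_measurable borel" unfolding F'_def by measurable
  moreover have "AE t in lborel. F t = F' t"
    using g(2) h(2)
  proof eventually_elim
    case (elim t)
    then show ?case using supp[of t] by (simp add: F'_def complex_eq_iff)
  qed
  ultimately show ?thesis
    by (intro exI[of _ F'] conjI AE_completion) (simp_all add: F'_def)
qed

lemma L2_on_set_integral:
  assumes "L2_on \<Lambda> F"
  shows "(LINT \<gamma>:\<Lambda>|lebesgue. (norm (F \<gamma>))^2) = (LINT \<gamma>|lebesgue. (norm (F \<gamma>))^2)"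
  unfolding set_lebesgue_integral_def
  by (intro Bochner_Integration.integral_cong refl) (use assms in \<open>auto simp: L2_on_def indicator_def\<close>)

lemma L2_on_borel:
  fixes F :: "'a::euclidean_space \<Rightarrow> complex"
  assumes F: "L2_on \<Lambda> F" and L: "closed \<Lambda>"
  shows "\<exists>F'. F' \<in> borel_measurable borel \<and> integrable lborel (\<lambda>t. (norm (F' t))^2) \<and> (\<forall>t. t \<notin> \<Lambda> \<longrightarrow> F' t = 0) \<and>
    ifourier F = ift F' \<and> (LINT \<gamma>:\<Lambda>|lebesgue. (norm (F \<gamma>))^2) = (LINT t|lborel. (norm (F' t))^2)"
proof -
  have Fm: "F \<in> borel_measurable lebesgue" and sq: "integrable lebesgue (\<lambda>t. (norm (F t))^2)"
    and supp: "\<And>t. t \<notin> \<Lambda> \<Longrightarrow> F t = 0"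
    using F by (auto simp: L2_on_def)
  obtain F' where F': "F' \<in> borel_measurable borel" "\<And>t. t \<notin> \<Lambda> \<Longrightarrow> F' t = 0" "AE t in lebesgue. F t = F' t"
    using borel_version[OF Fm L supp] by blast
  have F'l: "F' \<in> borel_measurable lborel" using F'(1) by simp
  have F'c: "F' \<in> borel_measurable lebesgue" by (rule measurable_completion[OF F'l])
  have sq'm: "(\<lambda>t. (norm (F' t))^2) \<in> borel_measurable lborel" using F'(1) by measurable
  have "integrable lebesgue (\<lambda>t. (norm (F' t))^2)"
    using sq
  proof (rule integrable_cong_AE_imp)
    show "(\<lambda>t. (norm (F' t))^2) \<in> borel_measurable lebesgue" by (rule measurable_completion[OF sq'm])
    show "AE t in lebesgue. (norm (F t))^2 = (norm (F' t))^2" using F'(3) by eventually_elim simp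
  qed
  then have i: "integrable lborel (\<lambda>t. (norm (F' t))^2)" by (simp only: integrable_completion[OF sq'm])
  have "ifourier F x = ift F' x" for x
  proof -
    have m: "(\<lambda>t. F' t * cis (2 * pi * (x \<bullet> t))) \<in> borel_measurable lborel" using F'(1) by measurable
    have c: "(\<lambda>t. cis (2 * pi * (x \<bullet> t))) \<in> borel_measurable lebesgue" by (rule measurable_completion) measurable
    have "ifourier F x = (LINT t|lebesgue. F' t * cis (2 * pi * (x \<bullet> t)))"
      unfolding ifourier_def
    proof (rule integral_cong_AE)
      show "(\<lambda>t. F t * cis (2 * pi * (x \<bullet> t))) \<in> borel_measurable lebesgue" using Fm c by (rule borel_measurable_times)
      show "(\<lambda>t. F' t * cis (2 * pi * (x \<bullet> t))) \<in> borel_measurable lebesgue" by (rule measurable_completion[OF m])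
      show "AE t in lebesgue. F t * cis (2 * pi * (x \<bullet> t)) = F' t * cis (2 * pi * (x \<bullet> t))"
        using F'(3) by eventually_elim simp
    qed
    also have "\<dots> = ift F' x" unfolding trig_def by (rule integral_completion[OF m])
    finally show ?thesis .
  qed
  moreover have "(LINT \<gamma>:\<Lambda>|lebesgue. (norm (F \<gamma>))^2) = (LINT t|lborel. (norm (F' t))^2)"
  proof -
    have "(LINT \<gamma>|lebesgue. (norm (F \<gamma>))^2) = (LINT t|lebesgue. (norm (F' t))^2)"
    proof (rule integral_cong_AE)
      show "(\<lambda>t. (norm (F' t))^2) \<in> borel_measurable lebesgue" by (rule measurable_completion[OF sq'm])
      show "AE t in lebesgue. (norm (F t))^2 = (norm (F' t))^2" using F'(3) by eventually_elim simp
    qed (use sq in auto)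
    then show ?thesis unfolding L2_on_set_integral[OF F] integral_completion[OF sq'm] .
  qed
  ultimately show ?thesis using F' i by blast
qed

text \<open>\<open>C\<close> may be any essential bound: the lemma serves both for the one given by
  boundedness and for \<open>Linf_norm G\<close>.\<close>

lemma L2_on_mult_bounded:
  fixes G :: "'a::euclidean_space \<Rightarrow> real"
  assumes F: "L2_on \<Lambda> F" and G: "G \<in> borel_measurable lebesgue" and C: "AE \<gamma> in lebesgue. \<bar>G \<gamma>\<bar> \<le> C"
  shows "L2_on \<Lambda> (\<lambda>\<gamma>. F \<gamma> * complex_of_real (G \<gamma>))"
    and "(LINT \<gamma>:\<Lambda>|lebesgue. (norm (F \<gamma> * complex_of_real (G \<gamma>)))^2) \<le> C^2 * (LINT \<gamma>:\<Lambda>|lebesgue. (norm (F \<gamma>))^2)"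
proof -
  have Fm: "F \<in> borel_measurable lebesgue" and sq: "integrable lebesgue (\<lambda>t. (norm (F t))^2)"
    using F by (auto simp: L2_on_def)
  have m: "(\<lambda>\<gamma>. F \<gamma> * complex_of_real (G \<gamma>)) \<in> borel_measurable lebesgue" using Fm G by measurable
  have le: "AE \<gamma> in lebesgue. (norm (F \<gamma> * complex_of_real (G \<gamma>)))^2 \<le> C^2 * (norm (F \<gamma>))^2"
    using C
  proof eventually_elim
    case (elim \<gamma>)
    have "(norm (F \<gamma> * complex_of_real (G \<gamma>)))^2 = \<bar>G \<gamma>\<bar>^2 * (norm (F \<gamma>))^2"
      by (simp add: norm_mult power_mult_distrib mult.commute)
    also have "\<dots> \<le> C^2 * (norm (F \<gamma>))^2" by (intro mult_right_mono power_mono elim) auto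
    finally show ?case .
  qed
  have iC: "integrable lebesgue (\<lambda>\<gamma>. C^2 * (norm (F \<gamma>))^2)" using sq by simp
  have i: "integrable lebesgue (\<lambda>\<gamma>. (norm (F \<gamma> * complex_of_real (G \<gamma>)))^2)"
    using iC
  proof (rule Bochner_Integration.integrable_bound)
    show "AE \<gamma> in lebesgue. norm ((norm (F \<gamma> * complex_of_real (G \<gamma>)))^2) \<le> norm (C^2 * (norm (F \<gamma>))^2)"
      using le by eventually_elim simp
  qed (use m in measurable)
  show L: "L2_on \<Lambda> (\<lambda>\<gamma>. F \<gamma> * complex_of_real (G \<gamma>))"
    using F i m unfolding L2_on_def by simp
  show "(LINT \<gamma>:\<Lambda>|lebesgue. (norm (F \<gamma> * complex_of_real (G \<gamma>)))^2) \<le> C^2 * (LINT \<gamma>:\<Lambda>|lebesgue. (norm (F \<gamma>))^2)"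
    unfolding L2_on_set_integral[OF L] L2_on_set_integral[OF F] using integral_mono_AE[OF i iC le] by simp
qed

text \<open>The variance of \<open>G\<close> under the weight |F|^2, taken about its mean m / P, is
  nonnegative; expanding it gives the inequality.\<close>

lemma weighted_Cauchy_Schwarz:
  fixes G :: "'a::euclidean_space \<Rightarrow> real"
  assumes F: "L2_on \<Lambda> F" and G: "G \<in> borel_measurable lebesgue" and C: "AE \<gamma> in lebesgue. \<bar>G \<gamma>\<bar> \<le> C"
    and P: "(LINT \<gamma>:\<Lambda>|lebesgue. (norm (F \<gamma>))^2) > 0"
  shows "(LINT \<gamma>:\<Lambda>|lebesgue. (norm (F \<gamma>))^2 * G \<gamma>)^2 / (LINT \<gamma>:\<Lambda>|lebesgue. (norm (F \<gamma>))^2)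
    \<le> (LINT \<gamma>:\<Lambda>|lebesgue. (norm (F \<gamma> * complex_of_real (G \<gamma>)))^2)"
proof -
  note L = L2_on_mult_bounded(1)[OF F G C]
  define P where "P = (LINT \<gamma>|lebesgue. (norm (F \<gamma>))^2)"
  have P0: "P > 0" using P unfolding L2_on_set_integral[OF F] P_def .
  define m where "m = (LINT \<gamma>|lebesgue. (norm (F \<gamma>))^2 * G \<gamma>)"
  have Fm: "F \<in> borel_measurable lebesgue" and i0: "integrable lebesgue (\<lambda>t. (norm (F t))^2)"
    using F by (auto simp: L2_on_def)
  have i2: "integrable lebesgue (\<lambda>t. (norm (F t * complex_of_real (G t)))^2)" using L by (simp add: L2_on_def)
  have iC: "integrable lebesgue (\<lambda>\<gamma>. C * (norm (F \<gamma>))^2)" using i0 by simp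
  have i1: "integrable lebesgue (\<lambda>t. (norm (F t))^2 * G t)"
    using iC
  proof (rule Bochner_Integration.integrable_bound)
    show "AE t in lebesgue. norm ((norm (F t))^2 * G t) \<le> norm (C * (norm (F t))^2)"
      using C
    proof eventually_elim
      case (elim t)
      have "norm ((norm (F t))^2 * G t) = \<bar>G t\<bar> * (norm (F t))^2" by (simp add: abs_mult)
      also have "\<dots> \<le> \<bar>C\<bar> * (norm (F t))^2" using elim by (intro mult_right_mono) auto
      finally show ?case by (simp add: abs_mult)
    qed
  qed (use Fm G in measurable)
  have mset: "(LINT \<gamma>:\<Lambda>|lebesgue. (norm (F \<gamma>))^2 * G \<gamma>) = m"
    unfolding set_lebesgue_integral_def m_def
    by (intro Bochner_Integration.integral_cong refl) (use F in \<open>auto simp: L2_on_def indicator_def\<close>)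
  define a where "a = m / P"
  have eq: "(norm (F t))^2 * (G t - a)^2 = (norm (F t * complex_of_real (G t)))^2 - 2 * a * ((norm (F t))^2 * G t) + a^2 * (norm (F t))^2" for t
    by (simp add: norm_mult power_mult_distrib power2_diff distrib_left right_diff_distrib)
  have "0 \<le> (LINT t|lebesgue. (norm (F t))^2 * (G t - a)^2)" by (intro Bochner_Integration.integral_nonneg) simp
  also have "\<dots> = (LINT t|lebesgue. (norm (F t * complex_of_real (G t)))^2) - 2 * a * m + a^2 * P"
    unfolding eq m_def P_def using i0 i1 i2 by simp
  also have "2 * a * m = 2 * (m^2 / P)" by (simp add: a_def power2_eq_square)
  also have "a^2 * P = m^2 / P" using P0 by (simp add: a_def power2_eq_square)
  finally have "m^2 / P \<le> (LINT t|lebesgue. (norm (F t * complex_of_real (G t)))^2)" by linarith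
  then show ?thesis unfolding mset L2_on_set_integral[OF F] L2_on_set_integral[OF L] P_def .
qed

lemma L2_on_integral_pos:
  assumes F: "L2_on \<Lambda> F" and ne: "\<not> (AE \<gamma> in lebesgue. F \<gamma> = 0)"
  shows "(LINT \<gamma>:\<Lambda>|lebesgue. (norm (F \<gamma>))^2) > 0"
proof -
  have sq: "integrable lebesgue (\<lambda>t. (norm (F t))^2)" using F by (auto simp: L2_on_def)
  have "(LINT t|lebesgue. (norm (F t))^2) \<noteq> 0"
    using integral_nonneg_eq_0_iff_AE[OF sq] ne by simp
  moreover have "(LINT t|lebesgue. (norm (F t))^2) \<ge> 0" by (intro Bochner_Integration.integral_nonneg) simp
  ultimately show ?thesis unfolding L2_on_set_integral[OF F] by linarith
qed

text \<open>\<open>real_of_ereal\<close> sends \<infinity> to 0, so the essential supremum has to be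
  known not to be \<infinity>; the bound \<open>C\<close> provides this.\<close>

lemma AE_le_Linf_norm:
  assumes G: "G \<in> borel_measurable lebesgue" and C: "AE \<gamma> in lebesgue. \<bar>G \<gamma>\<bar> \<le> C"
  shows "AE \<gamma> in lebesgue. \<bar>G \<gamma>\<bar> \<le> Linf_norm G"
proof -
  let ?s = "esssup lebesgue (\<lambda>\<gamma>. ereal \<bar>G \<gamma>\<bar>)"
  have "?s \<le> ereal C" using G C by (intro esssup_I) auto
  moreover have "AE \<gamma> in lebesgue. ereal \<bar>G \<gamma>\<bar> \<le> ?s" by (rule esssup_AE)
  ultimately show ?thesis unfolding Linf_norm_def
    by (cases ?s) auto
qed

text \<open>The uniform bound over finite subsets yields summability first; without it the infinite
  sum could be the default value 0.\<close>

lemma infsum_sampling_le: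
  fixes E \<Lambda> :: "'a::euclidean_space set"
  assumes "separated E" "compact \<Lambda>"
  shows "\<exists>B>0. \<forall>F. L2_on \<Lambda> F \<longrightarrow> (\<lambda>x. (norm (ifourier F x))^2) summable_on E \<and>
    (\<Sum>\<^sub>\<infinity>x\<in>E. (norm (ifourier F x))^2) \<le> B * (LINT \<gamma>:\<Lambda>|lebesgue. (norm (F \<gamma>))^2)"
proof -
  obtain R where R: "\<And>t. t \<in> \<Lambda> \<Longrightarrow> norm t \<le> R"
    using compact_imp_bounded[OF assms(2)] unfolding bounded_iff by blast
  obtain B where B: "B > 0" "\<And>F A. F \<in> borel_measurable borel \<Longrightarrow> integrable lborel (\<lambda>t. (norm (F t))^2) \<Longrightarrow>
    (\<forall>t. norm t > R \<longrightarrow> F t = 0) \<Longrightarrow> finite A \<Longrightarrow> A \<subseteq> E \<Longrightarrow>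
    (\<Sum>x\<in>A. (norm (ift F x))^2) \<le> B * (LINT t|lborel. (norm (F t))^2)"
    using plancherel_polya[OF assms(1), of R] by blast
  have "(\<lambda>x. (norm (ifourier F x))^2) summable_on E \<and>
    (\<Sum>\<^sub>\<infinity>x\<in>E. (norm (ifourier F x))^2) \<le> B * (LINT \<gamma>:\<Lambda>|lebesgue. (norm (F \<gamma>))^2)" if F: "L2_on \<Lambda> F" for F
  proof -
    obtain F' where F': "F' \<in> borel_measurable borel" "integrable lborel (\<lambda>t. (norm (F' t))^2)" "\<forall>t. t \<notin> \<Lambda> \<longrightarrow> F' t = 0"
      "ifourier F = ift F'" "(LINT \<gamma>:\<Lambda>|lebesgue. (norm (F \<gamma>))^2) = (LINT t|lborel. (norm (F' t))^2)"
      using L2_on_borel[OF F compact_imp_closed[OF assms(2)]] by blast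
    have z: "\<forall>t. norm t > R \<longrightarrow> F' t = 0" using F'(3) R by (meson not_le)
    have fin: "(\<Sum>x\<in>A. (norm (ifourier F x))^2) \<le> B * (LINT \<gamma>:\<Lambda>|lebesgue. (norm (F \<gamma>))^2)" if "finite A" "A \<subseteq> E" for A
      unfolding F'(4,5) by (rule B(2)[OF F'(1,2) z that])
    have sm: "(\<lambda>x. (norm (ifourier F x))^2) summable_on E"
    proof (rule nonneg_bdd_above_summable_on)
      show "bdd_above (sum (\<lambda>x. (norm (ifourier F x))^2) ` {F. F \<subseteq> E \<and> finite F})"
        by (rule bdd_aboveI2[where M="B * (LINT \<gamma>:\<Lambda>|lebesgue. (norm (F \<gamma>))^2)"]) (use fin in blast)
    qed simp
    show ?thesis by (intro conjI sm infsum_le_finite_sums[OF sm fin])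
  qed
  then show ?thesis using B(1) by blast
qed

lemma sampling_lower_bound_L2_on:
  fixes E \<Lambda> :: "'a::euclidean_space set"
  assumes sep: "separated E" and cpt: "compact \<Lambda>" and cvx: "convex \<Lambda>" and sym: "\<forall>\<gamma>\<in>\<Lambda>. - \<gamma> \<in> \<Lambda>"
    and bal: "balayage_possible E \<Lambda>"
  shows "\<exists>c>0. \<forall>F. L2_on \<Lambda> F \<longrightarrow>
    (LINT \<gamma>:\<Lambda>|lebesgue. (norm (F \<gamma>))^2) \<le> c * (\<Sum>\<^sub>\<infinity>x\<in>E. (norm (ifourier F x))^2)"
proof (cases "interior \<Lambda> = {}")
  case True
  have cl: "closed \<Lambda>" using cpt by (rule compact_imp_closed)
  \<comment> \<open>A closed set without interior is its own frontier, and the frontier of a convex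
    set is a null set.\<close>
  have "frontier \<Lambda> = \<Lambda>" using True cl by (simp add: frontier_def)
  then have "negligible \<Lambda>" using negligible_convex_frontier[OF cvx] by simp
  then have "AE t in lebesgue. t \<notin> \<Lambda>" by (intro AE_not_in) (simp add: negligible_iff_null_sets)
  have "(LINT \<gamma>:\<Lambda>|lebesgue. (norm (F \<gamma>))^2) \<le> 1 * (\<Sum>\<^sub>\<infinity>x\<in>E. (norm (ifourier F x))^2)" if F: "L2_on \<Lambda> F" for F
  proof -
    have "AE t in lebesgue. (norm (F t))^2 = 0"
      using \<open>AE t in lebesgue. t \<notin> \<Lambda>\<close> by eventually_elim (use F in \<open>simp add: L2_on_def\<close>)
    then have "(LINT \<gamma>|lebesgue. (norm (F \<gamma>))^2) = 0" by (rule integral_eq_zero_AE)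
    moreover have "(\<Sum>\<^sub>\<infinity>x\<in>E. (norm (ifourier F x))^2) \<ge> 0" by (rule infsum_nonneg) simp
    ultimately show ?thesis unfolding L2_on_set_integral[OF F] by simp
  qed
  then show ?thesis using zero_less_one by blast
next
  case False
  then obtain x r where r: "r > 0" "ball x r \<subseteq> \<Lambda>" unfolding mem_interior ex_in_conv[symmetric] by blast
  have ball0: "t \<in> \<Lambda>" if t: "norm t < r" for t
  proof -
    have 1: "x + t \<in> \<Lambda>" "x - t \<in> \<Lambda>" using r t by (auto simp: dist_norm)
    then have "- (x - t) \<in> \<Lambda>" using sym by blast
    \<comment> \<open>The point \<open>t\<close> is the midpoint of x + t and the reflection of x -
      t, which carries the ball around \<open>x\<close> to one around the origin.\<close>
    then have "(1/2) *\<^sub>R (x + t) + (1/2) *\<^sub>R (- (x - t)) \<in> \<Lambda>" using 1 by (intro convexD[OF cvx]) auto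
    moreover have "(1/2) *\<^sub>R (x + t) + (1/2) *\<^sub>R (- (x - t)) = t"
      by (simp add: scaleR_add_right[symmetric])
    ultimately show ?thesis by simp
  qed
  have \<rho>: "r / 2 > 0" "cball 0 (r / 2) \<subseteq> \<Lambda>" using r ball0 by auto
  obtain R where R: "R > 0" "\<Lambda> \<subseteq> cball 0 R"
    using compact_imp_bounded[OF cpt] unfolding bounded_pos by (auto simp: subset_iff)
  obtain c where c: "c > 0" "\<And>F. F \<in> borel_measurable borel \<Longrightarrow> integrable lborel (\<lambda>t. (norm (F t))^2) \<Longrightarrow>
    (\<forall>t. t \<notin> \<Lambda> \<longrightarrow> F t = 0) \<Longrightarrow> (\<lambda>x. (norm (ift F x))^2) summable_on E \<Longrightarrow>
    (LINT t|lborel. (norm (F t))^2) \<le> c * (\<Sum>\<^sub>\<infinity>x\<in>E. (norm (ift F x))^2)"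
    using sampling_lower_bound[OF bal cvx sym \<rho> R] by blast
  have sm: "\<And>F. L2_on \<Lambda> F \<Longrightarrow> (\<lambda>x. (norm (ifourier F x))^2) summable_on E"
    using infsum_sampling_le[OF sep cpt] by blast
  have "(LINT \<gamma>:\<Lambda>|lebesgue. (norm (F \<gamma>))^2) \<le> c * (\<Sum>\<^sub>\<infinity>x\<in>E. (norm (ifourier F x))^2)" if F: "L2_on \<Lambda> F" for F
  proof -
    obtain F' where F': "F' \<in> borel_measurable borel" "integrable lborel (\<lambda>t. (norm (F' t))^2)" "\<forall>t. t \<notin> \<Lambda> \<longrightarrow> F' t = 0"
      "ifourier F = ift F'" "(LINT \<gamma>:\<Lambda>|lebesgue. (norm (F \<gamma>))^2) = (LINT t|lborel. (norm (F' t))^2)"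
      using L2_on_borel[OF F compact_imp_closed[OF cpt]] by blast
    show ?thesis using c(2)[OF F'(1-3)] sm[OF F] unfolding F'(4,5) by blast
  qed
  then show ?thesis using c(1) by blast
qed

theorem theorem4p4:
  fixes E \<Lambda> :: "'a::euclidean_space set" and G :: "'a \<Rightarrow> real"
  assumes sep: "separated E"
    and S: "S_set \<Lambda>" and mult: "strict_multiplicity \<Lambda>"
    and cpt: "compact \<Lambda>" and cvx: "convex \<Lambda>" and sym: "\<forall>\<gamma>\<in>\<Lambda>. - \<gamma> \<in> \<Lambda>"
    and Gmeas: "G \<in> borel_measurable lebesgue"
    and Gbdd: "\<exists>C. AE \<gamma> in lebesgue. \<bar>G \<gamma>\<bar> \<le> C"
    and Gnn: "AE \<gamma> in lebesgue. 0 \<le> G \<gamma>"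
    and bal: "balayage_possible E \<Lambda>"
  shows "(\<exists>A>0. \<exists>B>0. \<forall>F. L2_on \<Lambda> F \<and> \<not> (AE \<gamma> in lebesgue. F \<gamma> = 0) \<longrightarrow>
            (\<lambda>x. (norm (ifourier (\<lambda>\<gamma>. F \<gamma> * complex_of_real (G \<gamma>)) x))\<^sup>2) summable_on E \<and>
            A * (LINT \<gamma>:\<Lambda>|lebesgue. (norm (F \<gamma>))\<^sup>2 * G \<gamma>)\<^sup>2
                / (LINT \<gamma>:\<Lambda>|lebesgue. (norm (F \<gamma>))\<^sup>2)
              \<le> (\<Sum>\<^sub>\<infinity>x\<in>E. (norm (ifourier (\<lambda>\<gamma>. F \<gamma> * complex_of_real (G \<gamma>)) x))\<^sup>2) \<and>
            (\<Sum>\<^sub>\<infinity>x\<in>E. (norm (ifourier (\<lambda>\<gamma>. F \<gamma> * complex_of_real (G \<gamma>)) x))\<^sup>2)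
              \<le> B * (LINT \<gamma>:\<Lambda>|lebesgue. (norm (F \<gamma>))\<^sup>2))
         \<and> (\<forall>B1. (\<forall>F. L2_on \<Lambda> F \<longrightarrow>
                      (\<lambda>x. (norm (ifourier F x))\<^sup>2) summable_on E \<and>
                      (\<Sum>\<^sub>\<infinity>x\<in>E. (norm (ifourier F x))\<^sup>2)
                        \<le> B1 * (LINT \<gamma>:\<Lambda>|lebesgue. (norm (F \<gamma>))\<^sup>2))
                \<longrightarrow> (\<forall>F. L2_on \<Lambda> F \<and> \<not> (AE \<gamma> in lebesgue. F \<gamma> = 0) \<longrightarrow>
                      (\<Sum>\<^sub>\<infinity>x\<in>E. (norm (ifourier (\<lambda>\<gamma>. F \<gamma> * complex_of_real (G \<gamma>)) x))\<^sup>2)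
                        \<le> B1 * (Linf_norm G)\<^sup>2 * (LINT \<gamma>:\<Lambda>|lebesgue. (norm (F \<gamma>))\<^sup>2)))"
proof (intro conjI allI impI)
  obtain C where C: "AE \<gamma> in lebesgue. \<bar>G \<gamma>\<bar> \<le> C" using Gbdd by blast
  let ?H = "\<lambda>F \<gamma>. F \<gamma> * complex_of_real (G \<gamma>)"
  let ?P = "\<lambda>F. LINT \<gamma>:\<Lambda>|lebesgue. (norm (F \<gamma>))\<^sup>2"
  let ?S = "\<lambda>F. \<Sum>\<^sub>\<infinity>x\<in>E. (norm (ifourier F x))\<^sup>2"
  obtain B where B: "B > 0" "\<And>F. L2_on \<Lambda> F \<Longrightarrow> (\<lambda>x. (norm (ifourier F x))^2) summable_on E"
    "\<And>F. L2_on \<Lambda> F \<Longrightarrow> ?S F \<le> B * ?P F"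
    using infsum_sampling_le[OF sep cpt] by blast
  obtain c where c: "c > 0" "\<And>F. L2_on \<Lambda> F \<Longrightarrow> ?P F \<le> c * ?S F"
    using sampling_lower_bound_L2_on[OF sep cpt cvx sym bal] by blast
  have HL: "L2_on \<Lambda> (?H F)" if "L2_on \<Lambda> F" for F by (rule L2_on_mult_bounded(1)[OF that Gmeas C])
  have lower: "1 / c * (LINT \<gamma>:\<Lambda>|lebesgue. (norm (F \<gamma>))\<^sup>2 * G \<gamma>)\<^sup>2 / ?P F \<le> ?S (?H F)"
    if F: "L2_on \<Lambda> F" "\<not> (AE \<gamma> in lebesgue. F \<gamma> = 0)" for F
  proof -
    have "(LINT \<gamma>:\<Lambda>|lebesgue. (norm (F \<gamma>))\<^sup>2 * G \<gamma>)\<^sup>2 / ?P F \<le> ?P (?H F)"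
      by (rule weighted_Cauchy_Schwarz[OF F(1) Gmeas C L2_on_integral_pos[OF F]])
    also have "\<dots> \<le> c * ?S (?H F)" by (rule c(2)[OF HL[OF F(1)]])
    finally have "(LINT \<gamma>:\<Lambda>|lebesgue. (norm (F \<gamma>))\<^sup>2 * G \<gamma>)\<^sup>2 / ?P F \<le> ?S (?H F) * c"
      by (simp only: mult.commute)
    then have "(LINT \<gamma>:\<Lambda>|lebesgue. (norm (F \<gamma>))\<^sup>2 * G \<gamma>)\<^sup>2 / ?P F / c \<le> ?S (?H F)"
      by (simp only: pos_divide_le_eq[OF c(1)])
    then show ?thesis by (simp add: mult.commute[of c])
  qed
  \<comment> \<open>The additional \<open>B\<close> keeps the constant positive when
    \<open>C\<close> is 0.\<close>
  have upper: "?S (?H F) \<le> (B * C\<^sup>2 + B) * ?P F" if F: "L2_on \<Lambda> F" "\<not> (AE \<gamma> in lebesgue. F \<gamma> = 0)" for F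
  proof -
    have "?S (?H F) \<le> B * ?P (?H F)" by (rule B(3)[OF HL[OF F(1)]])
    also have "\<dots> \<le> B * (C\<^sup>2 * ?P F)"
      using B(1) by (intro mult_left_mono L2_on_mult_bounded(2)[OF F(1) Gmeas C]) simp
    also have "\<dots> \<le> (B * C\<^sup>2 + B) * ?P F"
      using B(1) L2_on_integral_pos[OF F] by (simp add: distrib_right)
    finally show ?thesis .
  qed
  have "B * C\<^sup>2 + B > 0" using B(1) by (simp add: add_nonneg_pos)
  then show "\<exists>A>0. \<exists>B>0. \<forall>F. L2_on \<Lambda> F \<and> \<not> (AE \<gamma> in lebesgue. F \<gamma> = 0) \<longrightarrow>
      (\<lambda>x. (norm (ifourier (?H F) x))\<^sup>2) summable_on E \<and>
      A * (LINT \<gamma>:\<Lambda>|lebesgue. (norm (F \<gamma>))\<^sup>2 * G \<gamma>)\<^sup>2 / ?P F \<le> ?S (?H F) \<and> ?S (?H F) \<le> B * ?P F"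
    using c(1) B(2) HL lower upper
    by (intro exI[of _ "1 / c"] conjI exI[of _ "B * C\<^sup>2 + B"]) auto
next
  fix B1 F
  let ?H = "\<lambda>F \<gamma>. F \<gamma> * complex_of_real (G \<gamma>)"
  let ?P = "\<lambda>F. LINT \<gamma>:\<Lambda>|lebesgue. (norm (F \<gamma>))\<^sup>2"
  let ?S = "\<lambda>F. \<Sum>\<^sub>\<infinity>x\<in>E. (norm (ifourier F x))\<^sup>2"
  assume B1: "\<forall>F. L2_on \<Lambda> F \<longrightarrow> (\<lambda>x. (norm (ifourier F x))\<^sup>2) summable_on E \<and> ?S F \<le> B1 * ?P F"
  assume F: "L2_on \<Lambda> F \<and> \<not> (AE \<gamma> in lebesgue. F \<gamma> = 0)"
  obtain C where "AE \<gamma> in lebesgue. \<bar>G \<gamma>\<bar> \<le> C" using Gbdd by blast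
  then have L: "AE \<gamma> in lebesgue. \<bar>G \<gamma>\<bar> \<le> Linf_norm G" by (rule AE_le_Linf_norm[OF Gmeas])
  note H = L2_on_mult_bounded[OF conjunct1[OF F] Gmeas L]
  \<comment> \<open>The sign of \<open>B1\<close> is needed for monotonicity below; testing the
    assumed inequality on \<open>F\<close> itself, whose square integral is positive, supplies
    it.\<close>
  have "0 \<le> ?S F" by (rule infsum_nonneg) simp
  also have "\<dots> \<le> B1 * ?P F" using B1 F by blast
  finally have "B1 \<ge> 0"
    using L2_on_integral_pos[OF conjunct1[OF F] conjunct2[OF F]] by (simp add: zero_le_mult_iff)
  have "?S (?H F) \<le> B1 * ?P (?H F)" using B1 H(1) by blast
  also have "\<dots> \<le> B1 * ((Linf_norm G)\<^sup>2 * ?P F)" by (rule mult_left_mono[OF H(2) \<open>B1 \<ge> 0\<close>])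
  finally show "?S (?H F) \<le> B1 * (Linf_norm G)\<^sup>2 * ?P F" by (simp only: mult.assoc)
qed

end
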